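(* For $i\in I_{d(n-1)}$ one has $s_i^{-1}\in\mathcal O(M_\Omega(n,\mathfrak e))$, so that $r_{(i)}\in\mathcal O(M_\Omega(n,\mathfrak e))$, where $r_{(i)}=r_i/s_i$. Then $F(n,\mathfrak e)$ is the rational function field in $n^2$ variables $$F(n,\mathfrak e)=\mathbb C(r_{(1)},\ldots,r_{(d(n-1))},s_1,\ldots,s_{d(n-1)},r_{d(n-1)+1},\ldots,r_{d(n-1)+n}).$$ Furthermore one has the Poisson commutation relations: $r_{d(n-1)+k}$ Poisson commutes with every element of $F(n,\mathfrak e)$ for $k\in I_n$ and, for $i,j\in I_{d(n-1)}$, (1) $[r_{(i)},r_{(j)}]=0$; (2) $[r_{(i)},s_j]=\delta_{ij}$; (3) $[s_i,s_j]=0$.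
   Context: Fix a positive integer $n$. For $k\ge 0$ put $d(k)=k(k+1)/2$ and $I_k=\{1,\dots,k\}$. $M(n)$ is the space of complex $n\times n$ matrices; for $x\in M(n)$ and $m\in I_n$, $x_m$ is the upper left $m\times m$ block of $x$. $M_\Omega(n)$ is the Zariski open set of all $x\in M(n)$ such that $x_m$ has $m$ distinct eigenvalues for every $m\in I_n$, and $x_m,x_{m+1}$ have no common eigenvalue for every $m\in I_{n-1}$. $\mathfrak e_{\Omega(n)}$ is the set of all $\nu=(\nu(1),\dots,\nu(n))$, $\nu(m)=\mathrm{diag}(\nu_{1\,m},\dots,\nu_{m\,m})$, such that for each $m\in I_n$ the numbers $\nu_{1\,m},\dots,\nu_{m\,m}$ are distinct and $\nu_{i\,m}\ne\nu_{j\,m+1}$ for all $m\in I_{n-1}$, $i\in I_m$, $j\in I_{m+1}$; it is a Zariski open subset of $\mathbb C^{d(n)}$. Let $$M_\Omega(n,\mathfrak e)=\{(\nu,x)\in\mathfrak e_{\Omega(n)}\times M_\Omega(n)\mid \nu(m)\text{ is } Gl(m)\text{-conjugate to }x_m\ \forall m\in I_n\},$$ with projection $\pi_n(\nu,x)=x$; it is a nonsingular affine variety of dimension $n^2$, with affine ring $\mathcal O(M_\Omega(n,\mathfrak e))$ and function field $F(n,\mathfrak e)$. For $m\in I_n$, $k\in I_m$ let $r_{d(m-1)+k}(\nu,x)=\nu_{k\,m}$; this defines regular functions $r_i$ ($i\in I_{d(n)}$) on $M_\Omega(n,\mathfrak e)$. Poisson structure: on $M(n)$, $[f,g](x)=\mathrm{tr}(x[\nabla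 f(x),\nabla g(x)])$, where $\mathrm{tr}(\nabla f(x)v)=df_x(v)$. Since $\pi_n$ is a local analytic isomorphism onto $M_\Omega(n)$, the structure lifts to $M_\Omega(n,\mathfrak e)$, makes $\mathcal O(M_\Omega(n,\mathfrak e))$ a Poisson algebra, and extends to $F(n,\mathfrak e)$. For a function $\varphi$, $\xi_\varphi$ is the vector field with $\xi_\varphi\psi=[\varphi,\psi]$. Torus: the vector fields $\xi_{r_j}$, $j\in I_{d(n-1)}$, commute and have globally defined complex flows, trivial for times in $2\pi i\,\mathbb Z$. Hence they define an action on $M_\Omega(n,\mathfrak e)$ of the torus $A_{\mathfrak r}\cong(\mathbb C^\times)^{d(n-1)}$ with coordinates $\zeta_1,\dots,\zeta_{d(n-1)}$, normalized as follows: if $b_q$ has $\zeta_j(b_q)=e^q$ and all other coordinates $1$, and $(b\cdot f)(z)=f(b^{-1}\cdot z)$, then $\frac{d}{dq}\big|_{q=0}\,b_q\cdot f=\xi_{r_j}f$. $\mathfrak b_e$ is the set of $x\in M(n)$ with $x_{i+1,i}=1$ for all $i\in I_{n-1}$ and $x_{i,j}=0$ for $i>j+1$ (Hessenberg matrices). Put $M_\Omega(n,\mathfrak e,\mathfrak b)=\pi_n^{-1}(\mathfrak b_e\cap M_\Omega(n))$. Every $z\in M_\Omega(n,\mathfrak e)$ is uniquely $z=b\cdot y$ with $b\in A_{\mathfrak r}$, $y\in M_\Omega(n,\mathfrak e,\mathfrak b)$; the regular functions $s_j$, $j\in I_{d(n-1)}$, are defined by $s_j(z)=\zeta_j(b^{-1})$.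 *)

theory Defs
  imports
    "Jordan_Normal_Form.Spectral_Radius"
    "HOL-Algebra.Generated_Fields"
    "HOL-Algebra.Indexed_Polynomials"
    "HOL-Analysis.Function_Topology"
    "HOL-Analysis.Complex_Transcendental"
begin

section \<open>Rational function fields\<close>

text \<open>
  Polynomials in commuting variables indexed by \<open>I\<close> with coefficients in \<open>K\<close> are those of
  \<^theory>\<open>HOL-Algebra.Indexed_Polynomials\<close>: coefficient functions on monomials, a monomial
  being the multiset of its variables.
\<close>

definition indexed_poly_value ::
    "('a, 'm) ring_scheme \<Rightarrow> ('i \<Rightarrow> 'a) \<Rightarrow> ('i multiset \<Rightarrow> 'a) \<Rightarrow> 'a" where
  "indexed_poly_value F g P =
     (\<Oplus>\<^bsub>F\<^esub> m \<in> {m. P m \<noteq> \<zero>\<^bsub>F\<^esub>}. P m \<otimes>\<^bsub>F\<^esub> (\<Otimes>\<^bsub>F\<^esub> i \<in> set_mset m. g i [^]\<^bsub>F\<^esub> count m i))"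

definition alg_independent_family ::
    "('a, 'm) ring_scheme \<Rightarrow> 'a set \<Rightarrow> 'i set \<Rightarrow> ('i \<Rightarrow> 'a) \<Rightarrow> bool" where
  "alg_independent_family F K I g \<longleftrightarrow>
     (\<forall>P \<in> ring.indexed_pset F I K. indexed_poly_value F g P = \<zero>\<^bsub>F\<^esub> \<longrightarrow> P = (\<lambda>_. \<zero>\<^bsub>F\<^esub>))"

text \<open>\<open>F = K(g\<^sub>i | i \<in> I)\<close> is the rational function field in the variables \<open>g\<^sub>i\<close>.\<close>

definition is_rational_function_field ::
    "('a, 'm) ring_scheme \<Rightarrow> 'a set \<Rightarrow> 'i set \<Rightarrow> ('i \<Rightarrow> 'a) \<Rightarrow> bool" where
  "is_rational_function_field F K I g \<longleftrightarrow>
     field F \<and> subfield K F \<and> g ` I \<subseteq> carrier F \<and>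
     alg_independent_family F K I g \<and>
     generate_field F (K \<union> g ` I) = carrier F"


section \<open>The variety of matrices with ordered eigenvalues of the upper left blocks\<close>

text \<open>
  Matrix entries are indexed from \<open>0\<close>, as in \<^theory>\<open>Jordan_Normal_Form.Matrix\<close>; all other
  indices run from \<open>1\<close>.  A point \<open>(\<nu>, x)\<close> has \<open>\<nu> k m = \<nu>\<^sub>k\<^sub>m\<close> for \<open>1 \<le> k \<le> m \<le> n\<close>; the
  remaining values of \<open>\<nu>\<close> are set to \<open>0\<close>, so that \<open>\<nu>\<close> amounts to a point of affine
  \<open>d(n)\<close>-space.
\<close>

type_synonym gz_point = "(nat \<Rightarrow> nat \<Rightarrow> complex) \<times> complex mat"

definition gz_d :: "nat \<Rightarrow> nat" where
  "gz_d k = k * (k + 1) div 2"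

definition upper_left_block :: "nat \<Rightarrow> 'a mat \<Rightarrow> 'a mat" where
  "upper_left_block m x = Matrix.mat m m (\<lambda>(i, j). x $$ (i, j))"

definition M_Omega :: "nat \<Rightarrow> complex mat set" where
  "M_Omega n = {x \<in> carrier_mat n n.
     (\<forall>m \<in> {1..n}. card (spectrum (upper_left_block m x)) = m) \<and>
     (\<forall>m \<in> {1..n - 1}.
        spectrum (upper_left_block m x) \<inter> spectrum (upper_left_block (m + 1) x) = {})}"

definition e_Omega :: "nat \<Rightarrow> (nat \<Rightarrow> nat \<Rightarrow> complex) set" where
  "e_Omega n = {\<nu>.
     (\<forall>k m. \<not> (1 \<le> k \<and> k \<le> m \<and> m \<le> n) \<longrightarrow> \<nu> k m = 0) \<and>
     (\<forall>m \<in> {1..n}. inj_on (\<lambda>k. \<nu> k m) {1..m}) \<and>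
     (\<forall>m \<in> {1..n - 1}. \<forall>i \<in> {1..m}. \<forall>j \<in> {1..m + 1}. \<nu> i m \<noteq> \<nu> j (m + 1))}"

definition gz_diag :: "(nat \<Rightarrow> nat \<Rightarrow> complex) \<Rightarrow> nat \<Rightarrow> complex mat" where
  "gz_diag \<nu> m = mat_diag m (\<lambda>i. \<nu> (Suc i) m)"

definition M_Omega_e :: "nat \<Rightarrow> gz_point set" where
  "M_Omega_e n = {(\<nu>, x). \<nu> \<in> e_Omega n \<and> x \<in> M_Omega n \<and>
     (\<forall>m \<in> {1..n}. similar_mat (gz_diag \<nu> m) (upper_left_block m x))}"

text \<open>\<open>r\<^bsub>d(m-1)+k\<^esub> (\<nu>, x) = \<nu>\<^sub>k\<^sub>m\<close>; every index \<open>i \<ge> 1\<close> is \<open>d(m-1)+k\<close> for exactly one pair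
  \<open>1 \<le> k \<le> m\<close>.\<close>

definition gz_r :: "nat \<Rightarrow> gz_point \<Rightarrow> complex" where
  "gz_r i z = (THE c. \<exists>m k. 1 \<le> k \<and> k \<le> m \<and> i = gz_d (m - 1) + k \<and> c = fst z k m)"


section \<open>Regular functions and the function field\<close>

inductive_set gz_polynomial :: "nat \<Rightarrow> (gz_point \<Rightarrow> complex) set" for n :: nat where
  const: "(\<lambda>_. c) \<in> gz_polynomial n"
| eigen: "1 \<le> k \<Longrightarrow> k \<le> m \<Longrightarrow> m \<le> n \<Longrightarrow> (\<lambda>z. fst z k m) \<in> gz_polynomial n"
| entry: "i < n \<Longrightarrow> j < n \<Longrightarrow> (\<lambda>z. snd z $$ (i, j)) \<in> gz_polynomial n"
| add: "p \<in> gz_polynomial n \<Longrightarrow> q \<in> gz_polynomial n \<Longrightarrow> (\<lambda>z. p z + q z) \<in> gz_polynomial n"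
| mult: "p \<in> gz_polynomial n \<Longrightarrow> q \<in> gz_polynomial n \<Longrightarrow> (\<lambda>z. p z * q z) \<in> gz_polynomial n"

definition gz_zariski_open :: "nat \<Rightarrow> gz_point set \<Rightarrow> bool" where
  "gz_zariski_open n U \<longleftrightarrow>
     (\<exists>S \<subseteq> gz_polynomial n. U = {z \<in> M_Omega_e n. \<exists>p \<in> S. p z \<noteq> 0})"

text \<open>Only the values on \<open>U\<close> of a function \<open>f\<close> regular on \<open>U\<close> carry meaning.\<close>

definition gz_regular_on :: "nat \<Rightarrow> gz_point set \<Rightarrow> (gz_point \<Rightarrow> complex) \<Rightarrow> bool" where
  "gz_regular_on n U f \<longleftrightarrow>
     (\<forall>z \<in> U. \<exists>V g h. gz_zariski_open n V \<and> z \<in> V \<and> V \<subseteq> U \<and>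
        g \<in> gz_polynomial n \<and> h \<in> gz_polynomial n \<and>
        (\<forall>w \<in> V. h w \<noteq> 0 \<and> f w = g w / h w))"

definition gz_O :: "nat \<Rightarrow> (gz_point \<Rightarrow> complex) set" where
  "gz_O n = {f. gz_regular_on n (M_Omega_e n) f}"

text \<open>
  A rational function is an equivalence class of pairs \<open>(U, f)\<close> with \<open>f\<close> regular on the nonempty
  Zariski open set \<open>U\<close>, two pairs being equivalent if the functions agree where both are defined.
\<close>

definition gz_rat_reps :: "nat \<Rightarrow> (gz_point set \<times> (gz_point \<Rightarrow> complex)) set" where
  "gz_rat_reps n = {(U, f). gz_zariski_open n U \<and> U \<noteq> {} \<and> gz_regular_on n U f}"

definition gz_rat_rel ::
    "nat \<Rightarrow> ((gz_point set \<times> (gz_point \<Rightarrow> complex)) \<times> (gz_point set \<times> (gz_point \<Rightarrow> complex))) set"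
  where
  "gz_rat_rel n = {((U, f), (V, g)). (U, f) \<in> gz_rat_reps n \<and> (V, g) \<in> gz_rat_reps n \<and>
     (\<forall>z \<in> U \<inter> V. f z = g z)}"

type_synonym gz_rational = "(gz_point set \<times> (gz_point \<Rightarrow> complex)) set"

definition gz_rat_class :: "nat \<Rightarrow> gz_point set \<Rightarrow> (gz_point \<Rightarrow> complex) \<Rightarrow> gz_rational" where
  "gz_rat_class n U f = gz_rat_rel n `` {(U, f)}"

definition gz_rat_lift2 ::
    "nat \<Rightarrow> ((gz_point \<Rightarrow> complex) \<Rightarrow> (gz_point \<Rightarrow> complex) \<Rightarrow> gz_point \<Rightarrow> complex) \<Rightarrow>
     gz_rational \<Rightarrow> gz_rational \<Rightarrow> gz_rational" where
  "gz_rat_lift2 n op A B = (\<Union>(U, f) \<in> A. \<Union>(V, g) \<in> B. gz_rat_class n (U \<inter> V) (op f g))"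

definition gz_rat :: "nat \<Rightarrow> (gz_point \<Rightarrow> complex) \<Rightarrow> gz_rational" where
  "gz_rat n f = gz_rat_class n (M_Omega_e n) f"

definition gz_F :: "nat \<Rightarrow> gz_rational ring" where
  "gz_F n = \<lparr>carrier = gz_rat_reps n // gz_rat_rel n,
     mult = gz_rat_lift2 n (\<lambda>f g z. f z * g z),
     one = gz_rat n (\<lambda>_. 1),
     zero = gz_rat n (\<lambda>_. 0),
     add = gz_rat_lift2 n (\<lambda>f g z. f z + g z)\<rparr>"

definition gz_scalars :: "nat \<Rightarrow> gz_rational set" where
  "gz_scalars n = range (\<lambda>c. gz_rat n (\<lambda>_. c))"


section \<open>The Poisson structure\<close>

definition matrix_trace :: "'a :: comm_monoid_add mat \<Rightarrow> 'a" where
  "matrix_trace A = (\<Sum>i < dim_row A. A $$ (i, i))"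

text \<open>For a function \<open>f\<close> holomorphic near \<open>x\<close>, \<open>df\<^sub>x(v)\<close> is the complex derivative of
  \<open>f (x + t v)\<close> at \<open>t = 0\<close>.\<close>

definition mat_gradient :: "nat \<Rightarrow> (complex mat \<Rightarrow> complex) \<Rightarrow> complex mat \<Rightarrow> complex mat" where
  "mat_gradient n f x = (THE G. G \<in> carrier_mat n n \<and>
     (\<forall>v \<in> carrier_mat n n.
        ((\<lambda>t. f (x + t \<cdot>\<^sub>m v)) has_field_derivative matrix_trace (G * v)) (at 0)))"

definition mat_bracket ::
    "nat \<Rightarrow> (complex mat \<Rightarrow> complex) \<Rightarrow> (complex mat \<Rightarrow> complex) \<Rightarrow> complex mat \<Rightarrow> complex" where
  "mat_bracket n f g x =
     matrix_trace (x * (mat_gradient n f x * mat_gradient n g x -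
                        mat_gradient n g x * mat_gradient n f x))"

text \<open>The usual topology of \<open>M(n)\<close>: entrywise convergence.\<close>

definition mat_topology :: "nat \<Rightarrow> complex mat topology" where
  "mat_topology n =
     pullback_topology (carrier_mat n n)
       (\<lambda>x i j. if i < n \<and> j < n then x $$ (i, j) else 0) euclidean"

text \<open>\<open>\<sigma>\<close> is the local inverse on \<open>U\<close> of the projection \<open>(\<nu>, x) \<mapsto> x\<close> that passes through \<open>z\<close>.
  The continuity of its second component is automatic, and since the projection is a local
  analytic isomorphism a continuous local inverse is analytic.\<close>

definition gz_local_inverse ::
    "nat \<Rightarrow> gz_point \<Rightarrow> complex mat set \<Rightarrow> (complex mat \<Rightarrow> gz_point) \<Rightarrow> bool" where
  "gz_local_inverse n z U \<sigma> \<longleftrightarrow>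
     openin (mat_topology n) U \<and> U \<subseteq> M_Omega n \<and> snd z \<in> U \<and> \<sigma> (snd z) = z \<and>
     (\<forall>y \<in> U. \<sigma> y \<in> M_Omega_e n \<and> snd (\<sigma> y) = y) \<and>
     continuous_map (subtopology (mat_topology n) U) euclidean (\<lambda>y. fst (\<sigma> y))"

text \<open>The bracket lifted through the projection; the value does not depend on the choice of the
  local inverse, because two of them agree near \<open>snd z\<close>.\<close>

definition gz_bracket ::
    "nat \<Rightarrow> (gz_point \<Rightarrow> complex) \<Rightarrow> (gz_point \<Rightarrow> complex) \<Rightarrow> gz_point \<Rightarrow> complex" where
  "gz_bracket n \<phi> \<psi> z = (THE c. \<exists>U \<sigma>. gz_local_inverse n z U \<sigma> \<and>
     c = mat_bracket n (\<phi> \<circ> \<sigma>) (\<psi> \<circ> \<sigma>) (snd z))"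

definition gz_F_bracket :: "nat \<Rightarrow> gz_rational \<Rightarrow> gz_rational \<Rightarrow> gz_rational" where
  "gz_F_bracket n = gz_rat_lift2 n (gz_bracket n)"


section \<open>The torus action and the functions \<open>s\<^sub>j\<close>\<close>

text \<open>Complex integral curves of the vector field \<open>\<xi>\<^sub>\<phi>\<close>, \<open>\<xi>\<^sub>\<phi> \<psi> = [\<phi>, \<psi>]\<close>, and its flow.  The
  regular functions include all coordinates, so they determine tangent vectors.\<close>

definition gz_integral_curve ::
    "nat \<Rightarrow> (gz_point \<Rightarrow> complex) \<Rightarrow> gz_point \<Rightarrow> (complex \<Rightarrow> gz_point) \<Rightarrow> bool" where
  "gz_integral_curve n \<phi> z \<gamma> \<longleftrightarrow>
     \<gamma> 0 = z \<and> range \<gamma> \<subseteq> M_Omega_e n \<and>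
     (\<forall>\<psi> \<in> gz_O n. \<forall>t. ((\<lambda>q. \<psi> (\<gamma> q)) has_field_derivative gz_bracket n \<phi> \<psi> (\<gamma> t)) (at t))"

definition gz_flow ::
    "nat \<Rightarrow> (gz_point \<Rightarrow> complex) \<Rightarrow> complex \<Rightarrow> gz_point \<Rightarrow> gz_point" where
  "gz_flow n \<phi> t z = (THE w. \<exists>\<gamma>. gz_integral_curve n \<phi> z \<gamma> \<and> w = \<gamma> t)"

text \<open>A torus element is given by its coordinates \<open>\<zeta>\<^sub>1, \<dots>, \<zeta>\<^bsub>d(n-1)\<^esub>\<close>.\<close>

definition gz_torus :: "nat \<Rightarrow> (nat \<Rightarrow> complex) set" where
  "gz_torus n = {1..gz_d (n - 1)} \<rightarrow>\<^sub>E (UNIV - {0})"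

text \<open>
  If \<open>b\<^sub>q\<close> has \<open>\<zeta>\<^sub>j(b\<^sub>q) = e\<^sup>q\<close> and all other coordinates \<open>1\<close>, the normalisation
  \<open>d/dq f(b\<^sub>q\<^sup>-\<^sup>1 z) = (\<xi>\<^bsub>r\<^sub>j\<^esub> f)(z)\<close> at \<open>q = 0\<close> says that \<open>q \<mapsto> b\<^sub>q\<^sup>-\<^sup>1 z\<close> is the integral curve
  of \<open>\<xi>\<^bsub>r\<^sub>j\<^esub>\<close> through \<open>z\<close>; hence \<open>b\<^sub>q\<close> acts as the flow at time \<open>-q\<close>.  The flows commute and are
  trivial for times in \<open>2\<pi>i\<int>\<close>, so neither the order of composition nor the branch of the logarithm
  matters.
\<close>

definition gz_torus_act :: "nat \<Rightarrow> (nat \<Rightarrow> complex) \<Rightarrow> gz_point \<Rightarrow> gz_point" where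
  "gz_torus_act n b z =
     fold (\<lambda>j. gz_flow n (gz_r j) (- Ln (b j))) [1..<Suc (gz_d (n - 1))] z"

definition hessenberg_mats :: "nat \<Rightarrow> complex mat set" where
  "hessenberg_mats n = {x \<in> carrier_mat n n.
     (\<forall>i. i + 1 < n \<longrightarrow> x $$ (i + 1, i) = 1) \<and>
     (\<forall>i < n. \<forall>j < n. i > j + 1 \<longrightarrow> x $$ (i, j) = 0)}"

definition M_Omega_e_b :: "nat \<Rightarrow> gz_point set" where
  "M_Omega_e_b n = {z \<in> M_Omega_e n. snd z \<in> hessenberg_mats n \<inter> M_Omega n}"

definition gz_torus_part :: "nat \<Rightarrow> gz_point \<Rightarrow> nat \<Rightarrow> complex" where
  "gz_torus_part n z = (THE b. b \<in> gz_torus n \<and> (\<exists>y \<in> M_Omega_e_b n. z = gz_torus_act n b y))"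

definition gz_s :: "nat \<Rightarrow> nat \<Rightarrow> gz_point \<Rightarrow> complex" where
  "gz_s n j z = inverse (gz_torus_part n z j)"

definition gz_r_over_s :: "nat \<Rightarrow> nat \<Rightarrow> gz_point \<Rightarrow> complex" where
  "gz_r_over_s n i z = gz_r i z / gz_s n i z"

text \<open>The \<open>n\<^sup>2 = 2 d(n-1) + n\<close> generators in the order
  \<open>r\<^bsub>(1)\<^esub>, \<dots>, r\<^bsub>(d(n-1))\<^esub>, s\<^sub>1, \<dots>, s\<^bsub>d(n-1)\<^esub>, r\<^bsub>d(n-1)+1\<^esub>, \<dots>, r\<^bsub>d(n-1)+n\<^esub>\<close>.\<close>

definition gz_generator :: "nat \<Rightarrow> nat \<Rightarrow> gz_rational" where
  "gz_generator n l =
     (let d = gz_d (n - 1) in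
      if l \<le> d then gz_rat n (gz_r_over_s n l)
      else if l \<le> 2 * d then gz_rat n (gz_s n (l - d))
      else gz_rat n (gz_r (d + (l - 2 * d))))"

end

theory Submission
  imports Defs
begin

text \<open>
  For \<open>m < n\<close> normalise the eigenvector of \<open>x\<^sub>m\<close> with eigenvalue \<open>\<nu>\<^sub>k\<^sub>m\<close> to have last
  coordinate \<open>1\<close>, and let \<open>\<sigma>\<^sub>m\<^sub>k\<close> be the product of row \<open>m + 1\<close> of \<open>x\<^bsub>m+1\<^esub>\<close> (without its
  diagonal entry) with it.  On Hessenberg matrices \<open>\<sigma> = 1\<close>, and the flow of \<open>\<nu>\<^sub>k\<^sub>m\<close> preserves all
  eigenvalues, multiplies \<open>\<sigma>\<^sub>m\<^sub>k\<close> by \<open>e\<^sup>t\<close> and preserves the other \<open>\<sigma>\<close>.  Given \<open>\<nu>\<close> and nonzero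
  values of \<open>\<sigma>\<close>, the matrix can be rebuilt uniquely and rationally, block by block: the last column
  of \<open>x\<^bsub>m+1\<^esub>\<close> in the eigenbasis of \<open>x\<^sub>m\<close> solves an invertible Cauchy system.  Hence \<open>s = \<sigma>\<close>, a
  point is determined by \<open>(r, s)\<close>, the variety is an open subset of an affine space in these
  coordinates, and so its function field is rational.

  The gradient of \<open>\<nu>\<^sub>k\<^sub>m\<close> is the spectral projector \<open>P\<close>, so that \<open>\<xi> = [x, P]\<close>.  Since
  \<open>[f, g]\<close> is the derivative of \<open>g\<close> in the direction \<open>[x, \<nabla>f]\<close>, the bracket of two \<open>\<sigma>\<close> of
  different levels vanishes because \<open>\<sigma>\<^sub>l\<^sub>j\<close> is invariant under conjugation by matrices in
  \<open>GL(l)\<close> with last row \<open>(0, \<dots>, 0, 1)\<close>; on equal levels it is computed from the derivatives of the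
  eigenvectors.
\<close>

text \<open>Gradients, brackets, flows and the torus part are all definite descriptions, so each of
  them calls for a uniqueness proof. Local inverses of the projection are only known to be
  continuous; the derivative of an eigenvalue is therefore drawn from continuity alone, and
  \<open>has_gradient\<close> tests a function along every curve whose matrix entries are
  differentiable. Integral curves are unique because along them each eigenvalue and each
  \<open>sval\<close> satisfies \<open>f' = c f\<close> with a constant \<open>c\<close>. The other
  recurring device is \<open>rat_closure\<close>, the rational expressions whose denominators vanish
  nowhere on the variety. Eigenvalues with matrix entries and eigenvalues with \<open>sval\<close>
  generate the same class. This gives the regularity of \<open>s\<close>, carries velocities from
  the new coordinates over to the matrix, and turns polynomial conditions on the variety into
  polynomial conditions on affine space, where irreducibility becomes a question about
  lines.\<close>

section \<open>Explicit inverse matrices and bases of eigenvectors\<close>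

definition matinv :: "complex mat \<Rightarrow> complex mat" where
  "matinv A = Matrix.mat (dim_row A) (dim_row A) (\<lambda>(i, j). inverse (det A) * adj_mat A $$ (i, j))"

lemma mat_mult_entry:
  assumes "A \<in> carrier_mat m m" "B \<in> carrier_mat m m" "i < m" "j < m"
  shows "(A * B) $$ (i, j) = (\<Sum>l<m. A $$ (i, l) * B $$ (l, j))"
  using assms by (auto simp: scalar_prod_def atLeast0LessThan intro!: sum.cong)

lemma matinv_left:
  assumes A: "A \<in> carrier_mat m m" and d: "det A \<noteq> 0" and "i < m" "j < m"
  shows "(\<Sum>l<m. matinv A $$ (i, l) * A $$ (l, j)) = (if i = j then 1 else 0)"
proof -
  have "(\<Sum>l<m. adj_mat A $$ (i, l) * A $$ (l, j)) = (det A \<cdot>\<^sub>m 1\<^sub>m m) $$ (i, j)"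
    using mat_mult_entry[OF adj_mat(1)[OF A] A] adj_mat(3)[OF A] assms by metis
  also have "\<dots> = (if i = j then det A else 0)" using assms by simp
  finally have *: "(\<Sum>l<m. adj_mat A $$ (i, l) * A $$ (l, j)) = (if i = j then det A else 0)" .
  have "(\<Sum>l<m. matinv A $$ (i, l) * A $$ (l, j)) =
      inverse (det A) * (\<Sum>l<m. adj_mat A $$ (i, l) * A $$ (l, j))"
    unfolding sum_distrib_left using assms by (intro sum.cong) (auto simp: matinv_def)
  then show ?thesis using * d by simp
qed

lemma matinv_right:
  assumes A: "A \<in> carrier_mat m m" and d: "det A \<noteq> 0" and "i < m" "j < m"
  shows "(\<Sum>l<m. A $$ (i, l) * matinv A $$ (l, j)) = (if i = j then 1 else 0)"
proof -
  have "(\<Sum>l<m. A $$ (i, l) * adj_mat A $$ (l, j)) = (det A \<cdot>\<^sub>m 1\<^sub>m m) $$ (i, j)"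
    using mat_mult_entry[OF A adj_mat(1)[OF A]] adj_mat(2)[OF A] assms by metis
  also have "\<dots> = (if i = j then det A else 0)" using assms by simp
  finally have *: "(\<Sum>l<m. A $$ (i, l) * adj_mat A $$ (l, j)) = (if i = j then det A else 0)" .
  have "(\<Sum>l<m. A $$ (i, l) * matinv A $$ (l, j)) =
      inverse (det A) * (\<Sum>l<m. A $$ (i, l) * adj_mat A $$ (l, j))"
    unfolding sum_distrib_left using assms by (intro sum.cong) (auto simp: matinv_def)
  then show ?thesis using * d by simp
qed

lemma sum_swap_delta:
  fixes f :: "nat \<Rightarrow> 'a::comm_semiring_1"
  assumes "\<And>i j. i < m \<Longrightarrow> j < m \<Longrightarrow> (\<Sum>l<m. B i l * C l j) = (if i = j then 1 else 0)" "i < m"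
  shows "(\<Sum>l<m. B i l * (\<Sum>j<m. C l j * f j)) = f i"
    and "(\<Sum>l<m. (\<Sum>j<m. f j * B j l) * C l i) = f i"
proof -
  have "(\<Sum>l<m. B i l * (\<Sum>j<m. C l j * f j)) = (\<Sum>j<m. (\<Sum>l<m. B i l * C l j) * f j)"
    unfolding sum_distrib_left sum_distrib_right by (subst sum.swap) (simp add: mult.assoc)
  also have "\<dots> = (\<Sum>j<m. if i = j then f j else 0)"
    using assms by (intro sum.cong) auto
  finally show "(\<Sum>l<m. B i l * (\<Sum>j<m. C l j * f j)) = f i" using \<open>i < m\<close> by simp
  have "(\<Sum>l<m. (\<Sum>j<m. f j * B j l) * C l i) = (\<Sum>j<m. f j * (\<Sum>l<m. B j l * C l i))"
    unfolding sum_distrib_left sum_distrib_right by (subst sum.swap) (simp add: mult.assoc)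
  also have "\<dots> = (\<Sum>j<m. if j = i then f j else 0)"
    using assms by (intro sum.cong) auto
  finally show "(\<Sum>l<m. (\<Sum>j<m. f j * B j l) * C l i) = f i" using \<open>i < m\<close> by simp
qed

lemma matinv_apply:
  assumes "A \<in> carrier_mat m m" "det A \<noteq> 0" "i < m"
  shows "(\<Sum>l<m. A $$ (i, l) * (\<Sum>j<m. matinv A $$ (l, j) * f j)) = f i"
    and "(\<Sum>l<m. matinv A $$ (i, l) * (\<Sum>j<m. A $$ (l, j) * f j)) = f i"
    and "(\<Sum>l<m. (\<Sum>j<m. f j * matinv A $$ (j, l)) * A $$ (l, i)) = f i"
    and "(\<Sum>l<m. (\<Sum>j<m. f j * A $$ (j, l)) * matinv A $$ (l, i)) = f i"
proof -
  show "(\<Sum>l<m. A $$ (i, l) * (\<Sum>j<m. matinv A $$ (l, j) * f j)) = f i"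
    by (rule sum_swap_delta(1)) (use assms matinv_right in auto)
  show "(\<Sum>l<m. matinv A $$ (i, l) * (\<Sum>j<m. A $$ (l, j) * f j)) = f i"
    by (rule sum_swap_delta(1)) (use assms matinv_left in auto)
  show "(\<Sum>l<m. (\<Sum>j<m. f j * matinv A $$ (j, l)) * A $$ (l, i)) = f i"
    by (rule sum_swap_delta(2)) (use assms matinv_left in auto)
  show "(\<Sum>l<m. (\<Sum>j<m. f j * A $$ (j, l)) * matinv A $$ (l, i)) = f i"
    by (rule sum_swap_delta(2)) (use assms matinv_right in auto)
qed

lemma matinv_solve:
  assumes "A \<in> carrier_mat m m" "det A \<noteq> 0"
    and "\<And>i. i < m \<Longrightarrow> (\<Sum>j<m. A $$ (i, j) * y j) = b i" "i < m"
  shows "y i = (\<Sum>j<m. matinv A $$ (i, j) * b j)"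
  using matinv_apply(2)[OF assms(1,2,4), of y] assms(3) by simp

lemma matinv_solve_row:
  assumes "A \<in> carrier_mat m m" "det A \<noteq> 0"
    and "\<And>j. j < m \<Longrightarrow> (\<Sum>i<m. y i * A $$ (i, j)) = b j" "j < m"
  shows "y j = (\<Sum>i<m. b i * matinv A $$ (i, j))"
  using matinv_apply(4)[OF assms(1,2,4), of y] assms(3) by simp

lemma det_nonzeroI:
  fixes A :: "complex mat"
  assumes A: "A \<in> carrier_mat m m"
    and ker: "\<And>c. (\<And>i. i < m \<Longrightarrow> (\<Sum>j<m. A $$ (i, j) * c j) = 0) \<Longrightarrow> (\<forall>j<m. c j = 0)"
  shows "det A \<noteq> 0"
proof
  assume "det A = 0"
  then obtain v where v: "v \<in> carrier_vec m" "v \<noteq> 0\<^sub>v m" "A *\<^sub>v v = 0\<^sub>v m"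
    using det_0_iff_vec_prod_zero[OF A] by auto
  have "(\<Sum>j<m. A $$ (i, j) * v $ j) = 0" if "i < m" for i
  proof -
    have "(A *\<^sub>v v) $ i = (\<Sum>j<m. A $$ (i, j) * v $ j)"
      using A v(1) that by (auto simp: scalar_prod_def atLeast0LessThan intro!: sum.cong)
    then show ?thesis using v that by simp
  qed
  then have "\<forall>j<m. v $ j = 0" using ker by blast
  then have "v = 0\<^sub>v m" using v(1) by auto
  then show False using v by simp
qed

text \<open>Vectors are plain functions of which only the values below \<open>m\<close> count, and
  the block is read off from \<open>x\<close> itself, so that passing to a smaller or larger block
  needs no conversion. The zero vector qualifies; nonvanishing is always stated separately.\<close>

definition eigvec :: "complex mat \<Rightarrow> nat \<Rightarrow> complex \<Rightarrow> (nat \<Rightarrow> complex) \<Rightarrow> bool" where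
  "eigvec x m l v \<longleftrightarrow> (\<forall>i<m. (\<Sum>j<m. x $$ (i, j) * v j) = l * v i)"

text \<open>Applying \<open>x - l p\<close> to a linear relation removes its last vector and
  multiplies the other coefficients by \<open>l k - l p\<close>, which is nonzero; induction on the
  number of vectors does the rest.\<close>

lemma eigvec_independent:
  fixes p :: nat
  assumes "\<And>k. k < p \<Longrightarrow> eigvec x m (l k) (v k)" "\<And>k. k < p \<Longrightarrow> \<exists>i<m. v k i \<noteq> 0"
    and "inj_on l {..<p}" "\<And>i. i < m \<Longrightarrow> (\<Sum>k<p. v k i * c k) = 0"
  shows "\<forall>k<p. c k = 0"
  using assms
proof (induction p arbitrary: c)
  case (Suc p)
  have "(\<Sum>k<p. v k i * (c k * (l k - l p))) = 0" if i: "i < m" for i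
  proof -
    have "0 = (\<Sum>j<m. x $$ (i, j) * (\<Sum>k<Suc p. v k j * c k))"
      using Suc.prems(4) by simp
    also have "\<dots> = (\<Sum>k<Suc p. (\<Sum>j<m. x $$ (i, j) * v k j) * c k)"
      unfolding sum_distrib_left sum_distrib_right by (subst sum.swap) (simp add: mult.assoc)
    also have "\<dots> = (\<Sum>k<Suc p. l k * v k i * c k)"
      using Suc.prems(1) i by (intro sum.cong) (auto simp: eigvec_def)
    finally have "(\<Sum>k<Suc p. l k * v k i * c k) - l p * (\<Sum>k<Suc p. v k i * c k) = 0"
      using Suc.prems(4) i by simp
    then show ?thesis by (simp add: sum_distrib_left sum_subtractf algebra_simps)
  qed
  then have "\<forall>k<p. c k * (l k - l p) = 0"
    by (intro Suc.IH) (use Suc.prems in \<open>auto simp: inj_on_def\<close>)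
  moreover have "l k \<noteq> l p" if "k < p" for k
    using Suc.prems(3) that by (auto simp: inj_on_def)
  ultimately have 0: "\<forall>k<p. c k = 0" by auto
  obtain i where i: "i < m" "v p i \<noteq> 0" using Suc.prems(2) by blast
  have "v p i * c p = 0" using Suc.prems(4)[OF i(1)] 0 by simp
  then show ?case using 0 i by (auto simp: less_Suc_eq)
qed simp

lemma eigvec_det:
  assumes V: "V \<in> carrier_mat m m" and "\<And>k. k < m \<Longrightarrow> eigvec x m (l k) (\<lambda>i. V $$ (i, k))"
    and "\<And>k. k < m \<Longrightarrow> \<exists>i<m. V $$ (i, k) \<noteq> 0" and "inj_on l {..<m}"
  shows "det V \<noteq> 0"
proof (rule det_nonzeroI[OF V])
  fix c assume "\<And>i. i < m \<Longrightarrow> (\<Sum>j<m. V $$ (i, j) * c j) = 0"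
  then show "\<forall>j<m. c j = 0"
    by (intro eigvec_independent[of m x m l "\<lambda>k i. V $$ (i, k)"]) (use assms in auto)
qed

text \<open>The rows of the inverse of an eigenvector matrix are left eigenvectors. Both sides are
  compared after multiplication by \<open>V\<close> from the right, where \<open>x * V\<close> is
  known.\<close>

lemma eigvec_left:
  assumes V: "V \<in> carrier_mat m m" "det V \<noteq> 0"
    and ev: "\<And>k. k < m \<Longrightarrow> eigvec x m (l k) (\<lambda>i. V $$ (i, k))" and "k < m" "j < m"
  shows "(\<Sum>i<m. matinv V $$ (k, i) * x $$ (i, j)) = l k * matinv V $$ (k, j)"
proof -
  have "(\<Sum>j<m. (\<Sum>i<m. matinv V $$ (k, i) * x $$ (i, j)) * V $$ (j, p)) =
     l p * (if k = p then 1 else 0)" if "p < m" for p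
  proof -
    have "(\<Sum>j<m. (\<Sum>i<m. matinv V $$ (k, i) * x $$ (i, j)) * V $$ (j, p)) =
       (\<Sum>i<m. matinv V $$ (k, i) * (\<Sum>j<m. x $$ (i, j) * V $$ (j, p)))"
      unfolding sum_distrib_left sum_distrib_right by (subst sum.swap) (simp add: mult.assoc)
    also have "\<dots> = (\<Sum>i<m. l p * (matinv V $$ (k, i) * V $$ (i, p)))"
      using ev[OF that] by (intro sum.cong) (auto simp: eigvec_def)
    also have "\<dots> = l p * (if k = p then 1 else 0)"
      unfolding sum_distrib_left[symmetric] using matinv_left[OF V \<open>k < m\<close> that] by simp
    finally show ?thesis .
  qed
  from matinv_solve_row[OF V this \<open>j < m\<close>]
  have "(\<Sum>i<m. matinv V $$ (k, i) * x $$ (i, j)) =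
    (\<Sum>p<m. l p * (if k = p then 1 else 0) * matinv V $$ (p, j))" by simp
  also have "\<dots> = (\<Sum>p<m. if p = k then l p * matinv V $$ (p, j) else 0)"
    by (intro sum.cong) auto
  also have "\<dots> = l k * matinv V $$ (k, j)" using \<open>k < m\<close> by simp
  finally show ?thesis .
qed

text \<open>Pairing \<open>(x - \<mu>) d = b\<close> with a left eigenvector decouples the system
  into one scalar equation per coordinate in the eigenbasis. All inhomogeneous systems over a block
  are solved this way.\<close>

lemma eigvec_coord:
  assumes V: "V \<in> carrier_mat m m" "det V \<noteq> 0"
    and ev: "\<And>k. k < m \<Longrightarrow> eigvec x m (l k) (\<lambda>i. V $$ (i, k))" and "k < m"
    and d: "\<And>i. i < m \<Longrightarrow> (\<Sum>j<m. x $$ (i, j) * d j) - \<mu> * d i = b i"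
  shows "(l k - \<mu>) * (\<Sum>i<m. matinv V $$ (k, i) * d i) = (\<Sum>i<m. matinv V $$ (k, i) * b i)"
proof -
  have "(\<Sum>i<m. matinv V $$ (k, i) * b i) =
     (\<Sum>i<m. matinv V $$ (k, i) * (\<Sum>j<m. x $$ (i, j) * d j)) - \<mu> * (\<Sum>i<m. matinv V $$ (k, i) * d i)"
    unfolding sum_distrib_left[of \<mu>] sum_subtractf[symmetric]
    using d by (intro sum.cong) (auto simp: algebra_simps simp flip: d)
  also have "(\<Sum>i<m. matinv V $$ (k, i) * (\<Sum>j<m. x $$ (i, j) * d j)) =
     (\<Sum>j<m. (\<Sum>i<m. matinv V $$ (k, i) * x $$ (i, j)) * d j)"
    unfolding sum_distrib_left sum_distrib_right by (subst sum.swap) (simp add: mult.assoc)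
  also have "\<dots> = l k * (\<Sum>j<m. matinv V $$ (k, j) * d j)"
    unfolding sum_distrib_left using eigvec_left[OF V ev \<open>k < m\<close>] by (simp add: mult.assoc)
  finally show ?thesis by (simp add: algebra_simps)
qed

text \<open>The right side has no component along the other eigenvectors, so neither has
  \<open>d\<close>. The term with \<open>\<kappa>\<close> is there for the derivative of the
  eigenvalue, which enters when the eigenvector equation is differentiated.\<close>

lemma eigvec_multiple:
  assumes V: "V \<in> carrier_mat m m" "det V \<noteq> 0"
    and ev: "\<And>k. k < m \<Longrightarrow> eigvec x m (l k) (\<lambda>i. V $$ (i, k))" and inj: "inj_on l {..<m}" and "k < m"
    and d: "\<And>i. i < m \<Longrightarrow> (\<Sum>j<m. x $$ (i, j) * d j) - l k * d i = \<kappa> * V $$ (i, k)"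
  shows "\<exists>a. \<forall>i<m. d i = a * V $$ (i, k)"
proof -
  define \<beta> where "\<beta> p = (\<Sum>i<m. matinv V $$ (p, i) * d i)" for p
  have \<beta>0: "\<beta> p = 0" if "p < m" "p \<noteq> k" for p
  proof -
    have "(l p - l k) * \<beta> p = (\<Sum>i<m. matinv V $$ (p, i) * (\<kappa> * V $$ (i, k)))"
      unfolding \<beta>_def by (rule eigvec_coord[OF V ev that(1) d])
    also have "\<dots> = \<kappa> * (\<Sum>i<m. matinv V $$ (p, i) * V $$ (i, k))"
      by (simp add: sum_distrib_left ac_simps)
    also have "\<dots> = 0" using matinv_left[OF V that(1) \<open>k < m\<close>] that by simp
    finally show ?thesis using inj that \<open>k < m\<close> by (auto simp: inj_on_def)
  qed
  have "d i = \<beta> k * V $$ (i, k)" if "i < m" for i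
  proof -
    have "d i = (\<Sum>p<m. V $$ (i, p) * \<beta> p)"
      using matinv_apply(1)[OF V that, of d] by (simp add: \<beta>_def)
    also have "\<dots> = (\<Sum>p<m. if p = k then V $$ (i, p) * \<beta> p else 0)"
      using \<beta>0 by (intro sum.cong) auto
    finally show ?thesis using \<open>k < m\<close> by simp
  qed
  then show ?thesis by blast
qed

lemma eigvec_value:
  assumes V: "V \<in> carrier_mat m m" "det V \<noteq> 0"
    and ev: "\<And>k. k < m \<Longrightarrow> eigvec x m (l k) (\<lambda>i. V $$ (i, k))"
    and y: "eigvec x m \<mu> y" "\<exists>i<m. y i \<noteq> 0"
  shows "\<exists>k<m. \<mu> = l k"
proof (rule ccontr)
  assume c: "\<not> ?thesis"
  define \<beta> where "\<beta> p = (\<Sum>i<m. matinv V $$ (p, i) * y i)" for p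
  have "\<beta> p = 0" if "p < m" for p
  proof -
    have "(l p - \<mu>) * \<beta> p = (\<Sum>i<m. matinv V $$ (p, i) * 0)"
      unfolding \<beta>_def by (rule eigvec_coord[OF V ev that]) (use y in \<open>auto simp: eigvec_def\<close>)
    then show ?thesis using c that by auto
  qed
  then have "y i = 0" if "i < m" for i
    using matinv_apply(1)[OF V that, of y] by (simp add: \<beta>_def)
  then show False using y by auto
qed

section \<open>Eigenvectors of the upper left blocks\<close>

text \<open>From here on the index \<open>k\<close> of an eigenvalue at level \<open>m\<close> runs from \<open>0\<close> to \<open>m - 1\<close>, like matrix
  entries.\<close>

abbreviation "eigval z m k \<equiv> fst (z::gz_point) (Suc k) m"

lemma upper_left_block_carrier: "upper_left_block m x \<in> carrier_mat m m"
  by (simp add: upper_left_block_def)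

lemma eigenvalue_block_iff:
  "eigenvalue (upper_left_block m x) \<mu> \<longleftrightarrow> (\<exists>v. (\<exists>i<m. v i \<noteq> 0) \<and> eigvec x m \<mu> v)"
proof
  assume "eigenvalue (upper_left_block m x) \<mu>"
  then obtain v where v: "v \<in> carrier_vec m" "v \<noteq> 0\<^sub>v m"
      and e: "upper_left_block m x *\<^sub>v v = \<mu> \<cdot>\<^sub>v v"
    unfolding eigenvalue_def eigenvector_def by (auto simp: upper_left_block_def)
  have "(\<Sum>j<m. x $$ (i, j) * v $ j) = \<mu> * v $ i" if "i < m" for i
  proof -
    have "(upper_left_block m x *\<^sub>v v) $ i = (\<Sum>j<m. x $$ (i, j) * v $ j)"
      using v(1) that by (auto simp: upper_left_block_def scalar_prod_def atLeast0LessThan intro!: sum.cong)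
    then show ?thesis using e v(1) that by simp
  qed
  moreover have "\<exists>i<m. v $ i \<noteq> 0"
  proof (rule ccontr)
    assume "\<not> ?thesis"
    then have "v = 0\<^sub>v m" using v(1) by auto
    then show False using v by simp
  qed
  ultimately show "\<exists>v. (\<exists>i<m. v i \<noteq> 0) \<and> eigvec x m \<mu> v"
    by (intro exI[of _ "\<lambda>i. v $ i"]) (auto simp: eigvec_def)
next
  assume "\<exists>v. (\<exists>i<m. v i \<noteq> 0) \<and> eigvec x m \<mu> v"
  then obtain v where v: "\<exists>i<m. v i \<noteq> 0" "eigvec x m \<mu> v" by auto
  define w where "w = Matrix.vec m v"
  have "upper_left_block m x *\<^sub>v w = \<mu> \<cdot>\<^sub>v w"
    using v(2) by (intro eq_vecI)
      (auto simp: w_def eigvec_def upper_left_block_def scalar_prod_def atLeast0LessThan)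
  moreover have "w \<noteq> 0\<^sub>v m"
  proof
    assume w0: "w = 0\<^sub>v m"
    from v(1) obtain i where i: "i < m" "v i \<noteq> 0" by auto
    have "w $ i = v i" using i by (simp add: w_def)
    then show False using w0 i by simp
  qed
  ultimately show "eigenvalue (upper_left_block m x) \<mu>"
    unfolding eigenvalue_def eigenvector_def
    by (intro exI[of _ w]) (auto simp: w_def upper_left_block_def)
qed

lemma spectrum_block:
  assumes "V \<in> carrier_mat m m" "\<And>k. k < m \<Longrightarrow> eigvec x m (l k) (\<lambda>i. V $$ (i, k))"
    and nz: "\<And>k. k < m \<Longrightarrow> \<exists>i<m. V $$ (i, k) \<noteq> 0" and "inj_on l {..<m}"
  shows "spectrum (upper_left_block m x) = l ` {..<m}"
proof -
  have "eigenvalue (upper_left_block m x) \<mu> \<longleftrightarrow> \<mu> \<in> l ` {..<m}" for \<mu>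
    unfolding eigenvalue_block_iff
  proof
    assume "\<exists>v. (\<exists>i<m. v i \<noteq> 0) \<and> eigvec x m \<mu> v"
    then obtain v where v: "eigvec x m \<mu> v" "\<exists>i<m. v i \<noteq> 0" by auto
    show "\<mu> \<in> l ` {..<m}"
      using eigvec_value[OF assms(1) eigvec_det[OF assms] assms(2) v] by auto
  next
    assume "\<mu> \<in> l ` {..<m}"
    then obtain k where k: "k < m" "\<mu> = l k" by auto
    show "\<exists>v. (\<exists>i<m. v i \<noteq> 0) \<and> eigvec x m \<mu> v"
      unfolding k(2) by (rule exI[of _ "\<lambda>i. V $$ (i, k)"], rule conjI[OF nz[OF k(1)] assms(2)[OF k(1)]])
  qed
  then show ?thesis by (auto simp: spectrum_def)
qed

text \<open>From \<open>D = P X Q\<close> one gets \<open>X Q = Q D\<close>, so the columns of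
  \<open>Q\<close> are eigenvectors; they are nonzero because \<open>Q\<close> is
  invertible.\<close>

lemma M_Omega_e_eigvec:
  assumes "z \<in> M_Omega_e n" "m \<in> {1..n}" "k < m"
  shows "\<exists>v. (\<exists>i<m. v i \<noteq> 0) \<and> eigvec (snd z) m (eigval z m k) v"
proof -
  let ?X = "upper_left_block m (snd z)" and ?D = "gz_diag (fst z) m"
  have "similar_mat ?D ?X" using assms by (auto simp: M_Omega_e_def)
  then obtain P Q where PQ: "similar_mat_wit ?D ?X P Q" by (auto simp: similar_mat_def)
  have D: "?D \<in> carrier_mat m m" by (simp add: gz_diag_def)
  from PQ D have c: "P \<in> carrier_mat m m" "Q \<in> carrier_mat m m"
    and i: "P * Q = 1\<^sub>m m" "Q * P = 1\<^sub>m m" and e: "?D = P * ?X * Q"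
    by (auto simp: similar_mat_wit_def Let_def)
  have X: "?X \<in> carrier_mat m m" by (rule upper_left_block_carrier)
  have "Q * ?D = Q * (P * (?X * Q))" using e c X by (simp add: assoc_mult_mat)
  also have "\<dots> = (Q * P) * (?X * Q)" using assoc_mult_mat[OF c(2,1), of "?X * Q" m] c X by simp
  also have "\<dots> = ?X * Q" using i c X by simp
  finally have XQ: "?X * Q = Q * ?D" by simp
  have "(\<Sum>j<m. snd z $$ (i, j) * Q $$ (j, k)) = eigval z m k * Q $$ (i, k)" if "i < m" for i
  proof -
    have "(\<Sum>j<m. snd z $$ (i, j) * Q $$ (j, k)) = (?X * Q) $$ (i, k)"
      unfolding mat_mult_entry[OF X c(2) that assms(3)]
      using that by (intro sum.cong) (auto simp: upper_left_block_def)
    also have "\<dots> = (\<Sum>j<m. Q $$ (i, j) * ?D $$ (j, k))"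
      unfolding XQ using mat_mult_entry[OF c(2) D that assms(3)] .
    also have "\<dots> = (\<Sum>j<m. if j = k then Q $$ (i, j) * eigval z m k else 0)"
      using assms(3) by (intro sum.cong) (auto simp: gz_diag_def mat_diag_def)
    finally show ?thesis using assms(3) by simp
  qed
  moreover have "\<exists>i<m. Q $$ (i, k) \<noteq> 0"
  proof (rule ccontr)
    assume "\<not> ?thesis"
    then have "(P * Q) $$ (k, k) = 0"
      unfolding mat_mult_entry[OF c assms(3,3)] by simp
    then show False using i assms(3) by simp
  qed
  ultimately show ?thesis by (intro exI[of _ "\<lambda>i. Q $$ (i, k)"]) (auto simp: eigvec_def)
qed

lemma e_Omega_inj:
  assumes "\<nu> \<in> e_Omega n" "m \<in> {1..n}"
  shows "inj_on (\<lambda>k. \<nu> (Suc k) m) {..<m}"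
proof -
  have "inj_on (\<lambda>k. \<nu> k m) {1..m}" using assms by (auto simp: e_Omega_def)
  then show ?thesis by (auto intro!: inj_onI dest: inj_onD[where f = "\<lambda>k. \<nu> k m"])
qed

lemma e_Omega_neq:
  assumes "\<nu> \<in> e_Omega n" "m < n" "i < m" "j < Suc m"
  shows "\<nu> (Suc i) m \<noteq> \<nu> (Suc j) (Suc m)"
  using assms unfolding e_Omega_def by auto

text \<open>Eigenvectors for the prescribed eigenvalues suffice: a block of size \<open>m\<close>
  with \<open>m\<close> different eigenvalues has no others and is diagonalised by them, so both the
  spectral conditions on \<open>x\<close> and the conjugacy follow from those on
  \<open>\<nu>\<close>.\<close>

lemma M_Omega_eI:
  assumes e: "fst z \<in> e_Omega n" and x: "snd z \<in> carrier_mat n n"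
    and v: "\<And>m k. m \<in> {1..n} \<Longrightarrow> k < m \<Longrightarrow> \<exists>v. (\<exists>i<m. v i \<noteq> 0) \<and> eigvec (snd z) m (eigval z m k) v"
  shows "z \<in> M_Omega_e n"
proof -
  define V where "V m = Matrix.mat m m (\<lambda>(i, k). (SOME v. (\<exists>i<m. v i \<noteq> 0) \<and> eigvec (snd z) m (eigval z m k) v) i)" for m
  have V: "V m \<in> carrier_mat m m" for m by (simp add: V_def)
  have V': "(\<exists>i<m. V m $$ (i, k) \<noteq> 0) \<and> eigvec (snd z) m (eigval z m k) (\<lambda>i. V m $$ (i, k))"
    if "m \<in> {1..n}" "k < m" for m k
    using someI_ex[OF v[OF that]] that by (auto simp: V_def eigvec_def cong: conj_cong)
  note V_eig = V'[THEN conjunct2] and V_nz = V'[THEN conjunct1]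
  note dV = eigvec_det[OF V V_eig V_nz e_Omega_inj[OF e]]
  have sp: "spectrum (upper_left_block m (snd z)) = (\<lambda>k. eigval z m k) ` {..<m}" if "m \<in> {1..n}" for m
    using spectrum_block[OF V V_eig V_nz e_Omega_inj[OF e]] that by blast
  have "snd z \<in> M_Omega n"
    unfolding M_Omega_def using x
    by (auto simp: sp card_image[OF e_Omega_inj[OF e]] e_Omega_neq[OF e])
  moreover have "similar_mat (gz_diag (fst z) m) (upper_left_block m (snd z))" if m: "m \<in> {1..n}" for m
  proof -
    let ?W = "Matrix.mat m m (\<lambda>ij. matinv (V m) $$ ij)" and ?X = "upper_left_block m (snd z)"
    have dV: "det (V m) \<noteq> 0" using dV m by blast
    have c: "?W \<in> carrier_mat m m" "?X \<in> carrier_mat m m" "?X * V m \<in> carrier_mat m m"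
      using upper_left_block_carrier mult_carrier_mat[OF upper_left_block_carrier V] by auto
    have W1: "?W * V m = 1\<^sub>m m" using c V
      by (intro eq_matI) (auto simp: mat_mult_entry[OF c(1) V] matinv_left[OF V dV] simp del: index_mult_mat(1))
    have W2: "V m * ?W = 1\<^sub>m m" using c V
      by (intro eq_matI) (auto simp: mat_mult_entry[OF V c(1)] matinv_right[OF V dV] simp del: index_mult_mat(1))
    have XV: "(?X * V m) $$ (i, k) = eigval z m k * V m $$ (i, k)" if "i < m" "k < m" for i k
    proof -
      have "(?X * V m) $$ (i, k) = (\<Sum>j<m. snd z $$ (i, j) * V m $$ (j, k))"
        unfolding mat_mult_entry[OF c(2) V that]
        using that by (intro sum.cong) (auto simp: upper_left_block_def)
      then show ?thesis using V_eig[OF m that(2)] that(1) by (simp add: eigvec_def)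
    qed
    have "(?W * (?X * V m)) $$ (i, k) = gz_diag (fst z) m $$ (i, k)" if "i < m" "k < m" for i k
    proof -
      have "(?W * (?X * V m)) $$ (i, k) = (\<Sum>j<m. eigval z m k * (matinv (V m) $$ (i, j) * V m $$ (j, k)))"
        unfolding mat_mult_entry[OF c(1,3) that]
        using that by (intro sum.cong) (auto simp: XV simp del: index_mult_mat(1))
      also have "\<dots> = eigval z m k * (if i = k then 1 else 0)"
        unfolding sum_distrib_left[symmetric] using matinv_left[OF V dV that] by simp
      finally show ?thesis using that by (simp add: gz_diag_def mat_diag_def del: index_mult_mat(1))
    qed
    then have "gz_diag (fst z) m = ?W * (?X * V m)"
      using c V carrier_matD[OF V, of m] by (intro eq_matI) (auto simp: gz_diag_def mat_diag_def simp del: index_mult_mat(1))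
    then have "gz_diag (fst z) m = ?W * ?X * V m"
      using assoc_mult_mat[OF c(1,2) V] by simp
    then have "similar_mat_wit (gz_diag (fst z) m) ?X ?W (V m)"
      unfolding similar_mat_wit_def Let_def using W1 W2 c V mat_diag_dim[of m "\<lambda>i. fst z (Suc i) m"]
      by (simp only: gz_diag_def[symmetric] carrier_matD) simp
    then show ?thesis by (auto simp: similar_mat_def)
  qed
  ultimately show ?thesis using e by (cases z) (auto simp: M_Omega_e_def)
qed

lemma M_Omega_eD:
  assumes "z \<in> M_Omega_e n"
  shows "fst z \<in> e_Omega n" "snd z \<in> carrier_mat n n" "snd z \<in> M_Omega n"
proof -
  have "fst z \<in> e_Omega n \<and> snd z \<in> M_Omega n"
    using assms unfolding M_Omega_e_def by (simp only: mem_Collect_eq case_prod_unfold)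
  then show "fst z \<in> e_Omega n" "snd z \<in> carrier_mat n n" "snd z \<in> M_Omega n"
    unfolding M_Omega_def by blast+
qed

lemma eigval_inj: "z \<in> M_Omega_e n \<Longrightarrow> m \<in> {1..n} \<Longrightarrow> inj_on (\<lambda>k. eigval z m k) {..<m}"
  using e_Omega_inj M_Omega_eD(1) by blast

lemma eigval_distinct:
  "z \<in> M_Omega_e n \<Longrightarrow> m \<in> {1..n} \<Longrightarrow> k < m \<Longrightarrow> j < m \<Longrightarrow> k \<noteq> j \<Longrightarrow> eigval z m k \<noteq> eigval z m j"
  using eigval_inj[of z n m] by (auto simp: inj_on_def)

lemma eigval_neq:
  "z \<in> M_Omega_e n \<Longrightarrow> m < n \<Longrightarrow> i < m \<Longrightarrow> j < Suc m \<Longrightarrow> eigval z m i \<noteq> eigval z (Suc m) j"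
  using e_Omega_neq M_Omega_eD(1) by blast

lemma eigval_complete:
  assumes z: "z \<in> M_Omega_e n" "m \<in> {1..n}" and y: "eigvec (snd z) m \<mu> y" "\<exists>i<m. y i \<noteq> 0"
  shows "\<exists>k<m. \<mu> = eigval z m k"
proof -
  define V where "V = Matrix.mat m m (\<lambda>(i, k). (SOME v. (\<exists>i<m. v i \<noteq> 0) \<and> eigvec (snd z) m (eigval z m k) v) i)"
  have V: "V \<in> carrier_mat m m" by (simp add: V_def)
  have V': "(\<exists>i<m. V $$ (i, k) \<noteq> 0) \<and> eigvec (snd z) m (eigval z m k) (\<lambda>i. V $$ (i, k))"
    if "k < m" for k
    using someI_ex[OF M_Omega_e_eigvec[OF z that]] that by (auto simp: V_def eigvec_def cong: conj_cong)
  note V1 = V'[THEN conjunct2] and V2 = V'[THEN conjunct1]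
  show ?thesis
    by (rule eigvec_value[OF V eigvec_det[OF V V1 V2 eigval_inj[OF z]] V1 y])
qed

text \<open>For an eigenvalue \<open>l\<close> of the next block, the first \<open>m\<close> rows of
  the equation for an eigenvector with last coordinate 1 say that this matrix maps the remaining
  coordinates to the last column of that block. Hence normalised eigenvectors are rational in the
  eigenvalue and the entries.\<close>

definition shifted_block :: "gz_point \<Rightarrow> nat \<Rightarrow> complex \<Rightarrow> complex mat" where
  "shifted_block z m l = Matrix.mat m m (\<lambda>(i, j). (if i = j then l else 0) - snd z $$ (i, j))"

text \<open>The columns are the right eigenvectors of the block with last coordinate \<open>1\<close>.\<close>

definition eigmat :: "gz_point \<Rightarrow> nat \<Rightarrow> complex mat" where
  "eigmat z m = Matrix.mat m m (\<lambda>(j, k). if Suc j = m then 1 else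
     (\<Sum>l<m - 1. matinv (shifted_block z (m - 1) (eigval z m k)) $$ (j, l) * snd z $$ (l, m - 1)))"

lemma shifted_block_apply:
  "i < m \<Longrightarrow> (\<Sum>j<m. shifted_block z m l $$ (i, j) * c j) = l * c i - (\<Sum>j<m. snd z $$ (i, j) * c j)"
proof -
  assume "i < m"
  then have "(\<Sum>j<m. shifted_block z m l $$ (i, j) * c j) =
     (\<Sum>j<m. (if j = i then l * c j else 0) - snd z $$ (i, j) * c j)"
    by (intro sum.cong) (auto simp: shifted_block_def algebra_simps)
  then show ?thesis using \<open>i < m\<close> by (simp add: sum_subtractf)
qed

lemma shifted_block_carrier: "shifted_block z m l \<in> carrier_mat m m"
  by (simp add: shifted_block_def)

text \<open>A kernel vector would be an eigenvector of the smaller block whose eigenvalue also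
  belongs to the next block.\<close>

lemma shifted_block_det:
  assumes z: "z \<in> M_Omega_e n" and "m < n" "k < Suc m"
  shows "det (shifted_block z m (eigval z (Suc m) k)) \<noteq> 0"
proof (rule det_nonzeroI[OF shifted_block_carrier])
  fix c assume "\<And>i. i < m \<Longrightarrow> (\<Sum>j<m. shifted_block z m (eigval z (Suc m) k) $$ (i, j) * c j) = 0"
  then have e: "eigvec (snd z) m (eigval z (Suc m) k) c"
    by (simp add: eigvec_def shifted_block_apply)
  show "\<forall>j<m. c j = 0"
  proof (rule ccontr)
    assume c: "\<not> ?thesis"
    then have "m \<in> {1..n}" using assms by auto
    then obtain i where "i < m" "eigval z (Suc m) k = eigval z m i"
      using eigval_complete[OF z _ e] c by blast
    then show False using eigval_neq[OF z, of m i k] assms by simp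
  qed
qed

lemma eigmat_carrier: "eigmat z m \<in> carrier_mat m m"
  by (simp add: eigmat_def)

lemma eigmat_last: "k < Suc m \<Longrightarrow> eigmat z (Suc m) $$ (m, k) = 1"
  by (simp add: eigmat_def)

lemma eigmat_unique_Suc:
  assumes z: "z \<in> M_Omega_e n" and "m < n" "k < Suc m"
    and y: "eigvec (snd z) (Suc m) (eigval z (Suc m) k) y" "y m = 1" and i: "i < Suc m"
  shows "y i = eigmat z (Suc m) $$ (i, k)"
proof (cases "i = m")
  case True
  then show ?thesis using y assms by (simp add: eigmat_def)
next
  case False
  then have i: "i < m" using i by simp
  have "(\<Sum>j<m. shifted_block z m (eigval z (Suc m) k) $$ (p, j) * y j) = snd z $$ (p, m)" if "p < m" for p
  proof -
    have "(\<Sum>j<Suc m. snd z $$ (p, j) * y j) = eigval z (Suc m) k * y p"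
      using y(1) that unfolding eigvec_def by (meson less_SucI)
    then show ?thesis unfolding shifted_block_apply[OF that] using y(2) by (simp add: algebra_simps)
  qed
  from matinv_solve[OF shifted_block_carrier shifted_block_det[OF z assms(2,3)] this i]
  show ?thesis using i assms(3) by (simp add: eigmat_def)
qed

text \<open>Normalisation is possible because an eigenvector with last coordinate 0 would restrict
  to an eigenvector of the smaller block for a common eigenvalue.\<close>

lemma eigmat_eigvec_Suc:
  assumes z: "z \<in> M_Omega_e n" and m: "m < n" "k < Suc m"
  shows "eigvec (snd z) (Suc m) (eigval z (Suc m) k) (\<lambda>i. eigmat z (Suc m) $$ (i, k))"
proof -
  obtain v where v: "\<exists>i<Suc m. v i \<noteq> 0" "eigvec (snd z) (Suc m) (eigval z (Suc m) k) v"
    using M_Omega_e_eigvec[OF z _ m(2)] m(1) by auto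
  have vm: "v m \<noteq> 0"
  proof
    assume 0: "v m = 0"
    then have e: "eigvec (snd z) m (eigval z (Suc m) k) v" and ne: "\<exists>i<m. v i \<noteq> 0"
      using v by (auto simp: eigvec_def less_Suc_eq)
    then have "m \<in> {1..n}" using m by auto
    then obtain i where "i < m" "eigval z (Suc m) k = eigval z m i"
      using eigval_complete[OF z _ e] ne by blast
    then show False using eigval_neq[OF z, of m i k] m by simp
  qed
  define y where "y i = v i / v m" for i
  have y: "eigvec (snd z) (Suc m) (eigval z (Suc m) k) y"
    using v(2) unfolding eigvec_def y_def times_divide_eq_right sum_divide_distrib[symmetric]
    by simp
  have "y i = eigmat z (Suc m) $$ (i, k)" if "i < Suc m" for i
    by (rule eigmat_unique_Suc[OF z m y _ that]) (simp add: y_def vm)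
  then show ?thesis using y by (simp add: eigvec_def)
qed

lemma eigmat_eigvec:
  assumes z: "z \<in> M_Omega_e n" and m: "m \<in> {1..n}" "k < m"
  shows "eigvec (snd z) m (eigval z m k) (\<lambda>i. eigmat z m $$ (i, k))"
proof -
  from m obtain p where "m = Suc p" by (cases m) auto
  then show ?thesis using eigmat_eigvec_Suc[OF z, of p k] m by simp
qed

lemma eigmat_last': "k < m \<Longrightarrow> eigmat z m $$ (m - 1, k) = 1"
  by (cases m) (auto simp: eigmat_last)

lemma eigmat_det:
  assumes z: "z \<in> M_Omega_e n" and m: "m \<in> {1..n}"
  shows "det (eigmat z m) \<noteq> 0"
proof -
  have "\<exists>i<m. eigmat z m $$ (i, k) \<noteq> 0" if "k < m" for k
    using eigmat_last'[OF that] m by (intro exI[of _ "m - 1"]) auto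
  then show ?thesis
    using eigvec_det[OF eigmat_carrier eigmat_eigvec[OF z m] _ eigval_inj[OF z m]] by blast
qed

text \<open>The \<open>\<sigma>\<close> of the overview. Since entries count from 0, row index
  \<open>m\<close> is the first row below the block of size \<open>m\<close>, and the value is
  meaningful for \<open>1 \<le> m < n\<close>.\<close>

definition sval :: "nat \<Rightarrow> nat \<Rightarrow> gz_point \<Rightarrow> complex" where
  "sval m k z = (\<Sum>j<m. snd z $$ (m, j) * eigmat z m $$ (j, k))"

text \<open>If the product were 0, the eigenvector of the block, extended by a coordinate 0, would
  be an eigenvector of the next block for the same eigenvalue.\<close>

lemma sval_nonzero:
  assumes z: "z \<in> M_Omega_e n" and m: "1 \<le> m" "m < n" "k < m"
  shows "sval m k z \<noteq> 0"
proof
  assume 0: "sval m k z = 0"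
  have m': "m \<in> {1..n}" using m by simp
  define y where "y i = (if i < m then eigmat z m $$ (i, k) else 0)" for i
  have e: "eigvec (snd z) (Suc m) (eigval z m k) y"
    using eigmat_eigvec[OF z m' m(3)] 0 by (auto simp: eigvec_def y_def less_Suc_eq sval_def)
  have "y (m - 1) \<noteq> 0" using eigmat_last'[OF m(3)] m by (simp add: y_def)
  then have "\<exists>i<Suc m. y i \<noteq> 0" using m by (intro exI[of _ "m - 1"]) auto
  then obtain j where "j < Suc m" "eigval z m k = eigval z (Suc m) j"
    using eigval_complete[OF z _ e] m by auto
  then show False using eigval_neq[OF z m(2,3)] by blast
qed

lemma row_of_sval:
  assumes z: "z \<in> M_Omega_e n" and m: "1 \<le> m" "m < n" and j: "j < m"
  shows "snd z $$ (m, j) = (\<Sum>i<m. sval m i z * matinv (eigmat z m) $$ (i, j))"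
proof (rule matinv_solve_row[OF eigmat_carrier eigmat_det[OF z] _ j, where y = "\<lambda>j. snd z $$ (m, j)"])
  show "m \<in> {1..n}" using m by simp
qed (simp add: sval_def)

text \<open>The last row of \<open>eigmat z m\<close> consists of ones, so the Hessenberg row
  \<open>(0, \<dots>, 0, 1)\<close> pairs to 1 with every eigenvector; as the eigenvectors form a
  basis, no other row does.\<close>

lemma hessenberg_iff_sval:
  assumes z: "z \<in> M_Omega_e n"
  shows "snd z \<in> hessenberg_mats n \<longleftrightarrow> (\<forall>m k. 1 \<le> m \<and> m < n \<and> k < m \<longrightarrow> sval m k z = 1)"
proof -
  have *: "(\<Sum>j<m. (if Suc j = m then 1 else 0) * eigmat z m $$ (j, k)) = 1" if "1 \<le> m" "k < m" for m k
  proof -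
    have "(\<Sum>j<m. (if Suc j = m then 1 else 0) * eigmat z m $$ (j, k)) =
       (\<Sum>j<m. if j = m - 1 then eigmat z m $$ (j, k) else 0)"
      using that by (intro sum.cong) auto
    then show ?thesis using that eigmat_last'[OF that(2)] by simp
  qed
  show ?thesis
  proof
    assume h: "snd z \<in> hessenberg_mats n"
    have "sval m k z = 1" if "1 \<le> m" "m < n" "k < m" for m k
    proof -
      have "snd z $$ (m, j) = (if Suc j = m then 1 else 0)" if "j < m" for j
        using h that \<open>m < n\<close> by (auto simp: hessenberg_mats_def)
      then have "sval m k z = (\<Sum>j<m. (if Suc j = m then 1 else 0) * eigmat z m $$ (j, k))"
        unfolding sval_def by (intro sum.cong) auto
      then show ?thesis using * that by simp
    qed
    then show "\<forall>m k. 1 \<le> m \<and> m < n \<and> k < m \<longrightarrow> sval m k z = 1" by blast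
  next
    assume s: "\<forall>m k. 1 \<le> m \<and> m < n \<and> k < m \<longrightarrow> sval m k z = 1"
    have "snd z $$ (m, j) = (if Suc j = m then 1 else 0)" if m: "1 \<le> m" "m < n" and j: "j < m" for m j
    proof -
      have m': "m \<in> {1..n}" using m by simp
      define y :: "nat \<Rightarrow> complex" where "y j = (if Suc j = m then 1 else 0)" for j
      have "(\<Sum>i<m. y i * eigmat z m $$ (i, k)) = 1" if "k < m" for k
        unfolding y_def by (rule *[OF m(1) that])
      from matinv_solve_row[OF eigmat_carrier eigmat_det[OF z m'] this j]
      have "y j = (\<Sum>i<m. 1 * matinv (eigmat z m) $$ (i, j))" .
      moreover have "(\<Sum>i<m. sval m i z * matinv (eigmat z m) $$ (i, j)) = (\<Sum>i<m. 1 * matinv (eigmat z m) $$ (i, j))"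
        using s m by (intro sum.cong) auto
      ultimately show ?thesis using row_of_sval[OF z m j] by (simp add: y_def)
    qed
    then have r: "snd z $$ (i, j) = (if Suc j = i then 1 else 0)" if "j < i" "i < n" for i j
      using that by simp
    show "snd z \<in> hessenberg_mats n"
    proof -
      have "snd z $$ (i + 1, i) = 1" if "i + 1 < n" for i using r[of i "i + 1"] that by simp
      moreover have "snd z $$ (i, j) = 0" if "i < n" "i > j + 1" for i j using r[of j i] that by simp
      ultimately show ?thesis using M_Omega_eD(2)[OF z] unfolding hessenberg_mats_def by blast
    qed
  qed
qed

section \<open>Rational functions without poles\<close>

text \<open>Rational expressions in \<open>B\<close> without poles on the variety: only functions
  vanishing nowhere on it may be inverted. The rule \<open>cong\<close> is included because the
  functions are total while only their values on the variety matter.\<close>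

inductive_set rat_closure :: "nat \<Rightarrow> (gz_point \<Rightarrow> complex) set \<Rightarrow> (gz_point \<Rightarrow> complex) set" for n B where
  const: "(\<lambda>_. c) \<in> rat_closure n B"
| base: "f \<in> B \<Longrightarrow> f \<in> rat_closure n B"
| add: "f \<in> rat_closure n B \<Longrightarrow> g \<in> rat_closure n B \<Longrightarrow> (\<lambda>z. f z + g z) \<in> rat_closure n B"
| mult: "f \<in> rat_closure n B \<Longrightarrow> g \<in> rat_closure n B \<Longrightarrow> (\<lambda>z. f z * g z) \<in> rat_closure n B"
| inverse: "f \<in> rat_closure n B \<Longrightarrow> \<forall>z \<in> M_Omega_e n. f z \<noteq> 0 \<Longrightarrow> (\<lambda>z. inverse (f z)) \<in> rat_closure n B"
| cong: "f \<in> rat_closure n B \<Longrightarrow> \<forall>z \<in> M_Omega_e n. g z = f z \<Longrightarrow> g \<in> rat_closure n B"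

context
  fixes n :: nat and B :: "(gz_point \<Rightarrow> complex) set"
begin

lemma rat_closure_minus: "f \<in> rat_closure n B \<Longrightarrow> (\<lambda>z. - f z) \<in> rat_closure n B"
  using rat_closure.mult[OF rat_closure.const[of "-1"]] by fastforce

lemma rat_closure_diff:
  "f \<in> rat_closure n B \<Longrightarrow> g \<in> rat_closure n B \<Longrightarrow> (\<lambda>z. f z - g z) \<in> rat_closure n B"
  using rat_closure.add[OF _ rat_closure_minus] by fastforce

lemma rat_closure_divide:
  "f \<in> rat_closure n B \<Longrightarrow> g \<in> rat_closure n B \<Longrightarrow> \<forall>z \<in> M_Omega_e n. g z \<noteq> 0 \<Longrightarrow>
   (\<lambda>z. f z / g z) \<in> rat_closure n B"
  using rat_closure.mult[OF _ rat_closure.inverse] by (simp add: divide_inverse)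

lemma rat_closure_sum:
  "finite I \<Longrightarrow> (\<And>i. i \<in> I \<Longrightarrow> f i \<in> rat_closure n B) \<Longrightarrow> (\<lambda>z. \<Sum>i\<in>I. f i z) \<in> rat_closure n B"
  by (induction I rule: finite_induct) (auto intro: rat_closure.const rat_closure.add)

lemma rat_closure_prod:
  "finite I \<Longrightarrow> (\<And>i. i \<in> I \<Longrightarrow> f i \<in> rat_closure n B) \<Longrightarrow> (\<lambda>z. \<Prod>i\<in>I. f i z) \<in> rat_closure n B"
  by (induction I rule: finite_induct) (auto intro: rat_closure.const rat_closure.mult)

lemma rat_closure_det:
  assumes "\<And>z. A z \<in> carrier_mat m m" "\<And>i j. i < m \<Longrightarrow> j < m \<Longrightarrow> (\<lambda>z. A z $$ (i, j)) \<in> rat_closure n B"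
  shows "(\<lambda>z. det (A z)) \<in> rat_closure n B"
proof -
  have "(\<lambda>z. \<Sum>p\<in>{p. p permutes {0..<m}}. signof p * (\<Prod>i = 0..<m. A z $$ (i, p i))) \<in> rat_closure n B"
  proof (rule rat_closure_sum)
    show "finite {p. p permutes {0..<m}}" by (rule finite_permutations) simp
    fix p assume "p \<in> {p. p permutes {0..<m}}"
    then have "p i < m" if "i < m" for i
      using permutes_in_image[of p "{0..<m}" i] that by simp
    then show "(\<lambda>z. signof p * (\<Prod>i = 0..<m. A z $$ (i, p i))) \<in> rat_closure n B"
      by (intro rat_closure.mult rat_closure.const rat_closure_prod assms(2)) auto
  qed
  then show ?thesis using det_def'[OF assms(1)] by simp
qed

text \<open>This is the reason for defining \<open>matinv\<close> by the adjugate: its entries are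
  polynomials in the entries of \<open>A\<close> divided by a determinant that vanishes nowhere on
  the variety.\<close>

lemma rat_closure_matinv:
  assumes A: "\<And>z. A z \<in> carrier_mat m m" "\<And>i j. i < m \<Longrightarrow> j < m \<Longrightarrow> (\<lambda>z. A z $$ (i, j)) \<in> rat_closure n B"
    and d: "\<And>z. z \<in> M_Omega_e n \<Longrightarrow> det (A z) \<noteq> 0" and ij: "i < m" "j < m"
  shows "(\<lambda>z. matinv (A z) $$ (i, j)) \<in> rat_closure n B"
proof -
  have dims: "dim_row (A z) = m" "dim_col (A z) = m" for z using A(1)[of z] by auto
  have "(\<lambda>z. det (mat_delete (A z) j i)) \<in> rat_closure n B"
  proof (rule rat_closure_det)
    fix z show "mat_delete (A z) j i \<in> carrier_mat (m - 1) (m - 1)"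
      using mat_delete_carrier[OF A(1)] .
  next
    fix p q assume pq: "p < m - 1" "q < m - 1"
    have "mat_delete (A z) j i $$ (p, q) = A z $$ (if p < j then p else Suc p, if q < i then q else Suc q)" for z
      using pq dims by (simp add: mat_delete_def)
    moreover have "(\<lambda>z. A z $$ (if p < j then p else Suc p, if q < i then q else Suc q)) \<in> rat_closure n B"
      using pq by (intro A(2)) auto
    ultimately show "(\<lambda>z. mat_delete (A z) j i $$ (p, q)) \<in> rat_closure n B" by simp
  qed
  then have "(\<lambda>z. inverse (det (A z)) * ((-1) ^ (j + i) * det (mat_delete (A z) j i))) \<in> rat_closure n B"
    using d by (intro rat_closure.mult rat_closure.inverse rat_closure.const rat_closure_det[of A, OF A]) auto
  then show ?thesis using ij dims by (simp add: matinv_def adj_mat_def cofactor_def)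
qed

end

definition gz_coordinates :: "nat \<Rightarrow> (gz_point \<Rightarrow> complex) set" where
  "gz_coordinates n = {(\<lambda>z. fst z k m) | k m. 1 \<le> k \<and> k \<le> m \<and> m \<le> n} \<union>
     {(\<lambda>z. snd z $$ (i, j)) | i j. i < n \<and> j < n}"

abbreviation "coord_closure n \<equiv> rat_closure n (gz_coordinates n)"

lemma coordinates_closure:
  "1 \<le> k \<Longrightarrow> k \<le> m \<Longrightarrow> m \<le> n \<Longrightarrow> (\<lambda>z. fst z k m) \<in> coord_closure n"
  "i < n \<Longrightarrow> j < n \<Longrightarrow> (\<lambda>z. snd z $$ (i, j)) \<in> coord_closure n"
  by (rule rat_closure.base, force simp: gz_coordinates_def)+

lemma polynomial_closure: "f \<in> gz_polynomial n \<Longrightarrow> f \<in> coord_closure n"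
  by (induction rule: gz_polynomial.induct)
    (auto intro: rat_closure.const rat_closure.add rat_closure.mult coordinates_closure)

text \<open>One fraction serves the whole variety. Inversion exchanges numerator and denominator,
  and the new denominator has no zeros since the function has none.\<close>

lemma closure_fraction:
  assumes "f \<in> coord_closure n"
  shows "\<exists>g \<in> gz_polynomial n. \<exists>h \<in> gz_polynomial n. \<forall>z \<in> M_Omega_e n. h z \<noteq> 0 \<and> f z = g z / h z"
  using assms
proof (induction rule: rat_closure.induct)
  case (const c)
  show ?case
    by (intro bexI[of _ "\<lambda>_. c"] bexI[of _ "\<lambda>_. 1"]) (auto intro: gz_polynomial.const)
next
  case (base f)
  then have "f \<in> gz_polynomial n"
    by (auto simp: gz_coordinates_def intro: gz_polynomial.intros)
  then show ?case
    by (intro bexI[of _ f] bexI[of _ "\<lambda>_. 1"]) (auto intro: gz_polynomial.const)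
next
  case (add f1 f2)
  then obtain g1 h1 g2 h2 where
    "g1 \<in> gz_polynomial n" "h1 \<in> gz_polynomial n" "\<forall>z \<in> M_Omega_e n. h1 z \<noteq> 0 \<and> f1 z = g1 z / h1 z"
    "g2 \<in> gz_polynomial n" "h2 \<in> gz_polynomial n" "\<forall>z \<in> M_Omega_e n. h2 z \<noteq> 0 \<and> f2 z = g2 z / h2 z"
    by auto
  then show ?case
    by (intro bexI[of _ "\<lambda>z. g1 z * h2 z + g2 z * h1 z"] bexI[of _ "\<lambda>z. h1 z * h2 z"])
      (auto intro!: gz_polynomial.add gz_polynomial.mult simp: add_frac_eq)
next
  case (mult f1 f2)
  then obtain g1 h1 g2 h2 where
    "g1 \<in> gz_polynomial n" "h1 \<in> gz_polynomial n" "\<forall>z \<in> M_Omega_e n. h1 z \<noteq> 0 \<and> f1 z = g1 z / h1 z"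
    "g2 \<in> gz_polynomial n" "h2 \<in> gz_polynomial n" "\<forall>z \<in> M_Omega_e n. h2 z \<noteq> 0 \<and> f2 z = g2 z / h2 z"
    by auto
  then show ?case
    by (intro bexI[of _ "\<lambda>z. g1 z * g2 z"] bexI[of _ "\<lambda>z. h1 z * h2 z"])
      (auto intro!: gz_polynomial.mult)
next
  case (inverse f)
  then obtain g h where
    gh: "g \<in> gz_polynomial n" "h \<in> gz_polynomial n" "\<forall>z \<in> M_Omega_e n. h z \<noteq> 0 \<and> f z = g z / h z"
    by auto
  with inverse(2) have "\<forall>z \<in> M_Omega_e n. g z \<noteq> 0" by auto
  with gh show ?case by (intro bexI[of _ h] bexI[of _ g]) auto
next
  case (cong f g)
  then show ?case by metis
qed

lemma zariski_open_UNIV: "gz_zariski_open n (M_Omega_e n)"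
  unfolding gz_zariski_open_def
  by (rule exI[of _ "{\<lambda>_. 1}"]) (auto intro: gz_polynomial.const)

lemma closure_regular:
  assumes "f \<in> coord_closure n"
  shows "f \<in> gz_O n"
proof -
  from closure_fraction[OF assms] obtain g h where gh: "g \<in> gz_polynomial n" "h \<in> gz_polynomial n"
      "\<forall>z \<in> M_Omega_e n. h z \<noteq> 0 \<and> f z = g z / h z"
    by auto
  show ?thesis
    unfolding gz_O_def gz_regular_on_def mem_Collect_eq
    by (intro ballI exI[of _ "M_Omega_e n"] exI[of _ g] exI[of _ h]) (use gh zariski_open_UNIV in auto)
qed

lemma eigmat_closure:
  assumes "m \<in> {1..n}" "j < m" "k < m"
  shows "(\<lambda>z. eigmat z m $$ (j, k)) \<in> coord_closure n"
proof (cases "Suc j = m")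
  case True
  then show ?thesis using assms by (simp add: eigmat_def rat_closure.const)
next
  case False
  have *: "(\<lambda>z. matinv (shifted_block z (m - 1) (eigval z m k)) $$ (j, l)) \<in> coord_closure n"
    if "l < m - 1" for l
  proof (rule rat_closure_matinv)
    show "shifted_block z (m - 1) (eigval z m k) \<in> carrier_mat (m - 1) (m - 1)" for z
      by (rule shifted_block_carrier)
    show "(\<lambda>z. shifted_block z (m - 1) (eigval z m k) $$ (p, q)) \<in> coord_closure n"
      if "p < m - 1" "q < m - 1" for p q
    proof -
      have "(\<lambda>z. eigval z m k - snd z $$ (p, q)) \<in> coord_closure n"
        "(\<lambda>z. 0 - snd z $$ (p, q)) \<in> coord_closure n"
        using assms that by (auto intro!: rat_closure_diff rat_closure_minus coordinates_closure rat_closure.const)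
      then show ?thesis using that by (cases "p = q") (auto simp: shifted_block_def)
    qed
    show "det (shifted_block z (m - 1) (eigval z m k)) \<noteq> 0" if "z \<in> M_Omega_e n" for z
      using shifted_block_det[OF that, of "m - 1" k] assms by simp
    show "j < m - 1" "l < m - 1" using that assms False by auto
  qed
  have "(\<lambda>z. \<Sum>l<m - 1. matinv (shifted_block z (m - 1) (eigval z m k)) $$ (j, l) * snd z $$ (l, m - 1))
     \<in> coord_closure n"
    using * assms by (intro rat_closure_sum rat_closure.mult coordinates_closure) auto
  then show ?thesis using assms False by (simp add: eigmat_def)
qed

lemma sval_closure:
  assumes "1 \<le> m" "m < n" "k < m"
  shows "sval m k \<in> coord_closure n"
proof -
  have "(\<lambda>z. \<Sum>j<m. snd z $$ (m, j) * eigmat z m $$ (j, k)) \<in> coord_closure n"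
    using assms by (intro rat_closure_sum rat_closure.mult coordinates_closure eigmat_closure) auto
  then show ?thesis by (simp add: sval_def[abs_def])
qed

section \<open>Continuity of the ordered eigenvalues\<close>

lemma prod_list_ge_power:
  assumes "\<forall>a \<in> set as. \<epsilon> \<le> cmod (f a)" "0 \<le> \<epsilon>"
  shows "\<epsilon> ^ length as \<le> cmod (\<Prod>a\<leftarrow>as. f a)"
  using assms by (induction as) (auto simp: norm_mult intro!: mult_mono)

text \<open>The value of the characteristic polynomial at \<open>l\<close> is the product of the
  \<open>m\<close> differences between \<open>l\<close> and the eigenvalues; if all of them were at
  least \<open>\<epsilon>\<close> in modulus, so would the product be at least
  \<open>\<epsilon> ^ m\<close>. Continuity of eigenvalues thus reduces to continuity of
  determinants.\<close>

lemma eigenvalue_near: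
  assumes A: "A \<in> carrier_mat m m" and l: "cmod (poly (char_poly A) l) < \<epsilon> ^ m" and e: "0 < \<epsilon>"
  shows "\<exists>a. eigenvalue A a \<and> dist a l < \<epsilon>"
proof -
  from char_poly_factorized[OF A] obtain as where
    as: "char_poly A = (\<Prod>a\<leftarrow>as. [:- a, 1:])" "length as = m" by auto
  have p: "poly (char_poly A) t = (\<Prod>a\<leftarrow>as. t - a)" for t
    unfolding as(1) by (induction as) (auto simp: algebra_simps)
  have "\<exists>a \<in> set as. cmod (l - a) < \<epsilon>"
  proof (rule ccontr)
    assume "\<not> ?thesis"
    then have "\<epsilon> ^ m \<le> cmod (poly (char_poly A) l)"
      unfolding p as(2)[symmetric] using e by (intro prod_list_ge_power) auto
    then show False using l by simp
  qed
  then obtain a where a: "a \<in> set as" "cmod (l - a) < \<epsilon>" by auto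
  have "(\<Prod>b\<leftarrow>as. a - b) = 0" using a(1) by (auto simp: prod_list_zero_iff)
  then have "eigenvalue A a" unfolding eigenvalue_root_char_poly[OF A] p .
  then show ?thesis using a(2) by (auto simp: dist_norm norm_minus_commute)
qed

text \<open>The characteristic polynomial of a block as a function of an infinite array of entries:
  this is the product space from which \<open>mat_topology\<close> is pulled back, and there
  continuity can be checked coordinatewise.\<close>

definition char_value :: "nat \<Rightarrow> complex \<Rightarrow> (nat \<Rightarrow> nat \<Rightarrow> complex) \<Rightarrow> complex" where
  "char_value m l e = det (Matrix.mat m m (\<lambda>(i, j). (if i = j then l else 0) - e i j))"

definition mat_entries :: "nat \<Rightarrow> complex mat \<Rightarrow> nat \<Rightarrow> nat \<Rightarrow> complex" where
  "mat_entries n x = (\<lambda>i j. if i < n \<and> j < n then x $$ (i, j) else 0)"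

lemma openin_mat_topology:
  "openin (mat_topology n) S \<longleftrightarrow> (\<exists>V. open V \<and> S = mat_entries n -` V \<inter> carrier_mat n n)"
  by (simp add: mat_topology_def openin_pullback_topology mat_entries_def[abs_def])

lemma topspace_mat_topology: "topspace (mat_topology n) = carrier_mat n n"
  by (simp add: mat_topology_def topspace_pullback_topology)

lemma char_value_block:
  assumes "m \<le> n"
  shows "char_value m l (mat_entries n x) = poly (char_poly (upper_left_block m x)) l"
proof -
  have "poly (char_poly (upper_left_block m x)) l =
      det (- char_matrix (upper_left_block m x) l)"
    by (rule char_poly_matrix[OF upper_left_block_carrier])
  also have "- char_matrix (upper_left_block m x) l =
      Matrix.mat m m (\<lambda>(i, j). (if i = j then l else 0) - mat_entries n x i j)"
    using assms by (intro eq_matI) (auto simp: char_matrix_def upper_left_block_def mat_entries_def)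
  finally show ?thesis by (simp add: char_value_def)
qed

lemma continuous_on_entry: "continuous_on UNIV (\<lambda>e :: nat \<Rightarrow> nat \<Rightarrow> complex. e i j)"
  by (rule continuous_on_product_then_coordinatewise[OF
        continuous_on_product_then_coordinatewise[OF continuous_on_id]])

lemma continuous_char_value: "continuous_on UNIV (char_value m l)"
proof -
  have "char_value m l = (\<lambda>e. \<Sum>p\<in>{p. p permutes {0..<m}}. signof p *
      (\<Prod>i = 0..<m. Matrix.mat m m (\<lambda>(i, j). (if i = j then l else 0) - e i j) $$ (i, p i)))"
    unfolding char_value_def by (subst det_def'[of _ m]) auto
  also have "\<dots> = (\<lambda>e. \<Sum>p\<in>{p. p permutes {0..<m}}. signof p *
      (\<Prod>i = 0..<m. (if i = p i then l else 0) - e i (p i)))"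
  proof (intro ext sum.cong refl arg_cong2[where f = "(*)"] prod.cong)
    fix e :: "nat \<Rightarrow> nat \<Rightarrow> complex" and p i assume "p \<in> {p. p permutes {0..<m}}" and i: "i \<in> {0..<m}"
    then have "p i < m" using permutes_in_image[of p "{0..<m}" i] by simp
    then show "Matrix.mat m m (\<lambda>(i, j). (if i = j then l else 0) - e i j) $$ (i, p i) =
       (if i = p i then l else 0) - e i (p i)" using i by simp
  qed
  finally have e: "char_value m l = \<dots>" .
  show ?thesis unfolding e by (intro continuous_intros continuous_on_entry)
qed

lemma openin_char_value:
  "openin (mat_topology n) {y \<in> carrier_mat n n. cmod (char_value m l (mat_entries n y)) < c}"
  unfolding openin_mat_topology
proof (intro exI conjI)
  show "open {e. cmod (char_value m l e) < c}"
    by (intro open_Collect_less continuous_intros continuous_char_value)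
qed auto

lemma continuous_map_euclideanI:
  fixes f :: "'a \<Rightarrow> 'b::metric_space"
  assumes "\<And>y \<delta>. y \<in> topspace A \<Longrightarrow> 0 < \<delta> \<Longrightarrow>
    \<exists>W. openin A W \<and> y \<in> W \<and> (\<forall>w \<in> W. dist (f w) (f y) < \<delta>)"
  shows "continuous_map A euclidean f"
  unfolding continuous_map_def
proof (intro conjI allI impI)
  fix V :: "'b set" assume "openin euclidean V"
  then have V: "open V" by simp
  show "openin A {x \<in> topspace A. f x \<in> V}"
  proof (subst openin_subopen, intro ballI)
    fix y assume y: "y \<in> {x \<in> topspace A. f x \<in> V}"
    then obtain \<delta> where \<delta>: "0 < \<delta>" "\<And>b. dist b (f y) < \<delta> \<Longrightarrow> b \<in> V"
      using V unfolding open_dist by blast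
    obtain W where W: "openin A W" "y \<in> W" "\<forall>w \<in> W. dist (f w) (f y) < \<delta>"
      using assms[of y \<delta>] y \<delta>(1) by auto
    then show "\<exists>T. openin A T \<and> y \<in> T \<and> T \<subseteq> {x \<in> topspace A. f x \<in> V}"
      using openin_subset[OF W(1)] \<delta>(2) by (intro exI[of _ W]) auto
  qed
qed auto

lemma continuous_map_fun2:
  fixes f :: "'a \<Rightarrow> nat \<Rightarrow> nat \<Rightarrow> complex"
  shows "continuous_map A euclidean f \<longleftrightarrow> (\<forall>k m. continuous_map A euclidean (\<lambda>y. f y k m))"
  unfolding euclidean_product_topology[symmetric] continuous_map_componentwise_UNIV ..

lemma finite_separation:
  fixes S :: "complex set"
  assumes "finite S"
  shows "\<exists>\<epsilon>>0. \<forall>a\<in>S. \<forall>b\<in>S. a \<noteq> b \<longrightarrow> 2 * \<epsilon> \<le> dist a b"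
proof -
  define D where "D = insert 1 {dist a b | a b. a \<in> S \<and> b \<in> S \<and> a \<noteq> b}"
  have "{dist a b | a b. a \<in> S \<and> b \<in> S \<and> a \<noteq> b} \<subseteq> (\<lambda>(a, b). dist a b) ` (S \<times> S)" by auto
  then have D: "finite D" "D \<noteq> {}" using assms unfolding D_def
    by (auto intro: finite_subset[of _ "(\<lambda>(a, b). dist a b) ` (S \<times> S)"])
  have "0 < Min D" using D by (auto simp: D_def)
  moreover have "Min D \<le> dist a b" if "a \<in> S" "b \<in> S" "a \<noteq> b" for a b
    using D that by (intro Min_le) (auto simp: D_def)
  ultimately show ?thesis by (intro exI[of _ "Min D / 2"]) auto
qed

text \<open>Over \<open>y\<close> near \<open>snd z\<close> one takes the only eigenvalue of each
  block that lies near the given eigenvalue of \<open>z\<close>. Distinct eigenvalues of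
  \<open>z\<close> keep disjoint discs around them, which preserves all inequalities defining
  \<open>e_Omega\<close>.\<close>

theorem local_inverse_exists:
  assumes z: "z \<in> M_Omega_e n"
  shows "\<exists>U \<sigma>. gz_local_inverse n z U \<sigma>"
proof -
  define S where "S = (\<lambda>(k, m). fst z k m) ` ({1..n} \<times> {1..n})"
  have "finite S" by (simp add: S_def)
  from finite_separation[OF this] obtain \<epsilon> where e: "0 < \<epsilon>"
    and sep: "\<And>a b. a \<in> S \<Longrightarrow> b \<in> S \<Longrightarrow> a \<noteq> b \<Longrightarrow> 2 * \<epsilon> \<le> dist a b" by blast
  have inS: "eigval z m k \<in> S" if "m \<in> {1..n}" "k < m" for m k
    unfolding S_def using that by (intro image_eqI[of _ _ "(Suc k, m)"]) auto
  \<comment> \<open>Discs of radius \<open>\<epsilon>\<close> about different eigenvalues of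
    \<open>z\<close> are disjoint, because \<open>\<epsilon>\<close> is at most half of every
    positive distance between them.\<close>
  have far: "a \<noteq> b" if "dist a (eigval z m k) < \<epsilon>" "dist b (eigval z m' k') < \<epsilon>"
    "m \<in> {1..n}" "k < m" "m' \<in> {1..n}" "k' < m'" "eigval z m k \<noteq> eigval z m' k'" for a b m k m' k'
  proof
    assume "a = b"
    then have "dist (eigval z m k) (eigval z m' k') < 2 * \<epsilon>"
      using dist_triangle3[of "eigval z m k" "eigval z m' k'" a] that(1,2) by simp
    then show False using sep[OF inS inS, of m k m' k'] that by auto
  qed
  \<comment> \<open>By \<open>eigenvalue_near\<close>, each of these finitely many open conditions
    provides an eigenvalue of a block of \<open>y\<close> within \<open>\<epsilon>\<close> of the
    one given for \<open>z\<close>.\<close>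
  define U where "U = {y \<in> carrier_mat n n. \<forall>m \<in> {1..n}. \<forall>k \<in> {..<m}.
     cmod (char_value m (eigval z m k) (mat_entries n y)) < \<epsilon> ^ m}"
  define P where "P y m k a \<longleftrightarrow> eigenvalue (upper_left_block m y) a \<and> dist a (eigval z m k) < \<epsilon>" for y m k a
  define \<rho> where "\<rho> y k m = (if 1 \<le> k \<and> k \<le> m \<and> m \<le> n then SOME a. P y m (k - 1) a else 0)" for y k m
  define \<sigma> where "\<sigma> y = (\<rho> y, y)" for y
  have U_open: "openin (mat_topology n) U"
  proof -
    define K where "K = Sigma {1..n} lessThan"
    define E where "E = (\<lambda>(m, k). {y \<in> carrier_mat n n. cmod (char_value m (eigval z m k) (mat_entries n y)) < \<epsilon> ^ m})"
    have "openin (mat_topology n) (\<Inter> (insert (topspace (mat_topology n)) (E ` K)))"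
      by (rule openin_Inter) (auto simp: K_def E_def openin_char_value)
    moreover have "\<Inter> (insert (topspace (mat_topology n)) (E ` K)) = U"
      unfolding U_def K_def E_def topspace_mat_topology by auto
    ultimately show ?thesis by simp
  qed
  have \<rho>: "P y m k (\<rho> y (Suc k) m)" if "y \<in> U" "m \<in> {1..n}" "k < m" for y m k
  proof -
    have "cmod (poly (char_poly (upper_left_block m y)) (eigval z m k)) < \<epsilon> ^ m"
      using that by (auto simp: U_def char_value_block)
    from eigenvalue_near[OF upper_left_block_carrier this e]
    have "\<exists>a. P y m k a" by (simp add: P_def)
    then have "P y m k (SOME a. P y m k a)" by (rule someI_ex)
    then show ?thesis using that by (simp add: \<rho>_def)
  qed
  have \<sigma>M: "\<sigma> y \<in> M_Omega_e n" if y: "y \<in> U" for y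
  proof (rule M_Omega_eI)
    show "snd (\<sigma> y) \<in> carrier_mat n n" using y by (simp add: \<sigma>_def U_def)
    show "\<exists>v. (\<exists>i<m. v i \<noteq> 0) \<and> eigvec (snd (\<sigma> y)) m (eigval (\<sigma> y) m k) v" if "m \<in> {1..n}" "k < m" for m k
      using \<rho>[OF y that] by (simp add: P_def eigenvalue_block_iff \<sigma>_def)
    have d: "dist (\<rho> y k m) (fst z k m) < \<epsilon>" if "1 \<le> k" "k \<le> m" "m \<le> n" for k m
      using \<rho>[OF y, of m "k - 1"] that by (auto simp: P_def)
    have "inj_on (\<lambda>k. \<rho> y k m) {1..m}" if m: "m \<in> {1..n}" for m
    proof (rule inj_onI, rule ccontr)
      fix i j assume ij: "i \<in> {1..m}" "j \<in> {1..m}" "\<rho> y i m = \<rho> y j m" "i \<noteq> j"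
      then have "eigval z m (i - 1) \<noteq> eigval z m (j - 1)"
        using m by (intro eigval_distinct[OF z]) auto
      then have "\<rho> y i m \<noteq> \<rho> y j m"
        by (intro far[of "\<rho> y i m" "i - 1" m "\<rho> y j m" "j - 1" m]) (use d[of i m] d[of j m] ij m in auto)
      then show False using ij(3) by simp
    qed
    moreover have "\<rho> y i m \<noteq> \<rho> y j (m + 1)" if m: "m \<in> {1..n - 1}" and ij: "i \<in> {1..m}" "j \<in> {1..m + 1}" for m i j
    proof -
      have m': "Suc m \<le> n" "i - 1 < m" "j - 1 < Suc m" using m ij by auto
      then have "eigval z m (i - 1) \<noteq> eigval z (Suc m) (j - 1)"
        using m ij by (intro eigval_neq[OF z]) auto
      then show ?thesis
        using far[of "\<rho> y i m" "i - 1" m "\<rho> y j (m + 1)" "j - 1" "Suc m"] d[of i m] d[of j "m + 1"] ij m m' by auto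
    qed
    moreover have "\<rho> y k m = 0" if "\<not> (1 \<le> k \<and> k \<le> m \<and> m \<le> n)" for k m
      using that unfolding \<rho>_def by (rule if_not_P)
    ultimately show "fst (\<sigma> y) \<in> e_Omega n" unfolding e_Omega_def \<sigma>_def by simp
  qed
  \<comment> \<open>The chosen values already exhaust the spectrum of the block, and the discs are
    disjoint, so the choice made by \<open>SOME\<close> was the only one.\<close>
  have unique: "a = \<rho> y (Suc k) m" if y: "y \<in> U" and mk: "m \<in> {1..n}" "k < m" and a: "P y m k a" for y m k a
  proof -
    obtain v where v: "\<exists>i<m. v i \<noteq> 0" "eigvec y m a v" using a by (auto simp: P_def eigenvalue_block_iff)
    then obtain k' where k': "k' < m" "a = \<rho> y (Suc k') m"
      using eigval_complete[OF \<sigma>M[OF y] mk(1), of a v] by (auto simp: \<sigma>_def)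
    have "k' = k"
    proof (rule ccontr)
      assume "k' \<noteq> k"
      then have "eigval z m k' \<noteq> eigval z m k" using k' mk by (intro eigval_distinct[OF z]) auto
      then show False using far[of a k' m a k m] \<rho>[OF y mk(1) k'(1)] k' a mk by (auto simp: P_def)
    qed
    then show ?thesis using k' by simp
  qed
  have zU: "snd z \<in> U"
  proof -
    have "cmod (char_value m (eigval z m k) (mat_entries n (snd z))) < \<epsilon> ^ m" if "m \<in> {1..n}" "k < m" for m k
    proof -
      have "eigenvalue (upper_left_block m (snd z)) (eigval z m k)"
        using M_Omega_e_eigvec[OF z that] by (simp add: eigenvalue_block_iff)
      then have "poly (char_poly (upper_left_block m (snd z))) (eigval z m k) = 0"
        using eigenvalue_root_char_poly[OF upper_left_block_carrier] by blast
      then show ?thesis using that e by (simp add: char_value_block)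
    qed
    then show ?thesis using M_Omega_eD(2)[OF z] by (auto simp: U_def)
  qed
  have \<sigma>z: "\<sigma> (snd z) = z"
  proof -
    have "\<rho> (snd z) k m = fst z k m" for k m
    proof (cases "1 \<le> k \<and> k \<le> m \<and> m \<le> n")
      case True
      then have "k - 1 < m" by linarith
      then have "eigenvalue (upper_left_block m (snd z)) (eigval z m (k - 1))"
        using M_Omega_e_eigvec[OF z, of m "k - 1"] True by (simp add: eigenvalue_block_iff)
      then show ?thesis using unique[OF zU, of m "k - 1" "fst z k m"] True e \<open>k - 1 < m\<close> by (simp add: P_def)
    next
      case False
      then have "fst z k m = 0" using M_Omega_eD(1)[OF z] unfolding e_Omega_def by blast
      then show ?thesis using False by (auto simp: \<rho>_def)
    qed
    then have "\<rho> (snd z) = fst z" by blast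
    then show ?thesis by (simp add: \<sigma>_def)
  qed
  have "continuous_map (subtopology (mat_topology n) U) euclidean (\<lambda>y. \<rho> y k m)" for k m
  proof (cases "1 \<le> k \<and> k \<le> m \<and> m \<le> n")
    case False
    then have "(\<lambda>y. \<rho> y k m) = (\<lambda>_. 0)" by (auto simp: \<rho>_def)
    then show ?thesis by simp
  next
    case True
    define p where "p = k - 1"
    have p: "k = Suc p" "p < m" "m \<in> {1..n}" using True by (auto simp: p_def)
    show ?thesis
    proof (rule continuous_map_euclideanI)
      fix y and \<delta> :: real assume y: "y \<in> topspace (subtopology (mat_topology n) U)" and \<delta>: "0 < \<delta>"
      then have y: "y \<in> U" by simp
      \<comment> \<open>The radius is cut down so that an eigenvalue found within it also stays in
        the disc about the eigenvalue of \<open>z\<close>, where uniqueness identifies it with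
        \<open>\<rho> w k m\<close>.\<close>
      define \<delta>' where "\<delta>' = min \<delta> (\<epsilon> - dist (\<rho> y k m) (eigval z m p))"
      have \<delta>': "0 < \<delta>'" using \<rho>[OF y p(3,2)] \<delta> by (simp add: \<delta>'_def P_def p)
      define W where "W = {w \<in> carrier_mat n n. cmod (char_value m (\<rho> y k m) (mat_entries n w)) < \<delta>' ^ m} \<inter> U"
      have "openin (subtopology (mat_topology n) U) W"
        unfolding W_def by (rule openin_subtopology_Int[OF openin_char_value])
      moreover have "y \<in> W"
      proof -
        have "char_value m (\<rho> y k m) (mat_entries n y) = 0"
          using \<rho>[OF y p(3,2)] True eigenvalue_root_char_poly[OF upper_left_block_carrier, of m y]
          unfolding P_def p(1) by (subst char_value_block) auto
        then show ?thesis using y \<delta>' by (simp add: W_def) (simp add: U_def)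
      qed
      moreover have "dist (\<rho> w k m) (\<rho> y k m) < \<delta>" if w: "w \<in> W" for w
      proof -
        have wU: "w \<in> U" and "cmod (poly (char_poly (upper_left_block m w)) (\<rho> y k m)) < \<delta>' ^ m"
          using w True by (auto simp: W_def char_value_block)
        from eigenvalue_near[OF upper_left_block_carrier this(2) \<delta>'] obtain a
          where a: "eigenvalue (upper_left_block m w) a" "dist a (\<rho> y k m) < \<delta>'" by auto
        have "dist a (eigval z m p) < \<epsilon>"
          using dist_triangle[of a "eigval z m p" "\<rho> y k m"] a(2) by (simp add: \<delta>'_def)
        then have "a = \<rho> w k m" using unique[OF wU p(3,2)] a(1) by (simp add: P_def p)
        then show ?thesis using a(2) by (simp add: \<delta>'_def)
      qed
      ultimately show "\<exists>W. openin (subtopology (mat_topology n) U) W \<and> y \<in> W \<and>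
          (\<forall>w \<in> W. dist (\<rho> w k m) (\<rho> y k m) < \<delta>)" by blast
    qed
  qed
  then have "continuous_map (subtopology (mat_topology n) U) euclidean (\<lambda>y. fst (\<sigma> y))"
    unfolding continuous_map_fun2 by (simp add: \<sigma>_def)
  moreover have "U \<subseteq> M_Omega n" using M_Omega_eD(3)[OF \<sigma>M] by (auto simp: \<sigma>_def)
  ultimately show ?thesis
    unfolding gz_local_inverse_def using U_open zU \<sigma>z \<sigma>M
    by (intro exI[of _ U] exI[of _ \<sigma>]) (auto simp: \<sigma>_def)
qed

lemma openin_mat_line:
  assumes W: "openin (mat_topology n) W" and x: "x \<in> W" and v: "v \<in> carrier_mat n n"
  shows "\<forall>\<^sub>F t in nhds 0. x + t \<cdot>\<^sub>m v \<in> W"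
proof -
  obtain V where V: "open V" "W = mat_entries n -` V \<inter> carrier_mat n n"
    using W unfolding openin_mat_topology by auto
  have xc: "x \<in> carrier_mat n n" using x V by auto
  define f where "f t = mat_entries n (x + t \<cdot>\<^sub>m v)" for t
  have "f = (\<lambda>t i j. if i < n \<and> j < n then x $$ (i, j) + t * v $$ (i, j) else 0)"
    using xc v by (intro ext) (auto simp: f_def mat_entries_def)
  moreover have "continuous_on UNIV (\<lambda>t i j. if i < n \<and> j < n then x $$ (i, j) + t * v $$ (i, j) else 0)"
  proof (intro continuous_on_coordinatewise_then_product)
    show "continuous_on UNIV (\<lambda>t. if i < n \<and> j < n then x $$ (i, j) + t * v $$ (i, j) else 0)" for i j
      by (cases "i < n \<and> j < n") (auto intro!: continuous_intros)
  qed
  ultimately have "open (f -` V)" using open_vimage[OF V(1)] by simp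
  moreover have "x + 0 \<cdot>\<^sub>m v = x" using xc v by (intro eq_matI) auto
  then have "0 \<in> f -` V" using x V by (simp add: f_def)
  ultimately have "\<forall>\<^sub>F t in nhds 0. t \<in> f -` V" by (rule eventually_nhds_in_open)
  then show ?thesis
    by (rule eventually_mono) (use V xc v in \<open>auto simp: f_def\<close>)
qed

section \<open>Gradients\<close>

text \<open>Only the matrix entries are required to be differentiable, with velocity
  \<open>Y\<close>; for the eigenvalues continuity is enough. This covers lines lifted by a
  continuous local inverse as well as the explicit flow lines.\<close>

definition good_curve :: "nat \<Rightarrow> (complex \<Rightarrow> gz_point) \<Rightarrow> complex \<Rightarrow> complex mat \<Rightarrow> bool" where
  "good_curve n \<gamma> q\<^sub>0 Y \<longleftrightarrow> (\<forall>\<^sub>F q in nhds q\<^sub>0. \<gamma> q \<in> M_Omega_e n) \<and>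
     (\<forall>k m. isCont (\<lambda>q. fst (\<gamma> q) k m) q\<^sub>0) \<and> Y \<in> carrier_mat n n \<and>
     (\<forall>i<n. \<forall>j<n. ((\<lambda>q. snd (\<gamma> q) $$ (i, j)) has_field_derivative Y $$ (i, j)) (at q\<^sub>0))"

lemma good_curveD:
  assumes "good_curve n \<gamma> q\<^sub>0 Y"
  shows "\<forall>\<^sub>F q in nhds q\<^sub>0. \<gamma> q \<in> M_Omega_e n" "\<gamma> q\<^sub>0 \<in> M_Omega_e n" "Y \<in> carrier_mat n n"
    "isCont (\<lambda>q. fst (\<gamma> q) k m) q\<^sub>0"
    "i < n \<Longrightarrow> j < n \<Longrightarrow> ((\<lambda>q. snd (\<gamma> q) $$ (i, j)) has_field_derivative Y $$ (i, j)) (at q\<^sub>0)"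
  using assms by (auto simp: good_curve_def dest: eventually_nhds_x_imp_x)

lemma closure_isCont:
  assumes "f \<in> coord_closure n" and c: "good_curve n \<gamma> q\<^sub>0 Y"
  shows "isCont (\<lambda>q. f (\<gamma> q)) q\<^sub>0"
  using assms(1)
proof (induction rule: rat_closure.induct)
  case (base f)
  then show ?case
    by (auto simp: gz_coordinates_def intro: good_curveD(4)[OF c] DERIV_isCont[OF good_curveD(5)[OF c]])
next
  case (inverse f)
  then show ?case using good_curveD(2)[OF c] by (intro continuous_intros) auto
next
  case (cong f g)
  have "\<forall>\<^sub>F q in nhds q\<^sub>0. g (\<gamma> q) = f (\<gamma> q)"
    using good_curveD(1)[OF c] by (rule eventually_mono) (use cong in auto)
  then show ?case using isCont_cong[THEN iffD2] cong.IH by metis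
qed (auto intro!: continuous_intros)

text \<open>First-order perturbation theory: the eigenvalue moves by the velocity paired with the
  right eigenvector and the left eigenvector dual to it.\<close>

lemma curve_eigval_derivative:
  assumes c: "good_curve n \<gamma> q\<^sub>0 Y" and m: "m \<in> {1..n}" and k: "k < m"
  shows "((\<lambda>q. eigval (\<gamma> q) m k) has_field_derivative
     (\<Sum>i<m. \<Sum>j<m. matinv (eigmat (\<gamma> q\<^sub>0) m) $$ (k, i) * Y $$ (i, j) * eigmat (\<gamma> q\<^sub>0) m $$ (j, k))) (at q\<^sub>0)"
proof -
  define L where "L i = matinv (eigmat (\<gamma> q\<^sub>0) m) $$ (k, i)" for i
  define v where "v q i = eigmat (\<gamma> q) m $$ (i, k)" for q i
  define x where "x q i j = snd (\<gamma> q) $$ (i, j)" for q i j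
  define l where "l q = eigval (\<gamma> q) m k" for q
  define N where "N q = (\<Sum>i<m. L i * v q i)" for q
  note M0 = good_curveD(2)[OF c]
  have vc: "isCont (\<lambda>q. v q i) q\<^sub>0" if "i < m" for i
    unfolding v_def by (rule closure_isCont[OF eigmat_closure[OF m that k] c])
  have Nc: "isCont N q\<^sub>0" unfolding N_def using vc by (intro continuous_intros) auto
  have N0: "N q\<^sub>0 = 1" unfolding N_def L_def v_def
    using matinv_left[OF eigmat_carrier eigmat_det[OF M0 m] k k] by simp
  have left: "(\<Sum>i<m. L i * x q\<^sub>0 i j) = l q\<^sub>0 * L j" if "j < m" for j
    unfolding L_def x_def l_def
    by (rule eigvec_left[OF eigmat_carrier eigmat_det[OF M0 m] eigmat_eigvec[OF M0 m] k that])
  \<comment> \<open>Multiplying \<open>x v = l v\<close> by the left eigenvector at \<open>q\<^sub>0\<close> avoids differentiating \<open>v\<close>: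
    its continuity suffices.\<close>
  have diff: "(l q - l q\<^sub>0) * N q = (\<Sum>i<m. \<Sum>j<m. L i * (x q i j - x q\<^sub>0 i j) * v q j)"
    if "\<gamma> q \<in> M_Omega_e n" for q
  proof -
    have "(\<Sum>i<m. \<Sum>j<m. L i * x q i j * v q j) = (\<Sum>i<m. L i * (\<Sum>j<m. x q i j * v q j))"
      by (simp add: sum_distrib_left mult.assoc)
    also have "\<dots> = (\<Sum>i<m. L i * (l q * v q i))"
      using eigmat_eigvec[OF that m k] by (simp add: eigvec_def x_def v_def l_def)
    also have "\<dots> = l q * N q" by (simp add: N_def sum_distrib_left ac_simps)
    finally have 1: "(\<Sum>i<m. \<Sum>j<m. L i * x q i j * v q j) = l q * N q" .
    have "(\<Sum>i<m. \<Sum>j<m. L i * x q\<^sub>0 i j * v q j) = (\<Sum>j<m. (\<Sum>i<m. L i * x q\<^sub>0 i j) * v q j)"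
      by (subst sum.swap) (simp add: sum_distrib_right)
    also have "\<dots> = l q\<^sub>0 * N q" using left by (simp add: N_def sum_distrib_left ac_simps)
    finally have 2: "(\<Sum>i<m. \<Sum>j<m. L i * x q\<^sub>0 i j * v q j) = l q\<^sub>0 * N q" .
    show ?thesis using 1 2 by (simp add: algebra_simps sum_subtractf)
  qed
  \<comment> \<open>The difference quotient comes from \<open>diff\<close> upon division by
    \<open>(q - q\<^sub>0) * N q\<close>; \<open>N\<close> is continuous and equals 1 at
    \<open>q\<^sub>0\<close>.\<close>
  have "((\<lambda>q. (\<Sum>i<m. \<Sum>j<m. L i * ((x q i j - x q\<^sub>0 i j) / (q - q\<^sub>0)) * v q j) / N q)
      \<longlongrightarrow> (\<Sum>i<m. \<Sum>j<m. L i * Y $$ (i, j) * v q\<^sub>0 j) / 1) (at q\<^sub>0)"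
  proof (intro tendsto_divide tendsto_sum tendsto_mult tendsto_const)
    show "(N \<longlongrightarrow> 1) (at q\<^sub>0)" using Nc N0 by (simp add: isCont_def)
    fix i j assume ij: "i \<in> {..<m}" "j \<in> {..<m}"
    show "((\<lambda>q. (x q i j - x q\<^sub>0 i j) / (q - q\<^sub>0)) \<longlongrightarrow> Y $$ (i, j)) (at q\<^sub>0)"
      using good_curveD(5)[OF c, of i j] ij m by (simp add: has_field_derivative_iff x_def)
    show "((\<lambda>q. v q j) \<longlongrightarrow> v q\<^sub>0 j) (at q\<^sub>0)" using vc[of j] ij by (simp add: isCont_def)
  qed simp
  moreover have "\<forall>\<^sub>F q in at q\<^sub>0. (\<Sum>i<m. \<Sum>j<m. L i * ((x q i j - x q\<^sub>0 i j) / (q - q\<^sub>0)) * v q j) / N q =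
      (l q - l q\<^sub>0) / (q - q\<^sub>0)"
  proof -
    have "\<forall>\<^sub>F q in at q\<^sub>0. N q \<noteq> 0"
      using Nc N0 tendsto_imp_eventually_ne[of N 1 "at q\<^sub>0" 0] by (simp add: isCont_def)
    moreover have "\<forall>\<^sub>F q in at q\<^sub>0. \<gamma> q \<in> M_Omega_e n"
      using good_curveD(1)[OF c] by (simp add: eventually_at_filter eventually_mono)
    ultimately show ?thesis
    proof eventually_elim
      case (elim q)
      have "(\<Sum>i<m. \<Sum>j<m. L i * ((x q i j - x q\<^sub>0 i j) / (q - q\<^sub>0)) * v q j) =
          (\<Sum>i<m. \<Sum>j<m. L i * (x q i j - x q\<^sub>0 i j) * v q j) / (q - q\<^sub>0)"
        by (simp add: sum_divide_distrib)
      also have "\<dots> = (l q - l q\<^sub>0) * N q / (q - q\<^sub>0)" using diff[OF elim(2)] by simp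
      finally show ?case using elim(1) by simp
    qed
  qed
  ultimately have "((\<lambda>q. (l q - l q\<^sub>0) / (q - q\<^sub>0)) \<longlongrightarrow>
      (\<Sum>i<m. \<Sum>j<m. L i * Y $$ (i, j) * v q\<^sub>0 j) / 1) (at q\<^sub>0)"
    by (rule Lim_transform_eventually)
  then show ?thesis by (simp add: has_field_derivative_iff l_def L_def v_def)
qed

text \<open>Testing along all good curves, and not only along lifted lines, makes the same gradient
  usable for the bracket, for integral curves and for curves built only to realise a given
  velocity.\<close>

definition has_gradient :: "nat \<Rightarrow> (gz_point \<Rightarrow> complex) \<Rightarrow> gz_point \<Rightarrow> complex mat \<Rightarrow> bool" where
  "has_gradient n f z G \<longleftrightarrow> G \<in> carrier_mat n n \<and>
     (\<forall>\<gamma> q\<^sub>0 Y. good_curve n \<gamma> q\<^sub>0 Y \<and> \<gamma> q\<^sub>0 = z \<longrightarrow>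
        ((\<lambda>q. f (\<gamma> q)) has_field_derivative matrix_trace (G * Y)) (at q\<^sub>0))"

lemma has_gradientD:
  "has_gradient n f z G \<Longrightarrow> G \<in> carrier_mat n n"
  "has_gradient n f z G \<Longrightarrow> good_curve n \<gamma> q\<^sub>0 Y \<Longrightarrow> \<gamma> q\<^sub>0 = z \<Longrightarrow>
     ((\<lambda>q. f (\<gamma> q)) has_field_derivative matrix_trace (G * Y)) (at q\<^sub>0)"
  by (auto simp: has_gradient_def)

lemma matrix_trace_mult:
  assumes "A \<in> carrier_mat n n" "B \<in> carrier_mat n n"
  shows "matrix_trace (A * B) = (\<Sum>i<n. \<Sum>j<n. A $$ (i, j) * B $$ (j, i))"
  using assms by (auto simp: matrix_trace_def scalar_prod_def atLeast0LessThan intro!: sum.cong)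

definition elem_mat :: "nat \<Rightarrow> nat \<Rightarrow> nat \<Rightarrow> complex mat" where
  "elem_mat n i j = Matrix.mat n n (\<lambda>(a, b). if a = i \<and> b = j then 1 else 0)"

lemma elem_mat_carrier: "elem_mat n i j \<in> carrier_mat n n"
  by (simp add: elem_mat_def)

lemma trace_elem_mat:
  assumes "A \<in> carrier_mat n n" "i < n" "j < n"
  shows "matrix_trace (A * elem_mat n i j) = A $$ (j, i)" "matrix_trace (elem_mat n i j * A) = A $$ (j, i)"
proof -
  have "matrix_trace (A * elem_mat n i j) = (\<Sum>p<n. \<Sum>q<n. if q = i then (if p = j then A $$ (p, q) else 0) else 0)"
    unfolding matrix_trace_mult[OF assms(1) elem_mat_carrier]
    by (intro sum.cong) (auto simp: elem_mat_def)
  then show "matrix_trace (A * elem_mat n i j) = A $$ (j, i)" using assms by simp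
  have "matrix_trace (elem_mat n i j * A) = (\<Sum>p<n. \<Sum>q<n. if q = j then (if p = i then A $$ (q, p) else 0) else 0)"
    unfolding matrix_trace_mult[OF elem_mat_carrier assms(1)]
    by (intro sum.cong) (auto simp: elem_mat_def)
  then show "matrix_trace (elem_mat n i j * A) = A $$ (j, i)" using assms by simp
qed

text \<open>The spectral projector \<open>P\<close> of the overview, padded with zeros to size
  \<open>n\<close>.\<close>

definition eigproj :: "nat \<Rightarrow> nat \<Rightarrow> nat \<Rightarrow> gz_point \<Rightarrow> complex mat" where
  "eigproj n m k z = Matrix.mat n n (\<lambda>(i, j).
     if i < m \<and> j < m then eigmat z m $$ (i, k) * matinv (eigmat z m) $$ (k, j) else 0)"

lemma eigproj_carrier: "eigproj n m k z \<in> carrier_mat n n"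
  by (simp add: eigproj_def)

lemma sum_truncate:
  fixes f :: "nat \<Rightarrow> complex"
  assumes "m \<le> n" "\<And>i. i < n \<Longrightarrow> \<not> i < m \<Longrightarrow> f i = 0"
  shows "(\<Sum>i<n. f i) = (\<Sum>i<m. f i)"
  using assms by (intro sum.mono_neutral_right) auto

lemma has_gradient_eigval:
  assumes "m \<in> {1..n}" "k < m"
  shows "has_gradient n (\<lambda>z. eigval z m k) z (eigproj n m k z)"
  unfolding has_gradient_def
proof (intro conjI allI impI eigproj_carrier)
  fix \<gamma> q\<^sub>0 Y assume c: "good_curve n \<gamma> q\<^sub>0 Y \<and> \<gamma> q\<^sub>0 = z"
  have Y: "Y \<in> carrier_mat n n" using c good_curveD by blast
  have "matrix_trace (eigproj n m k z * Y) = (\<Sum>i<n. \<Sum>j<n. eigproj n m k z $$ (i, j) * Y $$ (j, i))"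
    by (rule matrix_trace_mult[OF eigproj_carrier Y])
  also have "\<dots> = (\<Sum>i<m. \<Sum>j<n. eigproj n m k z $$ (i, j) * Y $$ (j, i))"
    using assms by (intro sum_truncate) (auto simp: eigproj_def)
  also have "\<dots> = (\<Sum>i<m. \<Sum>j<m. eigproj n m k z $$ (i, j) * Y $$ (j, i))"
    using assms by (intro sum.cong refl sum_truncate) (auto simp: eigproj_def)
  also have "\<dots> = (\<Sum>i<m. \<Sum>j<m. matinv (eigmat z m) $$ (k, i) * Y $$ (i, j) * eigmat z m $$ (j, k))"
    using assms by (subst sum.swap) (auto simp: eigproj_def intro!: sum.cong)
  finally show "((\<lambda>q. eigval (\<gamma> q) m k) has_field_derivative matrix_trace (eigproj n m k z * Y)) (at q\<^sub>0)"
    using curve_eigval_derivative[of n \<gamma> q\<^sub>0 Y m k] c assms by simp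
qed

lemma has_gradient_entry:
  assumes "i < n" "j < n"
  shows "has_gradient n (\<lambda>z. snd z $$ (i, j)) z (elem_mat n j i)"
  unfolding has_gradient_def
  using assms by (auto simp: elem_mat_carrier trace_elem_mat good_curveD)

lemma has_gradient_const: "has_gradient n (\<lambda>_. c) z (0\<^sub>m n n)"
  unfolding has_gradient_def
proof (intro conjI allI impI zero_carrier_mat)
  fix \<gamma> q\<^sub>0 Y assume "good_curve n \<gamma> q\<^sub>0 Y \<and> \<gamma> q\<^sub>0 = z"
  then have "Y \<in> carrier_mat n n" using good_curveD(3) by blast
  then have "matrix_trace (0\<^sub>m n n * Y) = 0" by (simp add: matrix_trace_def)
  then show "((\<lambda>q. c) has_field_derivative matrix_trace (0\<^sub>m n n * Y)) (at q\<^sub>0)" by simp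
qed

lemma matrix_trace_linear_left:
  assumes "A \<in> carrier_mat n n" "B \<in> carrier_mat n n" "Y \<in> carrier_mat n n"
  shows "matrix_trace ((a \<cdot>\<^sub>m A + b \<cdot>\<^sub>m B) * Y) = a * matrix_trace (A * Y) + b * matrix_trace (B * Y)"
proof -
  have c: "a \<cdot>\<^sub>m A + b \<cdot>\<^sub>m B \<in> carrier_mat n n" using assms by simp
  have e: "(a \<cdot>\<^sub>m A + b \<cdot>\<^sub>m B) $$ (i, j) = a * A $$ (i, j) + b * B $$ (i, j)" if "i < n" "j < n" for i j
    using assms that by simp
  show ?thesis
    unfolding matrix_trace_mult[OF c assms(3)] matrix_trace_mult[OF assms(1,3)] matrix_trace_mult[OF assms(2,3)]
      sum_distrib_left sum.distrib[symmetric]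
    by (intro sum.cong refl) (auto simp: e algebra_simps)
qed

lemma has_gradient_add:
  assumes "has_gradient n f z F" "has_gradient n g z G"
  shows "has_gradient n (\<lambda>z. f z + g z) z (1 \<cdot>\<^sub>m F + 1 \<cdot>\<^sub>m G)"
  unfolding has_gradient_def
proof (intro conjI allI impI)
  show "1 \<cdot>\<^sub>m F + 1 \<cdot>\<^sub>m G \<in> carrier_mat n n" using assms[THEN has_gradientD(1)] by simp
  fix \<gamma> q\<^sub>0 Y assume c: "good_curve n \<gamma> q\<^sub>0 Y \<and> \<gamma> q\<^sub>0 = z"
  show "((\<lambda>q. f (\<gamma> q) + g (\<gamma> q)) has_field_derivative matrix_trace ((1 \<cdot>\<^sub>m F + 1 \<cdot>\<^sub>m G) * Y)) (at q\<^sub>0)"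
    using c assms[THEN has_gradientD(1)]
    by (auto simp: matrix_trace_linear_left good_curveD intro!: DERIV_add assms[THEN has_gradientD(2)])
qed

lemma has_gradient_mult:
  assumes "has_gradient n f z F" "has_gradient n g z G"
  shows "has_gradient n (\<lambda>z. f z * g z) z (g z \<cdot>\<^sub>m F + f z \<cdot>\<^sub>m G)"
  unfolding has_gradient_def
proof (intro conjI allI impI)
  show "g z \<cdot>\<^sub>m F + f z \<cdot>\<^sub>m G \<in> carrier_mat n n" using assms[THEN has_gradientD(1)] by simp
  fix \<gamma> q\<^sub>0 Y assume c: "good_curve n \<gamma> q\<^sub>0 Y \<and> \<gamma> q\<^sub>0 = z"
  then have Y: "Y \<in> carrier_mat n n" using good_curveD by blast
  show "((\<lambda>q. f (\<gamma> q) * g (\<gamma> q)) has_field_derivative matrix_trace ((g z \<cdot>\<^sub>m F + f z \<cdot>\<^sub>m G) * Y)) (at q\<^sub>0)"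
    using DERIV_mult[OF has_gradientD(2)[OF assms(1), of \<gamma> q\<^sub>0 Y] has_gradientD(2)[OF assms(2), of \<gamma> q\<^sub>0 Y]] c
    unfolding matrix_trace_linear_left[OF has_gradientD(1)[OF assms(1)] has_gradientD(1)[OF assms(2)] Y]
    by (simp add: algebra_simps)
qed

lemma has_gradient_inverse:
  assumes f: "has_gradient n f z F" and 0: "f z \<noteq> 0"
  shows "has_gradient n (\<lambda>z. inverse (f z)) z ((- inverse (f z ^ 2)) \<cdot>\<^sub>m F)"
  unfolding has_gradient_def
proof (intro conjI allI impI)
  note F = has_gradientD(1)[OF f]
  show "(- inverse (f z ^ 2)) \<cdot>\<^sub>m F \<in> carrier_mat n n" using F by simp
  fix \<gamma> q\<^sub>0 Y assume c: "good_curve n \<gamma> q\<^sub>0 Y \<and> \<gamma> q\<^sub>0 = z"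
  then have Y: "Y \<in> carrier_mat n n" using good_curveD by blast
  have e: "matrix_trace (((- inverse (f z ^ 2)) \<cdot>\<^sub>m F) * Y) = - inverse (f z ^ 2) * matrix_trace (F * Y)"
    using matrix_trace_linear_left[OF F zero_carrier_mat Y, of "- inverse (f z ^ 2)" 0] F Y by simp
  have "((\<lambda>q. inverse (f (\<gamma> q))) has_field_derivative
      - (inverse (f (\<gamma> q\<^sub>0)) * matrix_trace (F * Y) * inverse (f (\<gamma> q\<^sub>0)))) (at q\<^sub>0)"
    by (rule DERIV_inverse'[OF has_gradientD(2)[OF f]]) (use c 0 in auto)
  then show "((\<lambda>q. inverse (f (\<gamma> q))) has_field_derivative matrix_trace (((- inverse (f z ^ 2)) \<cdot>\<^sub>m F) * Y)) (at q\<^sub>0)"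
    unfolding e using c by (simp add: power2_eq_square ac_simps)
qed

lemma curve_in_zariski_open:
  assumes V: "gz_zariski_open n V" and c: "good_curve n \<gamma> q\<^sub>0 Y" and z: "\<gamma> q\<^sub>0 \<in> V"
  shows "\<forall>\<^sub>F q in nhds q\<^sub>0. \<gamma> q \<in> V"
proof -
  obtain S where S: "S \<subseteq> gz_polynomial n" "V = {z \<in> M_Omega_e n. \<exists>p \<in> S. p z \<noteq> 0}"
    using V by (auto simp: gz_zariski_open_def)
  then obtain p where p: "p \<in> S" "p (\<gamma> q\<^sub>0) \<noteq> 0" using z by auto
  have "isCont (\<lambda>q. p (\<gamma> q)) q\<^sub>0"
    using closure_isCont[OF polynomial_closure c] S(1) p(1) by blast
  then have "\<forall>\<^sub>F q in nhds q\<^sub>0. p (\<gamma> q) \<noteq> 0"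
    using tendsto_imp_eventually_ne[OF _ p(2)] tendsto_at_iff_tendsto_nhds[of "\<lambda>q. p (\<gamma> q)" q\<^sub>0]
    unfolding isCont_def by blast
  with good_curveD(1)[OF c] show ?thesis
    by eventually_elim (use S p in auto)
qed

lemma has_gradient_cong:
  assumes g: "has_gradient n g z G" and V: "gz_zariski_open n V" "z \<in> V" and "\<forall>w \<in> V. f w = g w"
  shows "has_gradient n f z G"
  unfolding has_gradient_def
proof (intro conjI allI impI has_gradientD(1)[OF g])
  fix \<gamma> q\<^sub>0 Y assume c: "good_curve n \<gamma> q\<^sub>0 Y \<and> \<gamma> q\<^sub>0 = z"
  have "\<forall>\<^sub>F q in nhds q\<^sub>0. \<gamma> q \<in> V" using curve_in_zariski_open[OF V(1)] c V(2) by blast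
  then have "\<forall>\<^sub>F q in nhds q\<^sub>0. f (\<gamma> q) = g (\<gamma> q)" by (rule eventually_mono) (use assms(4) in auto)
  then show "((\<lambda>q. f (\<gamma> q)) has_field_derivative matrix_trace (G * Y)) (at q\<^sub>0)"
    using DERIV_cong_ev[OF refl _ refl, THEN iffD2] has_gradientD(2)[OF g] c by metis
qed

lemma closure_has_gradient:
  assumes "f \<in> coord_closure n" and z: "z \<in> M_Omega_e n"
  shows "\<exists>G. has_gradient n f z G"
  using assms(1)
proof (induction rule: rat_closure.induct)
  case (base f)
  then consider k m where "1 \<le> k" "k \<le> m" "m \<le> n" "f = (\<lambda>z. fst z k m)" |
    i j where "i < n" "j < n" "f = (\<lambda>z. snd z $$ (i, j))"
    by (auto simp: gz_coordinates_def)
  then show ?case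
  proof cases
    case 1
    then obtain p where "k = Suc p" by (cases k) auto
    then show ?thesis using has_gradient_eigval[of m n p z] 1 by auto
  next
    case 2
    then show ?thesis using has_gradient_entry by blast
  qed
next
  case (inverse f)
  then show ?case using has_gradient_inverse z by blast
next
  case (cong f g)
  then show ?case using has_gradient_cong[OF _ zariski_open_UNIV z] by metis
qed (blast intro: has_gradient_const has_gradient_add has_gradient_mult)+

lemma regular_has_gradient:
  assumes "gz_regular_on n U f" and z: "z \<in> U" and U: "U \<subseteq> M_Omega_e n"
  shows "\<exists>G. has_gradient n f z G"
proof -
  obtain V g h where V: "gz_zariski_open n V" "z \<in> V" "V \<subseteq> U"
    and gh: "g \<in> gz_polynomial n" "h \<in> gz_polynomial n" "\<forall>w \<in> V. h w \<noteq> 0 \<and> f w = g w / h w"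
    using assms(1) z unfolding gz_regular_on_def by blast
  have zM: "z \<in> M_Omega_e n" using z U by auto
  obtain G H where G: "has_gradient n g z G" and H: "has_gradient n h z H"
    using closure_has_gradient[OF polynomial_closure _] gh zM by meson
  have "has_gradient n (\<lambda>z. g z * inverse (h z)) z (inverse (h z) \<cdot>\<^sub>m G + g z \<cdot>\<^sub>m ((- inverse (h z ^ 2)) \<cdot>\<^sub>m H))"
    using gh V by (intro has_gradient_mult has_gradient_inverse G H) auto
  moreover have "\<forall>w \<in> V. f w = g w * inverse (h w)" using gh(3) by (simp add: divide_inverse)
  ultimately show ?thesis using has_gradient_cong[OF _ V(1,2)] by blast
qed

text \<open>This is the link between the two notions of gradient: a straight line of matrices,
  lifted by a local inverse, is a good curve.\<close>

lemma good_curve_line: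
  assumes \<sigma>: "gz_local_inverse n z U \<sigma>" and v: "v \<in> carrier_mat n n"
  shows "good_curve n (\<lambda>t. \<sigma> (snd z + t \<cdot>\<^sub>m v)) 0 v" "\<sigma> (snd z + 0 \<cdot>\<^sub>m v) = z"
proof -
  have U: "openin (mat_topology n) U" "snd z \<in> U" and \<sigma>z: "\<sigma> (snd z) = z"
    and \<sigma>M: "\<And>y. y \<in> U \<Longrightarrow> \<sigma> y \<in> M_Omega_e n \<and> snd (\<sigma> y) = y"
    and cont: "continuous_map (subtopology (mat_topology n) U) euclidean (\<lambda>y. fst (\<sigma> y))"
    using \<sigma> by (auto simp: gz_local_inverse_def)
  have x: "snd z \<in> carrier_mat n n" using openin_subset[OF U(1)] U(2) by (auto simp: topspace_mat_topology)
  have x0: "snd z + 0 \<cdot>\<^sub>m v = snd z" using x v by (intro eq_matI) auto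
  show "\<sigma> (snd z + 0 \<cdot>\<^sub>m v) = z" using x0 \<sigma>z by simp
  have ev: "\<forall>\<^sub>F t in nhds 0. snd z + t \<cdot>\<^sub>m v \<in> U" by (rule openin_mat_line[OF U v])
  have "isCont (\<lambda>t. fst (\<sigma> (snd z + t \<cdot>\<^sub>m v)) k m) 0" for k m
    unfolding isCont_def tendsto_def
  proof (intro allI impI)
    fix S assume S: "open S" "fst (\<sigma> (snd z + 0 \<cdot>\<^sub>m v)) k m \<in> S"
    have "continuous_map (subtopology (mat_topology n) U) euclidean (\<lambda>y. fst (\<sigma> y) k m)"
      using cont unfolding continuous_map_fun2 by blast
    then have "openin (subtopology (mat_topology n) U) {y \<in> topspace (subtopology (mat_topology n) U). fst (\<sigma> y) k m \<in> S}"
      using S(1) unfolding continuous_map_def by simp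
    then have "openin (mat_topology n) {y \<in> topspace (subtopology (mat_topology n) U). fst (\<sigma> y) k m \<in> S}"
      using openin_open_subtopology[OF U(1)] by blast
    then have "\<forall>\<^sub>F t in nhds 0. snd z + t \<cdot>\<^sub>m v \<in> {y \<in> topspace (subtopology (mat_topology n) U). fst (\<sigma> y) k m \<in> S}"
      using S(2) U(2) x x0 by (intro openin_mat_line[OF _ _ v]) (auto simp: topspace_mat_topology)
    then show "\<forall>\<^sub>F t in at 0. fst (\<sigma> (snd z + t \<cdot>\<^sub>m v)) k m \<in> S"
      unfolding eventually_at_filter by (rule eventually_mono) auto
  qed
  moreover have "((\<lambda>t. snd (\<sigma> (snd z + t \<cdot>\<^sub>m v)) $$ (i, j)) has_field_derivative v $$ (i, j)) (at 0)"
    if ij: "i < n" "j < n" for i j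
  proof -
    have "\<forall>\<^sub>F t in nhds 0. snd (\<sigma> (snd z + t \<cdot>\<^sub>m v)) $$ (i, j) = snd z $$ (i, j) + t * v $$ (i, j)"
      using ev by (rule eventually_mono) (use \<sigma>M x v ij in auto)
    moreover have "((\<lambda>t. snd z $$ (i, j) + t * v $$ (i, j)) has_field_derivative v $$ (i, j)) (at 0)"
      by (auto intro!: derivative_eq_intros)
    ultimately show ?thesis by (subst DERIV_cong_ev[OF refl _ refl])
  qed
  moreover have "\<forall>\<^sub>F t in nhds 0. \<sigma> (snd z + t \<cdot>\<^sub>m v) \<in> M_Omega_e n"
    using ev by (rule eventually_mono) (use \<sigma>M in auto)
  ultimately show "good_curve n (\<lambda>t. \<sigma> (snd z + t \<cdot>\<^sub>m v)) 0 v"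
    using v by (simp add: good_curve_def)
qed

lemma good_curve_exists:
  assumes "z \<in> M_Omega_e n" "v \<in> carrier_mat n n"
  shows "\<exists>\<gamma>. good_curve n \<gamma> 0 v \<and> \<gamma> 0 = z"
  using local_inverse_exists[OF assms(1)] good_curve_line[OF _ assms(2)] by blast

text \<open>The trace pairing is nondegenerate, as testing against elementary matrices shows, so the
  description of \<open>mat_gradient\<close> has one solution only.\<close>

lemma mat_gradient_eq:
  assumes \<sigma>: "gz_local_inverse n z U \<sigma>" and f: "has_gradient n f z G"
  shows "mat_gradient n (f \<circ> \<sigma>) (snd z) = G"
  unfolding mat_gradient_def
proof (rule the_equality)
  note G = has_gradientD(1)[OF f]
  have d: "((\<lambda>t. (f \<circ> \<sigma>) (snd z + t \<cdot>\<^sub>m v)) has_field_derivative matrix_trace (G * v)) (at 0)"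
    if "v \<in> carrier_mat n n" for v
    using has_gradientD(2)[OF f good_curve_line[OF \<sigma> that]] by simp
  then show "G \<in> carrier_mat n n \<and> (\<forall>v \<in> carrier_mat n n.
     ((\<lambda>t. (f \<circ> \<sigma>) (snd z + t \<cdot>\<^sub>m v)) has_field_derivative matrix_trace (G * v)) (at 0))"
    using G by blast
  fix H assume H: "H \<in> carrier_mat n n \<and> (\<forall>v \<in> carrier_mat n n.
     ((\<lambda>t. (f \<circ> \<sigma>) (snd z + t \<cdot>\<^sub>m v)) has_field_derivative matrix_trace (H * v)) (at 0))"
  have "H $$ (j, i) = G $$ (j, i)" if ij: "i < n" "j < n" for i j
  proof -
    have "matrix_trace (H * elem_mat n i j) = matrix_trace (G * elem_mat n i j)"
      using H d[OF elem_mat_carrier] elem_mat_carrier DERIV_unique by blast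
    then show ?thesis using trace_elem_mat(1) H G ij by simp
  qed
  then show "H = G" using H G by (intro eq_matI) auto
qed

lemma matrix_trace_commutator:
  assumes x: "x \<in> carrier_mat n n" and F: "F \<in> carrier_mat n n" and G: "G \<in> carrier_mat n n"
  shows "matrix_trace (x * (F * G - G * F)) = matrix_trace (G * (x * F - F * (x :: complex mat)))"
proof -
  have 1: "x * (F * G - G * F) = x * (F * G) - x * (G * F)"
    using x F G by (intro mult_minus_distrib_mat) auto
  have 2: "G * (x * F - F * x) = G * (x * F) - G * (F * x)"
    using x F G by (intro mult_minus_distrib_mat) auto
  have sub: "matrix_trace (A - B) = matrix_trace A - matrix_trace B"
    if "A \<in> carrier_mat n n" "B \<in> carrier_mat n n" for A B :: "complex mat"
    using that by (auto simp: matrix_trace_def sum_subtractf)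
  have comm: "matrix_trace (A * B) = matrix_trace (B * A)"
    if "A \<in> carrier_mat n n" "B \<in> carrier_mat n n" for A B :: "complex mat"
    unfolding matrix_trace_mult[OF that] matrix_trace_mult[OF that(2,1)]
    by (subst sum.swap) (simp add: mult.commute)
  have c: "F * G \<in> carrier_mat n n" "G * F \<in> carrier_mat n n" "x * F \<in> carrier_mat n n" "F * x \<in> carrier_mat n n"
    using x F G by auto
  have "matrix_trace (x * (F * G)) = matrix_trace (G * (x * F))"
    using comm[OF c(3) G] assoc_mult_mat[OF x F G] by simp
  moreover have "matrix_trace (x * (G * F)) = matrix_trace (G * (F * x))"
    using comm[OF x c(2)] assoc_mult_mat[OF G F x] by simp
  ultimately show ?thesis
    unfolding 1 2 using sub[OF mult_carrier_mat[OF x c(1)] mult_carrier_mat[OF x c(2)]]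
      sub[OF mult_carrier_mat[OF G c(3)] mult_carrier_mat[OF G c(4)]] by simp
qed

text \<open>Gradients belong to the variety and not to the local inverse, so every choice of the
  latter yields the same number. The trace is written as the derivative of \<open>g\<close> along
  \<open>[x, F]\<close>, by cyclicity.\<close>

lemma bracket_eq:
  assumes z: "z \<in> M_Omega_e n" and f: "has_gradient n f z F" and g: "has_gradient n g z G"
  shows "gz_bracket n f g z = matrix_trace (G * (snd z * F - F * snd z))"
  unfolding gz_bracket_def
proof (rule the_equality)
  have *: "mat_bracket n (f \<circ> \<sigma>) (g \<circ> \<sigma>) (snd z) = matrix_trace (G * (snd z * F - F * snd z))"
    if "gz_local_inverse n z U \<sigma>" for U \<sigma>
    unfolding mat_bracket_def mat_gradient_eq[OF that f] mat_gradient_eq[OF that g]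
    by (rule matrix_trace_commutator[OF M_Omega_eD(2)[OF z] has_gradientD(1)[OF f] has_gradientD(1)[OF g]])
  show "\<exists>U \<sigma>. gz_local_inverse n z U \<sigma> \<and>
      matrix_trace (G * (snd z * F - F * snd z)) = mat_bracket n (f \<circ> \<sigma>) (g \<circ> \<sigma>) (snd z)"
    using local_inverse_exists[OF z] * by metis
  show "c = matrix_trace (G * (snd z * F - F * snd z))"
    if "\<exists>U \<sigma>. gz_local_inverse n z U \<sigma> \<and> c = mat_bracket n (f \<circ> \<sigma>) (g \<circ> \<sigma>) (snd z)" for c
    using that * by auto
qed

lemma trace_commutator_antisym:
  assumes x: "x \<in> carrier_mat n n" and F: "F \<in> carrier_mat n n" and G: "G \<in> carrier_mat n n"
  shows "matrix_trace (F * (x * G - G * x)) = - matrix_trace (G * (x * F - F * (x :: complex mat)))"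
proof -
  have "x * (G * F - F * G) = - (x * (F * G - G * F))"
  proof -
    have "G * F - F * G = - (F * G - G * F)" using F G by (intro eq_matI) auto
    then show ?thesis using x F G by simp
  qed
  moreover have "x * (F * G - G * F) \<in> carrier_mat n n"
    using x F G by (intro mult_carrier_mat minus_carrier_mat) auto
  moreover have "matrix_trace (- A) = - matrix_trace A" if "A \<in> carrier_mat n n" for A :: "complex mat"
    using that by (auto simp: matrix_trace_def sum_negf)
  ultimately show ?thesis
    unfolding matrix_trace_commutator[OF x F G, symmetric] matrix_trace_commutator[OF x G F, symmetric]
    by simp
qed

lemma bracket_antisym:
  assumes z: "z \<in> M_Omega_e n" and f: "has_gradient n f z F" and g: "has_gradient n g z G"
  shows "gz_bracket n g f z = - gz_bracket n f g z"
  unfolding bracket_eq[OF z f g] bracket_eq[OF z g f]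
  by (rule trace_commutator_antisym[OF M_Omega_eD(2)[OF z] has_gradientD(1)[OF f] has_gradientD(1)[OF g]])

section \<open>Poisson brackets of eigenvalues and eigenvector coordinates\<close>

text \<open>By the product rule, \<open>sval\<close> changes through the row and through the
  eigenvector. The derivative of the latter is not computed but recognised: \<open>y\<close> solves
  the linearised eigenvector equation with last coordinate 0, and such a solution is unique. The
  number \<open>\<mu>\<close> stands for the derivative of the eigenvalue. Applications only have to
  exhibit \<open>y\<close> and \<open>\<mu>\<close>.\<close>

lemma sval_gradient_value:
  assumes z: "z \<in> M_Omega_e n" and m: "1 \<le> m" "m < n" "k < m" and A: "A \<in> carrier_mat n n"
    and G: "has_gradient n (sval m k) z G" and y0: "y (m - 1) = 0"
    and y: "\<And>i. i < m \<Longrightarrow> (\<Sum>j<m. snd z $$ (i, j) * y j) - eigval z m k * y i +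
       (\<Sum>j<m. A $$ (i, j) * eigmat z m $$ (j, k)) = \<mu> * eigmat z m $$ (i, k)"
  shows "matrix_trace (G * A) = (\<Sum>j<m. A $$ (m, j) * eigmat z m $$ (j, k)) + (\<Sum>j<m. snd z $$ (m, j) * y j)"
proof -
  have m': "m \<in> {1..n}" using m by simp
  obtain \<gamma> where c: "good_curve n \<gamma> 0 A" and \<gamma>0: "\<gamma> 0 = z" using good_curve_exists[OF z A] by blast
  define v where "v j = eigmat z m $$ (j, k)" for j
  define l where "l = eigval z m k"
  have "\<exists>D. \<forall>j<m. ((\<lambda>q. eigmat (\<gamma> q) m $$ (j, k)) has_field_derivative D j) (at 0)"
  proof -
    have "\<forall>j. \<exists>d. j < m \<longrightarrow> ((\<lambda>q. eigmat (\<gamma> q) m $$ (j, k)) has_field_derivative d) (at 0)"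
      using closure_has_gradient[OF eigmat_closure[OF m' _ m(3)] z] has_gradientD(2)[OF _ c \<gamma>0] by blast
    from choice[OF this] show ?thesis by blast
  qed
  then obtain D where D: "\<And>j. j < m \<Longrightarrow> ((\<lambda>q. eigmat (\<gamma> q) m $$ (j, k)) has_field_derivative D j) (at 0)" by blast
  obtain dl where dl: "((\<lambda>q. eigval (\<gamma> q) m k) has_field_derivative dl) (at 0)"
    using has_gradientD(2)[OF has_gradient_eigval[OF m' m(3)] c \<gamma>0] by blast
  have X: "((\<lambda>q. snd (\<gamma> q) $$ (i, j)) has_field_derivative A $$ (i, j)) (at 0)" if "i < n" "j < n" for i j
    using good_curveD(5)[OF c that] .
  have D0: "D (m - 1) = 0"
  proof -
    have "(\<lambda>q. eigmat (\<gamma> q) m $$ (m - 1, k)) = (\<lambda>_. 1)" using eigmat_last'[OF m(3)] by simp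
    then show ?thesis using D[of "m - 1"] m DERIV_unique[OF _ DERIV_const] by fastforce
  qed
  have eq: "(\<Sum>j<m. A $$ (i, j) * v j + D j * snd z $$ (i, j)) = dl * v i + D i * l" if i: "i < m" for i
  proof -
    have 1: "((\<lambda>q. \<Sum>j<m. snd (\<gamma> q) $$ (i, j) * eigmat (\<gamma> q) m $$ (j, k)) has_field_derivative
        (\<Sum>j<m. A $$ (i, j) * eigmat (\<gamma> 0) m $$ (j, k) + D j * snd (\<gamma> 0) $$ (i, j))) (at 0)"
      using i m by (intro DERIV_sum DERIV_mult X D) auto
    have 2: "((\<lambda>q. eigval (\<gamma> q) m k * eigmat (\<gamma> q) m $$ (i, k)) has_field_derivative
        (dl * eigmat (\<gamma> 0) m $$ (i, k) + D i * eigval (\<gamma> 0) m k)) (at 0)"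
      by (intro DERIV_mult dl D i)
    have "\<forall>\<^sub>F q in nhds 0. (\<Sum>j<m. snd (\<gamma> q) $$ (i, j) * eigmat (\<gamma> q) m $$ (j, k)) =
        eigval (\<gamma> q) m k * eigmat (\<gamma> q) m $$ (i, k)"
      using good_curveD(1)[OF c]
      by (rule eventually_mono) (use eigmat_eigvec[OF _ m' m(3)] i in \<open>auto simp: eigvec_def\<close>)
    from DERIV_cong_ev[OF refl this refl, THEN iffD1, OF 1] 2 DERIV_unique
    show ?thesis unfolding v_def l_def \<gamma>0 by blast
  qed
  \<comment> \<open>\<open>y\<close> and the true derivative \<open>D\<close> satisfy the same
    linear equation up to a multiple of the eigenvector, so \<open>eigvec_multiple\<close> applies
    to their difference.\<close>
  define d where "d j = y j - D j" for j
  have "(\<Sum>j<m. snd z $$ (i, j) * d j) - eigval z m k * d i = (\<mu> - dl) * eigmat z m $$ (i, k)" if i: "i < m" for i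
  proof -
    define S where "S = (\<Sum>j<m. A $$ (i, j) * eigmat z m $$ (j, k))"
    have 1: "(\<Sum>j<m. snd z $$ (i, j) * y j) = \<mu> * eigmat z m $$ (i, k) + eigval z m k * y i - S"
      using y[OF i] unfolding S_def[symmetric] by (simp add: algebra_simps)
    have "S + (\<Sum>j<m. snd z $$ (i, j) * D j) = dl * eigmat z m $$ (i, k) + D i * eigval z m k"
      using eq[OF i] unfolding S_def v_def l_def by (simp add: sum.distrib mult.commute)
    then have 2: "(\<Sum>j<m. snd z $$ (i, j) * D j) = dl * eigmat z m $$ (i, k) + D i * eigval z m k - S"
      by (simp add: algebra_simps)
    show ?thesis unfolding d_def right_diff_distrib sum_subtractf 1 2 by (simp add: algebra_simps)
  qed
  from eigvec_multiple[OF eigmat_carrier eigmat_det[OF z m'] eigmat_eigvec[OF z m'] eigval_inj[OF z m'] m(3) this]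
  obtain a where a: "\<forall>i<m. d i = a * eigmat z m $$ (i, k)" by blast
  \<comment> \<open>Both vectors have last coordinate 0, whereas the eigenvector has last coordinate
    1.\<close>
  have "a = 0" using a[rule_format, of "m - 1"] eigmat_last'[OF m(3)] y0 D0 m by (simp add: d_def)
  then have yD: "y j = D j" if "j < m" for j using a that by (simp add: d_def)
  have "((\<lambda>q. sval m k (\<gamma> q)) has_field_derivative
      (\<Sum>j<m. A $$ (m, j) * eigmat (\<gamma> 0) m $$ (j, k) + D j * snd (\<gamma> 0) $$ (m, j))) (at 0)"
    unfolding sval_def using m by (intro DERIV_sum DERIV_mult X D) auto
  with has_gradientD(2)[OF G c \<gamma>0] have "matrix_trace (G * A) =
      (\<Sum>j<m. A $$ (m, j) * eigmat (\<gamma> 0) m $$ (j, k) + D j * snd (\<gamma> 0) $$ (m, j))"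
    using DERIV_unique by blast
  then show ?thesis using yD by (simp add: \<gamma>0 sum.distrib ac_simps)
qed

lemma commutator_entry:
  assumes x: "x \<in> carrier_mat n n" and C: "C \<in> carrier_mat n n" and "m \<le> n"
    and sup: "\<And>i j. i < n \<Longrightarrow> j < n \<Longrightarrow> \<not> (i < m \<and> j < m) \<Longrightarrow> C $$ (i, j) = (0::complex)"
    and ij: "i < n" "j < n"
  shows "(x * C - C * x) $$ (i, j) = (\<Sum>l<m. x $$ (i, l) * C $$ (l, j)) - (\<Sum>l<m. C $$ (i, l) * x $$ (l, j))"
proof -
  have "(x * C - C * x) $$ (i, j) = (x * C) $$ (i, j) - (C * x) $$ (i, j)"
    using x C ij by simp
  also have "(x * C) $$ (i, j) = (\<Sum>l<m. x $$ (i, l) * C $$ (l, j))"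
    unfolding mat_mult_entry[OF x C ij] using \<open>m \<le> n\<close> sup ij by (intro sum_truncate) auto
  also have "(C * x) $$ (i, j) = (\<Sum>l<m. C $$ (i, l) * x $$ (l, j))"
    unfolding mat_mult_entry[OF C x ij] using \<open>m \<le> n\<close> sup ij by (intro sum_truncate) auto
  finally show ?thesis .
qed

text \<open>\<open>[x, C]\<close> is the velocity of conjugation by the exponentials of a matrix
  \<open>C\<close> living in the block. Such a conjugation carries eigenvectors along and keeps
  their product with the row below, so \<open>sval\<close> changes only by the rescaling that brings
  the last coordinate back to 1.\<close>

lemma sval_gradient_commutator:
  assumes z: "z \<in> M_Omega_e n" and m: "1 \<le> m" "m < n" "k < m" and C: "C \<in> carrier_mat n n"
    and G: "has_gradient n (sval m k) z G"
    and sup: "\<And>i j. i < n \<Longrightarrow> j < n \<Longrightarrow> \<not> (i < m \<and> j < m) \<Longrightarrow> C $$ (i, j) = 0"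
  shows "matrix_trace (G * (snd z * C - C * snd z)) =
     sval m k z * (\<Sum>a<m. C $$ (m - 1, a) * eigmat z m $$ (a, k))"
proof -
  have m': "m \<in> {1..n}" using m by simp
  note x = M_Omega_eD(2)[OF z]
  define v where "v j = eigmat z m $$ (j, k)" for j
  define l where "l = eigval z m k"
  define w where "w i = (\<Sum>a<m. C $$ (i, a) * v a)" for i
  \<comment> \<open>Conjugation moves the eigenvector \<open>v\<close> with velocity
    \<open>-C v\<close>, which is \<open>-w\<close>; the multiple of \<open>v\<close> restores last
    coordinate 0 for the derivative. The eigenvalue stays fixed, hence \<open>\<mu> = 0\<close>
    below.\<close>
  define y where "y i = w (m - 1) * v i - w i" for i
  have ev: "(\<Sum>j<m. snd z $$ (i, j) * v j) = l * v i" if "i < m" for i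
    using eigmat_eigvec[OF z m' m(3)] that by (simp add: eigvec_def v_def l_def)
  let ?A = "snd z * C - C * snd z"
  note ent = commutator_entry[OF x C less_imp_le[OF m(2)] sup]
  have CV: "(\<Sum>j<m. (\<Sum>p<m. snd z $$ (i, p) * C $$ (p, j)) * v j) = (\<Sum>p<m. snd z $$ (i, p) * w p)" for i
    unfolding w_def sum_distrib_left sum_distrib_right by (subst sum.swap) (simp add: mult.assoc)
  have XV: "(\<Sum>j<m. (\<Sum>p<m. C $$ (i, p) * snd z $$ (p, j)) * v j) = l * w i" for i
  proof -
    have "(\<Sum>j<m. (\<Sum>p<m. C $$ (i, p) * snd z $$ (p, j)) * v j) = (\<Sum>p<m. C $$ (i, p) * (\<Sum>j<m. snd z $$ (p, j) * v j))"
      unfolding sum_distrib_left sum_distrib_right by (subst sum.swap) (simp add: mult.assoc)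
    also have "\<dots> = (\<Sum>p<m. C $$ (i, p) * (l * v p))" using ev by simp
    finally show ?thesis by (simp add: w_def sum_distrib_left ac_simps)
  qed
  have Av: "(\<Sum>j<m. ?A $$ (i, j) * v j) = (\<Sum>p<m. snd z $$ (i, p) * w p) - l * w i" if "i < n" for i
  proof -
    have "(\<Sum>j<m. ?A $$ (i, j) * v j) = (\<Sum>j<m. ((\<Sum>p<m. snd z $$ (i, p) * C $$ (p, j)) -
       (\<Sum>p<m. C $$ (i, p) * snd z $$ (p, j))) * v j)"
      using ent that m by (intro sum.cong refl arg_cong2[where f = "(*)"]) auto
    then show ?thesis unfolding CV[symmetric] XV[symmetric] by (simp add: left_diff_distrib sum_subtractf)
  qed
  have Xy: "(\<Sum>j<m. snd z $$ (i, j) * y j) = w (m - 1) * (\<Sum>j<m. snd z $$ (i, j) * v j) - (\<Sum>p<m. snd z $$ (i, p) * w p)" for i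
    by (simp add: y_def right_diff_distrib sum_subtractf sum_distrib_left ac_simps)
  have "matrix_trace (G * ?A) = (\<Sum>j<m. ?A $$ (m, j) * eigmat z m $$ (j, k)) + (\<Sum>j<m. snd z $$ (m, j) * y j)"
  proof (rule sval_gradient_value[OF z m _ G, where \<mu> = 0])
    show "?A \<in> carrier_mat n n" using x C by auto
    show "y (m - 1) = 0" using eigmat_last'[OF m(3)] by (simp add: y_def v_def)
    show "(\<Sum>j<m. snd z $$ (i, j) * y j) - eigval z m k * y i +
       (\<Sum>j<m. ?A $$ (i, j) * eigmat z m $$ (j, k)) = 0 * eigmat z m $$ (i, k)" if i: "i < m" for i
      using Av[of i] ev[OF i] i m unfolding Xy v_def[symmetric] l_def[symmetric]
      by (simp add: y_def algebra_simps)
  qed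
  also have "\<dots> = w (m - 1) * sval m k z"
  proof -
    have "w m = 0" unfolding w_def using sup[of m] m by simp
    then show ?thesis using Av[OF m(2)] unfolding Xy v_def[symmetric]
      by (simp add: sval_def v_def)
  qed
  finally show ?thesis by (simp add: w_def v_def)
qed

text \<open>\<open>sval m k\<close> depends only on entries in rows up to \<open>m\<close> and
  columns below \<open>m\<close>. The roles of \<open>i\<close> and \<open>j\<close> are exchanged
  here because the trace pairs entry \<open>(i, j)\<close> of the gradient with entry
  \<open>(j, i)\<close> of the velocity.\<close>

lemma sval_gradient_support:
  assumes z: "z \<in> M_Omega_e n" and m: "1 \<le> m" "m < n" "k < m"
    and G: "has_gradient n (sval m k) z G" and ij: "i < n" "j < n" "i \<ge> m \<or> j > m"
  shows "G $$ (i, j) = 0"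
proof -
  have "matrix_trace (G * elem_mat n j i) =
     (\<Sum>a<m. elem_mat n j i $$ (m, a) * eigmat z m $$ (a, k)) + (\<Sum>a<m. snd z $$ (m, a) * (\<lambda>_. 0) a)"
    by (rule sval_gradient_value[OF z m elem_mat_carrier G, where \<mu> = 0])
      (use m ij in \<open>auto simp: elem_mat_def intro!: sum.neutral\<close>)
  also have "\<dots> = 0" using m ij by (auto simp: elem_mat_def intro!: sum.neutral)
  finally show ?thesis using trace_elem_mat(1)[OF has_gradientD(1)[OF G] ij(2,1)] by simp
qed

lemma sval_has_gradient:
  assumes "z \<in> M_Omega_e n" "1 \<le> m" "m < n" "k < m"
  shows "\<exists>G. has_gradient n (sval m k) z G"
  by (rule closure_has_gradient[OF sval_closure[OF assms(2-4)] assms(1)])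

text \<open>The gradient of the lower function lies inside the block of size \<open>l\<close> and
  has last row 0 there, so the rescaling factor in \<open>sval_gradient_commutator\<close> vanishes.
  This is the infinitesimal form of the invariance under conjugation by matrices with last row
  \<open>(0, \<dots>, 0, 1)\<close>.\<close>

lemma bracket_sval_lower:
  assumes z: "z \<in> M_Omega_e n" and m: "1 \<le> m" "m < l" "k < m" and l: "l < n" "j < l"
  shows "gz_bracket n (sval m k) (sval l j) z = 0"
proof -
  have m': "m < n" and l': "1 \<le> l" using m l by auto
  obtain F where F: "has_gradient n (sval m k) z F" using sval_has_gradient[OF z m(1) m' m(3)] by blast
  obtain G where G: "has_gradient n (sval l j) z G" using sval_has_gradient[OF z l' l] by blast
  have "gz_bracket n (sval m k) (sval l j) z = sval l j z * (\<Sum>a<l. F $$ (l - 1, a) * eigmat z l $$ (a, j))"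
    unfolding bracket_eq[OF z F G]
    by (rule sval_gradient_commutator[OF z l' l has_gradientD(1)[OF F] G])
      (use sval_gradient_support[OF z m(1) m' m(3) F] m in auto)
  also have "(\<Sum>a<l. F $$ (l - 1, a) * eigmat z l $$ (a, j)) = 0"
  proof (intro sum.neutral ballI)
    fix a assume "a \<in> {..<l}"
    then have "F $$ (l - 1, a) = 0"
      using m l by (intro sval_gradient_support[OF z m(1) m' m(3) F]) auto
    then show "F $$ (l - 1, a) * eigmat z l $$ (a, j) = 0" by simp
  qed
  finally show ?thesis by simp
qed

lemma sum_scaled_diff:
  fixes c :: "'a::comm_ring"
  shows "(\<Sum>q\<in>A. x q * (c * (a q - b q))) = c * ((\<Sum>q\<in>A. x q * a q) - (\<Sum>q\<in>A. x q * b q))"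
  by (simp add: sum_distrib_left sum_subtractf algebra_simps)

text \<open>The gradient \<open>F\<close> is never written out. The parts of \<open>[x, F]\<close>
  that matter, its block and the row below, are found by pairing \<open>F\<close> with suitable
  matrices. The derivative of \<open>sval m j\<close> along it then has a contribution from the row
  and one from the eigenvector, and these cancel.\<close>

lemma bracket_sval_same:
  assumes z: "z \<in> M_Omega_e n" and m: "1 \<le> m" "m < n" "k < m" and j: "j < m" "j \<noteq> k"
  shows "gz_bracket n (sval m k) (sval m j) z = 0"
proof -
  have m': "m \<in> {1..n}" using m by simp
  note x = M_Omega_eD(2)[OF z]
  obtain F where F: "has_gradient n (sval m k) z F" using sval_has_gradient[OF z m] by blast
  obtain G where G: "has_gradient n (sval m j) z G" using sval_has_gradient[OF z m(1,2) j(1)] by blast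
  note Fc = has_gradientD(1)[OF F]
  define f g where "f = sval m k z" and "g = sval m j z"
  define V where "V i p = eigmat z m $$ (i, p)" for i p
  define \<nu> where "\<nu> p = eigval z m p" for p
  have ev: "(\<Sum>q<m. snd z $$ (i, q) * V q p) = \<nu> p * V i p" if "i < m" "p < m" for i p
    using eigmat_eigvec[OF z m' that(2)] that(1) by (simp add: eigvec_def V_def \<nu>_def)
  have last: "V (m - 1) p = 1" if "p < m" for p using eigmat_last'[OF that] by (simp add: V_def)
  have ne: "\<nu> k - \<nu> j \<noteq> 0" "\<nu> j - \<nu> k \<noteq> 0" using eigval_distinct[OF z m' m(3) j(1)] j by (auto simp: \<nu>_def)
  have row: "(\<Sum>q<m. snd z $$ (m, q) * V q k) = f" "(\<Sum>q<m. snd z $$ (m, q) * V q j) = g"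
    by (simp_all add: f_def g_def sval_def V_def)
  let ?Y = "snd z * F - F * snd z"
  have Yc: "?Y \<in> carrier_mat n n" using x Fc by auto
  \<comment> \<open>Each entry is isolated by an elementary matrix; antisymmetry turns it into a
    derivative of \<open>sval m k\<close> along a commutator, which is known.\<close>
  have Y: "?Y $$ (a, b) = - (f * (if b = m - 1 then V a k else 0))" if ab: "a < m" "b < m" for a b
  proof -
    have "?Y $$ (a, b) = matrix_trace (elem_mat n b a * ?Y)"
      using trace_elem_mat(2)[OF Yc, of b a] ab m by simp
    also have "\<dots> = - matrix_trace (F * (snd z * elem_mat n b a - elem_mat n b a * snd z))"
      by (rule trace_commutator_antisym[OF x elem_mat_carrier Fc])
    also have "matrix_trace (F * (snd z * elem_mat n b a - elem_mat n b a * snd z)) =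
       sval m k z * (\<Sum>p<m. elem_mat n b a $$ (m - 1, p) * eigmat z m $$ (p, k))"
      by (rule sval_gradient_commutator[OF z m elem_mat_carrier F]) (use ab in \<open>auto simp: elem_mat_def\<close>)
    also have "(\<Sum>p<m. elem_mat n b a $$ (m - 1, p) * eigmat z m $$ (p, k)) =
       (\<Sum>p<m. if p = a then (if b = m - 1 then V p k else 0) else 0)"
      using m by (intro sum.cong) (auto simp: elem_mat_def V_def)
    finally show ?thesis using ab by (simp add: f_def)
  qed
  have Yrow: "(\<Sum>b<m. ?Y $$ (m, b) * V b j) = f * (g - f) / (\<nu> k - \<nu> j)"
  proof -
    \<comment> \<open>The rank one product of eigenvector \<open>j\<close> with row
      \<open>m\<close>, chosen so that pairing it with \<open>F\<close> gives the desired
      sum.\<close>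
    define A where "A = Matrix.mat n n (\<lambda>(b, l). if b < m \<and> l < m then V b j * snd z $$ (m, l) else 0)"
    \<comment> \<open>\<open>A\<close> sends eigenvector \<open>k\<close> to \<open>f\<close> times
      eigenvector \<open>j\<close>; this solves the linearised equation, the term
      \<open>V i k\<close> making the last coordinate 0.\<close>
    define y where "y i = f / (\<nu> k - \<nu> j) * (V i j - V i k)" for i
    have A: "A \<in> carrier_mat n n" by (simp add: A_def)
    have Yb: "?Y $$ (m, b) = (\<Sum>l<m. snd z $$ (m, l) * F $$ (l, b))" if b: "b < m" for b
    proof -
      have "?Y $$ (m, b) = (snd z * F) $$ (m, b) - (F * snd z) $$ (m, b)"
        using x Fc b m by simp
      also have "(snd z * F) $$ (m, b) = (\<Sum>l<n. snd z $$ (m, l) * F $$ (l, b))"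
        using mat_mult_entry[OF x Fc m(2), of b] b m by simp
      also have "\<dots> = (\<Sum>l<m. snd z $$ (m, l) * F $$ (l, b))"
        using sval_gradient_support[OF z m F] b m by (intro sum_truncate) auto
      also have "(F * snd z) $$ (m, b) = (\<Sum>l<n. F $$ (m, l) * snd z $$ (l, b))"
        using mat_mult_entry[OF Fc x m(2), of b] b m by simp
      also have "\<dots> = 0" using sval_gradient_support[OF z m F] m by (intro sum.neutral) auto
      finally show ?thesis by simp
    qed
    have "(\<Sum>b<m. ?Y $$ (m, b) * V b j) = (\<Sum>b<m. \<Sum>l<m. F $$ (l, b) * A $$ (b, l))"
      using m by (intro sum.cong refl) (auto simp: Yb A_def sum_distrib_right intro!: sum.cong)
    also have "\<dots> = (\<Sum>l<m. \<Sum>b<m. F $$ (l, b) * A $$ (b, l))" by (rule sum.swap)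
    also have "\<dots> = (\<Sum>l<m. \<Sum>b<n. F $$ (l, b) * A $$ (b, l))"
      using m by (intro sum.cong refl sum_truncate[symmetric]) (auto simp: A_def)
    also have "\<dots> = (\<Sum>l<n. \<Sum>b<n. F $$ (l, b) * A $$ (b, l))"
      using m by (intro sum_truncate[symmetric]) (auto simp: A_def)
    also have "\<dots> = matrix_trace (F * A)" by (rule matrix_trace_mult[OF Fc A, symmetric])
    also have "\<dots> = (\<Sum>q<m. A $$ (m, q) * eigmat z m $$ (q, k)) + (\<Sum>q<m. snd z $$ (m, q) * y q)"
    proof (rule sval_gradient_value[OF z m A F, where \<mu> = 0])
      show "y (m - 1) = 0" using last m j by (simp add: y_def)
      fix i assume i: "i < m"
      have "(\<Sum>q<m. A $$ (i, q) * eigmat z m $$ (q, k)) = (\<Sum>q<m. V i j * (snd z $$ (m, q) * V q k))"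
        using i m by (intro sum.cong) (auto simp: A_def V_def)
      also have "\<dots> = V i j * f" unfolding sum_distrib_left[symmetric] row ..
      finally have 1: "(\<Sum>q<m. A $$ (i, q) * eigmat z m $$ (q, k)) = V i j * f" .
      have "(\<Sum>q<m. snd z $$ (i, q) * y q) = f / (\<nu> k - \<nu> j) * ((\<Sum>q<m. snd z $$ (i, q) * V q j) - (\<Sum>q<m. snd z $$ (i, q) * V q k))"
        unfolding y_def by (rule sum_scaled_diff)
      also have "\<dots> = f / (\<nu> k - \<nu> j) * (\<nu> j * V i j - \<nu> k * V i k)" using ev i m j by simp
      finally have 2: "(\<Sum>q<m. snd z $$ (i, q) * y q) - eigval z m k * y i = - f * V i j"
        using ne by (simp add: y_def \<nu>_def[symmetric] field_simps)
      show "(\<Sum>q<m. snd z $$ (i, q) * y q) - eigval z m k * y i + (\<Sum>q<m. A $$ (i, q) * eigmat z m $$ (q, k)) =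
         0 * eigmat z m $$ (i, k)"
        unfolding 1 2 by simp
    qed
    also have "(\<Sum>q<m. A $$ (m, q) * eigmat z m $$ (q, k)) = 0"
      using m by (intro sum.neutral) (auto simp: A_def)
    also have "(\<Sum>q<m. snd z $$ (m, q) * y q) = f / (\<nu> k - \<nu> j) * ((\<Sum>q<m. snd z $$ (m, q) * V q j) - (\<Sum>q<m. snd z $$ (m, q) * V q k))"
      unfolding y_def by (rule sum_scaled_diff)
    finally show ?thesis unfolding row by simp
  qed
  \<comment> \<open>Inside the block, \<open>?Y\<close> sends eigenvector \<open>j\<close> to
    \<open>-f\<close> times eigenvector \<open>k\<close>, because eigenvector \<open>j\<close> has
    last coordinate 1; again \<open>y\<close> solves the resulting equation with last coordinate
    0.\<close>
  define y where "y i = - f / (\<nu> j - \<nu> k) * (V i k - V i j)" for i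
  have "matrix_trace (G * ?Y) = (\<Sum>q<m. ?Y $$ (m, q) * eigmat z m $$ (q, j)) + (\<Sum>q<m. snd z $$ (m, q) * y q)"
  proof (rule sval_gradient_value[OF z m(1,2) j(1) Yc G, where \<mu> = 0])
    show "y (m - 1) = 0" using last m j by (simp add: y_def)
    fix i assume i: "i < m"
    have "(\<Sum>q<m. ?Y $$ (i, q) * eigmat z m $$ (q, j)) = (\<Sum>q<m. if q = m - 1 then - (f * V i k * V q j) else 0)"
      using Y[OF i] by (intro sum.cong) (auto simp: V_def)
    also have "\<dots> = - f * V i k" using m j last by simp
    finally have 1: "(\<Sum>q<m. ?Y $$ (i, q) * eigmat z m $$ (q, j)) = - f * V i k" .
    have "(\<Sum>q<m. snd z $$ (i, q) * y q) = - f / (\<nu> j - \<nu> k) * ((\<Sum>q<m. snd z $$ (i, q) * V q k) - (\<Sum>q<m. snd z $$ (i, q) * V q j))"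
      unfolding y_def by (rule sum_scaled_diff)
    also have "\<dots> = - f / (\<nu> j - \<nu> k) * (\<nu> k * V i k - \<nu> j * V i j)" using ev i m j by simp
    finally have 2: "(\<Sum>q<m. snd z $$ (i, q) * y q) - eigval z m j * y i = f * V i k"
      using ne by (simp add: y_def \<nu>_def[symmetric] field_simps)
    show "(\<Sum>q<m. snd z $$ (i, q) * y q) - eigval z m j * y i + (\<Sum>q<m. ?Y $$ (i, q) * eigmat z m $$ (q, j)) =
       0 * eigmat z m $$ (i, j)"
      unfolding 1 2 by simp
  qed
  also have "(\<Sum>q<m. ?Y $$ (m, q) * eigmat z m $$ (q, j)) = f * (g - f) / (\<nu> k - \<nu> j)"
    using Yrow by (simp add: V_def)
  also have "(\<Sum>q<m. snd z $$ (m, q) * y q) = - f / (\<nu> j - \<nu> k) * ((\<Sum>q<m. snd z $$ (m, q) * V q k) - (\<Sum>q<m. snd z $$ (m, q) * V q j))"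
    unfolding y_def by (rule sum_scaled_diff)
  also have "f * (g - f) / (\<nu> k - \<nu> j) + \<dots> = 0" unfolding row using ne by (simp add: field_simps)
  finally show ?thesis unfolding bracket_eq[OF z F G] .
qed

lemma bracket_self:
  assumes z: "z \<in> M_Omega_e n" and f: "has_gradient n f z F"
  shows "gz_bracket n f f z = 0"
  using bracket_antisym[OF z f f] by simp

theorem bracket_sval_sval:
  assumes z: "z \<in> M_Omega_e n" and m: "1 \<le> m" "m < n" "k < m" and l: "1 \<le> l" "l < n" "j < l"
  shows "gz_bracket n (sval m k) (sval l j) z = 0"
proof -
  obtain F where F: "has_gradient n (sval m k) z F" using sval_has_gradient[OF z m] by blast
  obtain G where G: "has_gradient n (sval l j) z G" using sval_has_gradient[OF z l] by blast
  consider "m < l" | "l < m" | "m = l" "j \<noteq> k" | "m = l" "j = k" by linarith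
  then show ?thesis
  proof cases
    case 1 then show ?thesis using bracket_sval_lower[OF z] m l by blast
  next
    case 2
    then have "gz_bracket n (sval l j) (sval m k) z = 0" using bracket_sval_lower[OF z] m l by blast
    then show ?thesis using bracket_antisym[OF z F G] by simp
  next
    case 3 then show ?thesis using bracket_sval_same[OF z m] l by blast
  next
    case 4 then show ?thesis using bracket_self[OF z F] by simp
  qed
qed

text \<open>Inside the block both products with the projector are the eigenvalue times the
  projector, as it is built from a right and a left eigenvector for the same eigenvalue.\<close>

lemma eigproj_commutator_block:
  assumes z: "z \<in> M_Omega_e n" and m: "m \<in> {1..n}" "k < m" and ij: "i < m" "j < m"
  shows "(snd z * eigproj n m k z - eigproj n m k z * snd z) $$ (i, j) = 0"
proof -
  let ?V = "eigmat z m" and ?P = "eigproj n m k z"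
  note d = eigmat_det[OF z m(1)]
  have P: "?P $$ (p, q) = ?V $$ (p, k) * matinv ?V $$ (k, q)" if "p < m" "q < m" for p q
    using that m by (simp add: eigproj_def)
  have "(snd z * ?P - ?P * snd z) $$ (i, j) =
     (\<Sum>l<m. snd z $$ (i, l) * ?P $$ (l, j)) - (\<Sum>l<m. ?P $$ (i, l) * snd z $$ (l, j))"
    by (rule commutator_entry[OF M_Omega_eD(2)[OF z] eigproj_carrier])
      (use m ij in \<open>auto simp: eigproj_def\<close>)
  also have "(\<Sum>l<m. snd z $$ (i, l) * ?P $$ (l, j)) = (\<Sum>l<m. snd z $$ (i, l) * ?V $$ (l, k)) * matinv ?V $$ (k, j)"
    using P ij by (simp add: sum_distrib_right mult.assoc)
  also have "(\<Sum>l<m. ?P $$ (i, l) * snd z $$ (l, j)) = ?V $$ (i, k) * (\<Sum>l<m. matinv ?V $$ (k, l) * snd z $$ (l, j))"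
    using P ij by (simp add: sum_distrib_left mult.assoc)
  also have "(\<Sum>l<m. matinv ?V $$ (k, l) * snd z $$ (l, j)) = eigval z m k * matinv ?V $$ (k, j)"
    by (rule eigvec_left[OF eigmat_carrier d eigmat_eigvec[OF z m(1)] m(2) ij(2)])
  also have "(\<Sum>l<m. snd z $$ (i, l) * ?V $$ (l, k)) = eigval z m k * ?V $$ (i, k)"
    using eigmat_eigvec[OF z m] ij by (simp add: eigvec_def)
  finally show ?thesis by simp
qed

text \<open>At level \<open>n\<close> the block is the whole matrix, so the commutator with the
  projector is 0: these eigenvalues are Casimir functions.\<close>

theorem bracket_eigval_top:
  assumes z: "z \<in> M_Omega_e n" and k: "k < n" and G: "has_gradient n g z G"
  shows "gz_bracket n (\<lambda>z. eigval z n k) g z = 0"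
proof -
  have n: "n \<in> {1..n}" using k by auto
  have "snd z * eigproj n n k z - eigproj n n k z * snd z = 0\<^sub>m n n"
    using eigproj_commutator_block[OF z n k] M_Omega_eD(2)[OF z] eigproj_carrier[of n n k z]
    by (intro eq_matI) (auto simp del: index_minus_mat(1))
  then show ?thesis
    unfolding bracket_eq[OF z has_gradient_eigval[OF n k] G]
    using has_gradientD(1)[OF G] by (simp add: matrix_trace_def)
qed

text \<open>The gradient of the lower eigenvalue is supported in a block on which the commutator for
  the higher one vanishes.\<close>

lemma bracket_eigval_lower:
  assumes z: "z \<in> M_Omega_e n" and m: "m \<in> {1..n}" "k < m" and l: "1 \<le> l" "l \<le> m" "j < l"
  shows "gz_bracket n (\<lambda>z. eigval z m k) (\<lambda>z. eigval z l j) z = 0"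
proof -
  have l': "l \<in> {1..n}" using m l by auto
  let ?Y = "snd z * eigproj n m k z - eigproj n m k z * snd z"
  have Y: "?Y \<in> carrier_mat n n" using M_Omega_eD(2)[OF z] eigproj_carrier[of n m k z] by auto
  have "matrix_trace (eigproj n l j z * ?Y) = (\<Sum>a<n. \<Sum>b<n. eigproj n l j z $$ (a, b) * ?Y $$ (b, a))"
    by (rule matrix_trace_mult[OF eigproj_carrier Y])
  also have "\<dots> = 0"
  proof (intro sum.neutral ballI)
    fix a b assume ab: "a \<in> {..<n}" "b \<in> {..<n}"
    show "eigproj n l j z $$ (a, b) * ?Y $$ (b, a) = 0"
    proof (cases "a < l \<and> b < l")
      case True
      then have "?Y $$ (b, a) = 0" using l by (intro eigproj_commutator_block[OF z m]) auto
      then show ?thesis by simp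
    next
      case False
      then have "eigproj n l j z $$ (a, b) = 0" using ab by (auto simp: eigproj_def)
      then show ?thesis by simp
    qed
  qed
  finally show ?thesis
    unfolding bracket_eq[OF z has_gradient_eigval[OF m] has_gradient_eigval[OF l' l(3)]] .
qed

theorem bracket_eigval_eigval:
  assumes z: "z \<in> M_Omega_e n" and m: "m \<in> {1..n}" "k < m" and l: "l \<in> {1..n}" "j < l"
  shows "gz_bracket n (\<lambda>z. eigval z m k) (\<lambda>z. eigval z l j) z = 0"
proof (cases "l \<le> m")
  case True
  then show ?thesis using bracket_eigval_lower[OF z m] l by auto
next
  case False
  then have "gz_bracket n (\<lambda>z. eigval z l j) (\<lambda>z. eigval z m k) z = 0"
    using bracket_eigval_lower[OF z l] m by auto
  then show ?thesis
    using bracket_antisym[OF z has_gradient_eigval[OF m] has_gradient_eigval[OF l]] by simp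
qed

text \<open>If \<open>l < m\<close>, then \<open>sval l j\<close> sees only entries of the block of
  size \<open>m\<close>, where the velocity is 0. Otherwise the projector lies in the block of size
  \<open>l\<close> and the rescaling factor is the last coordinate of its product with eigenvector
  \<open>j\<close>: a Kronecker delta for \<open>l = m\<close>, and 0 for \<open>l > m\<close> since
  that row of the projector is 0.\<close>

theorem bracket_eigval_sval:
  assumes z: "z \<in> M_Omega_e n" and m: "m \<in> {1..n}" "k < m" and l: "1 \<le> l" "l < n" "j < l"
  shows "gz_bracket n (\<lambda>z. eigval z m k) (sval l j) z = (if m = l \<and> k = j then sval l j z else 0)"
proof -
  obtain G where G: "has_gradient n (sval l j) z G" using sval_has_gradient[OF z l] by blast
  let ?P = "eigproj n m k z"
  let ?Y = "snd z * ?P - ?P * snd z"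
  have Y: "?Y \<in> carrier_mat n n" using M_Omega_eD(2)[OF z] eigproj_carrier[of n m k z] by auto
  note b = bracket_eq[OF z has_gradient_eigval[OF m] G]
  show ?thesis
  proof (cases "l < m")
    case True
    have Y0: "?Y $$ (p, q) = 0" if "p \<le> l" "q < l" for p q
      using that True by (intro eigproj_commutator_block[OF z m]) auto
    have "matrix_trace (G * ?Y) = (\<Sum>q<l. ?Y $$ (l, q) * eigmat z l $$ (q, j)) + (\<Sum>q<l. snd z $$ (l, q) * (\<lambda>_. 0) q)"
      by (rule sval_gradient_value[OF z l Y G, where \<mu> = 0]) (use Y0 in \<open>auto intro!: sum.neutral\<close>)
    also have "\<dots> = 0" using Y0 by (auto intro!: sum.neutral)
    finally show ?thesis unfolding b using True by simp
  next
    case False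
    then have ml: "m \<le> l" by simp
    have 1: "matrix_trace (G * ?Y) = sval l j z * (\<Sum>a<l. ?P $$ (l - 1, a) * eigmat z l $$ (a, j))"
      by (rule sval_gradient_commutator[OF z l eigproj_carrier G]) (use ml in \<open>auto simp: eigproj_def\<close>)
    have 2: "(\<Sum>a<l. ?P $$ (l - 1, a) * eigmat z l $$ (a, j)) = (if m = l \<and> k = j then 1 else 0)"
    proof (cases "m = l")
      case True
      have "(\<Sum>a<l. ?P $$ (l - 1, a) * eigmat z l $$ (a, j)) = (\<Sum>a<l. matinv (eigmat z l) $$ (k, a) * eigmat z l $$ (a, j))"
        using True l m eigmat_last'[of k l] by (intro sum.cong) (auto simp: eigproj_def)
      also have "\<dots> = (if k = j then 1 else 0)"
        using matinv_left[OF eigmat_carrier eigmat_det[OF z]] True m l by simp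
      finally show ?thesis using True by simp
    next
      case False
      then show ?thesis using ml l by (auto simp: eigproj_def intro!: sum.neutral)
    qed
    show ?thesis unfolding b 1 2 by simp
  qed
qed

section \<open>Reconstruction of a point from its coordinates\<close>

text \<open>The system comes from the last row of the eigenvector equation at level
  \<open>m + 1\<close>, with the eigenvector expanded in the eigenbasis of level \<open>m\<close>: a
  Cauchy matrix, bordered by a column of ones for the unknown diagonal entry.\<close>

definition cauchy_mat :: "(nat \<Rightarrow> nat \<Rightarrow> complex) \<Rightarrow> nat \<Rightarrow> complex mat" where
  "cauchy_mat \<nu> m = Matrix.mat (Suc m) (Suc m)
     (\<lambda>(k, i). if i < m then inverse (\<nu> (Suc k) (Suc m) - \<nu> (Suc i) m) else 1)"

lemma cauchy_mat_carrier: "cauchy_mat \<nu> m \<in> carrier_mat (Suc m) (Suc m)"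
  by (simp add: cauchy_mat_def)

lemma cauchy_mat_apply:
  "k < Suc m \<Longrightarrow> (\<Sum>i<Suc m. cauchy_mat \<nu> m $$ (k, i) * c i) =
     (\<Sum>i<m. c i / (\<nu> (Suc k) (Suc m) - \<nu> (Suc i) m)) + c m"
  by (simp add: cauchy_mat_def divide_inverse mult.commute)

text \<open>Clearing denominators gives a polynomial of degree at most \<open>m\<close> with the
  \<open>m + 1\<close> roots \<open>b k\<close>, hence 0. Its value at \<open>a i\<close> is a
  nonzero multiple of \<open>c i\<close>; once these vanish, so does \<open>c m\<close>.\<close>

lemma partial_fractions_zero:
  fixes a b :: "nat \<Rightarrow> complex"
  assumes a: "inj_on a {..<m}" and b: "inj_on b {..<Suc m}" and ab: "\<And>i k. i < m \<Longrightarrow> k < Suc m \<Longrightarrow> b k \<noteq> a i"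
    and 0: "\<And>k. k < Suc m \<Longrightarrow> (\<Sum>i<m. c i / (b k - a i)) + c m = 0"
  shows "\<forall>i<Suc m. c i = 0"
proof -
  define P where "P = Polynomial.smult (c m) (\<Prod>i<m. [:- a i, 1:]) + (\<Sum>i<m. Polynomial.smult (c i) (\<Prod>j\<in>{..<m} - {i}. [:- a j, 1:]))"
  have P: "poly P t = c m * (\<Prod>i<m. t - a i) + (\<Sum>i<m. c i * (\<Prod>j\<in>{..<m} - {i}. t - a j))" for t
    by (simp add: P_def poly_sum poly_prod)
  have deg: "Polynomial.degree (\<Prod>j\<in>A. [:- a j, 1:]) \<le> card A" for A
    using degree_prod_sum_le[of A "\<lambda>j. [:- a j, 1:]"] by (cases "finite A") auto
  have "Polynomial.degree P \<le> m"
    unfolding P_def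
  proof (intro degree_add_le degree_sum_le order.trans[OF Polynomial.degree_smult_le])
    show "Polynomial.degree (\<Prod>i<m. [:- a i, 1:]) \<le> m" using deg[of "{..<m}"] by simp
    show "Polynomial.degree (\<Prod>j\<in>{..<m} - {i}. [:- a j, 1:]) \<le> m" if "i \<in> {..<m}" for i
      using deg[of "{..<m} - {i}"] that by simp
  qed simp
  have root: "poly P (b k) = 0" if k: "k < Suc m" for k
  proof -
    have "(\<Prod>j\<in>{..<m} - {i}. b k - a j) = (\<Prod>j<m. b k - a j) / (b k - a i)" if "i < m" for i
      using ab[OF that k] that by (subst prod.remove[of "{..<m}" i]) auto
    then have "poly P (b k) = c m * (\<Prod>i<m. b k - a i) + (\<Sum>i<m. c i * ((\<Prod>j<m. b k - a j) / (b k - a i)))"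
      unfolding P by simp
    also have "\<dots> = (\<Prod>j<m. b k - a j) * ((\<Sum>i<m. c i / (b k - a i)) + c m)"
      by (simp add: distrib_left sum_distrib_left ac_simps)
    finally show ?thesis using 0[OF k] by simp
  qed
  have "P = 0"
  proof (rule ccontr)
    assume "P \<noteq> 0"
    then have "card {x. poly P x = 0} \<le> m" "finite {x. poly P x = 0}"
      using card_poly_roots_bound[of P] \<open>Polynomial.degree P \<le> m\<close> poly_roots_finite[of P] by auto
    moreover have "b ` {..<Suc m} \<subseteq> {x. poly P x = 0}" using root by auto
    ultimately have "card (b ` {..<Suc m}) \<le> m" using card_mono order.trans by blast
    then show False using card_image[OF b] by simp
  qed
  have ci: "c i = 0" if i: "i < m" for i
  proof -
    have s: "(\<Sum>l<m. c l * (\<Prod>j\<in>{..<m} - {l}. a i - a j)) = (\<Sum>l<m. if l = i then c i * (\<Prod>j\<in>{..<m} - {i}. a i - a j) else 0)"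
    proof (rule sum.cong)
      fix l assume l: "l \<in> {..<m}"
      have "(\<Prod>j\<in>{..<m} - {l}. a i - a j) = 0" if "l \<noteq> i"
        using that i by (intro prod_zero) auto
      then show "c l * (\<Prod>j\<in>{..<m} - {l}. a i - a j) = (if l = i then c i * (\<Prod>j\<in>{..<m} - {i}. a i - a j) else 0)"
        by simp
    qed simp
    have z: "(\<Prod>l<m. a i - a l) = 0" using i by (intro prod_zero) auto
    have "poly P (a i) = c i * (\<Prod>j\<in>{..<m} - {i}. a i - a j)"
      unfolding P s z using i by (subst sum.delta) auto
    then have "c i * (\<Prod>j\<in>{..<m} - {i}. a i - a j) = 0"
      unfolding \<open>P = 0\<close> poly_0 by (rule sym)
    moreover have "(\<Prod>j\<in>{..<m} - {i}. a i - a j) \<noteq> 0"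
      using a i by (auto simp: inj_on_def)
    ultimately show ?thesis by simp
  qed
  then have "c m = 0" using 0[of 0] by simp
  then show ?thesis using ci by (auto simp: less_Suc_eq)
qed

lemma cauchy_mat_det:
  assumes \<nu>: "\<nu> \<in> e_Omega n" and m: "m < n"
  shows "det (cauchy_mat \<nu> m) \<noteq> 0"
proof (rule det_nonzeroI[OF cauchy_mat_carrier])
  fix c assume *: "\<And>k. k < Suc m \<Longrightarrow> (\<Sum>i<Suc m. cauchy_mat \<nu> m $$ (k, i) * c i) = 0"
  show "\<forall>i<Suc m. c i = 0"
  proof (rule partial_fractions_zero[of "\<lambda>i. \<nu> (Suc i) m" m "\<lambda>k. \<nu> (Suc k) (Suc m)"])
    show "inj_on (\<lambda>i. \<nu> (Suc i) m) {..<m}"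
      using e_Omega_inj[OF \<nu>, of m] m by (cases "m = 0") auto
    show "inj_on (\<lambda>k. \<nu> (Suc k) (Suc m)) {..<Suc m}"
      using e_Omega_inj[OF \<nu>, of "Suc m"] m by simp
    show "\<nu> (Suc k) (Suc m) \<noteq> \<nu> (Suc i) m" if "i < m" "k < Suc m" for i k
      using e_Omega_neq[OF \<nu> m that] by simp
    show "(\<Sum>i<m. c i / (\<nu> (Suc k) (Suc m) - \<nu> (Suc i) m)) + c m = 0" if "k < Suc m" for k
      using *[OF that] unfolding cauchy_mat_apply[OF that] .
  qed
qed

text \<open>For \<open>i < m\<close> this is the product of \<open>sval\<close> with the
  \<open>i\<close>-th coordinate of the new column in the eigenbasis, and for \<open>i = m\<close>
  the diagonal entry. These depend on the eigenvalues alone, which is why a free choice of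
  \<open>s\<close> is possible.\<close>

definition cauchy_sol :: "(nat \<Rightarrow> nat \<Rightarrow> complex) \<Rightarrow> nat \<Rightarrow> nat \<Rightarrow> complex" where
  "cauchy_sol \<nu> m i = (\<Sum>k<Suc m. matinv (cauchy_mat \<nu> m) $$ (i, k) * \<nu> (Suc k) (Suc m))"

lemma cauchy_sol:
  assumes \<nu>: "\<nu> \<in> e_Omega n" and m: "m < n" and k: "k < Suc m"
  shows "(\<Sum>i<m. cauchy_sol \<nu> m i / (\<nu> (Suc k) (Suc m) - \<nu> (Suc i) m)) + cauchy_sol \<nu> m m = \<nu> (Suc k) (Suc m)"
  using matinv_apply(1)[OF cauchy_mat_carrier cauchy_mat_det[OF \<nu> m] k, of "\<lambda>k. \<nu> (Suc k) (Suc m)"]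
  unfolding cauchy_sol_def[symmetric] cauchy_mat_apply[OF k] .

lemma cauchy_sol_unique:
  assumes \<nu>: "\<nu> \<in> e_Omega n" and m: "m < n"
    and "\<And>k. k < Suc m \<Longrightarrow> (\<Sum>i<m. c i / (\<nu> (Suc k) (Suc m) - \<nu> (Suc i) m)) + c m = \<nu> (Suc k) (Suc m)"
    and i: "i < Suc m"
  shows "c i = cauchy_sol \<nu> m i"
  unfolding cauchy_sol_def
  by (rule matinv_solve[OF cauchy_mat_carrier cauchy_mat_det[OF \<nu> m] _ i])
    (simp only: cauchy_mat_apply assms(3))

text \<open>The quotient \<open>cauchy_sol \<nu> m i / s m i\<close> is a coordinate of the new
  column in the previous eigenbasis, and the further division inverts \<open>shifted_block\<close>
  in that basis.\<close>

primrec param_eigmat :: "(nat \<Rightarrow> nat \<Rightarrow> complex) \<Rightarrow> (nat \<Rightarrow> nat \<Rightarrow> complex) \<Rightarrow> nat \<Rightarrow> complex mat" where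
  "param_eigmat \<nu> s 0 = Matrix.mat 0 0 (\<lambda>_. 0)"
| "param_eigmat \<nu> s (Suc m) = Matrix.mat (Suc m) (Suc m) (\<lambda>(j, k). if j = m then 1 else
     (\<Sum>i<m. param_eigmat \<nu> s m $$ (j, i) * (cauchy_sol \<nu> m i / s m i) / (\<nu> (Suc k) (Suc m) - \<nu> (Suc i) m)))"

definition param_entry :: "(nat \<Rightarrow> nat \<Rightarrow> complex) \<Rightarrow> (nat \<Rightarrow> nat \<Rightarrow> complex) \<Rightarrow> nat \<Rightarrow> nat \<Rightarrow> complex" where
  "param_entry \<nu> s i j = (if i = j then cauchy_sol \<nu> i i
     else if j < i then \<Sum>k<i. s i k * matinv (param_eigmat \<nu> s i) $$ (k, j)
     else \<Sum>k<j. param_eigmat \<nu> s j $$ (i, k) * (cauchy_sol \<nu> j k / s j k))"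

definition param_point :: "nat \<Rightarrow> (nat \<Rightarrow> nat \<Rightarrow> complex) \<Rightarrow> (nat \<Rightarrow> nat \<Rightarrow> complex) \<Rightarrow> gz_point" where
  "param_point n \<nu> s = (\<nu>, Matrix.mat n n (\<lambda>(i, j). param_entry \<nu> s i j))"

lemma param_eigmat_carrier: "param_eigmat \<nu> s m \<in> carrier_mat m m"
  by (cases m) auto

lemma param_eigmat_last: "k < m \<Longrightarrow> param_eigmat \<nu> s m $$ (m - 1, k) = 1"
  by (cases m) auto

context
  fixes n :: nat and \<nu> s :: "nat \<Rightarrow> nat \<Rightarrow> complex"
  assumes \<nu>: "\<nu> \<in> e_Omega n" and s: "\<And>m k. 1 \<le> m \<Longrightarrow> m < n \<Longrightarrow> k < m \<Longrightarrow> s m k \<noteq> 0"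
begin

text \<open>Invertibility has to be carried through the induction, because row \<open>m\<close> of
  the matrix is defined by the inverse of the previous eigenvector matrix.\<close>

lemma param_eigvec:
  assumes "m \<le> n"
  shows "det (param_eigmat \<nu> s m) \<noteq> 0 \<and>
    (\<forall>k<m. eigvec (snd (param_point n \<nu> s)) m (\<nu> (Suc k) m) (\<lambda>i. param_eigmat \<nu> s m $$ (i, k)))"
  using assms
proof (induction m)
  case (Suc m)
  let ?x = "snd (param_point n \<nu> s)" and ?V = "param_eigmat \<nu> s m" and ?V' = "param_eigmat \<nu> s (Suc m)"
  define a where "a i = cauchy_sol \<nu> m i / s m i" for i
  have m: "m < n" using Suc by simp
  have IH: "det ?V \<noteq> 0" "\<And>k. k < m \<Longrightarrow> eigvec ?x m (\<nu> (Suc k) m) (\<lambda>i. ?V $$ (i, k))"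
    using Suc by auto
  have x: "?x $$ (i, j) = param_entry \<nu> s i j" if "i < n" "j < n" for i j
    using that by (simp add: param_point_def)
  have V': "?V' $$ (j, k) = (\<Sum>i<m. ?V $$ (j, i) * (a i / (\<nu> (Suc k) (Suc m) - \<nu> (Suc i) m)))" if "j < m" "k < Suc m" for j k
    using that by (simp add: a_def)
  have "eigvec ?x (Suc m) (\<nu> (Suc k) (Suc m)) (\<lambda>i. ?V' $$ (i, k))" if k: "k < Suc m" for k
    unfolding eigvec_def
  proof (intro allI impI)
    fix i assume i: "i < Suc m"
    define d where "d p = \<nu> (Suc k) (Suc m) - \<nu> (Suc p) m" for p
    have d: "d p \<noteq> 0" if "p < m" for p using e_Omega_neq[OF \<nu> m that k] by (simp add: d_def)
    have swap: "(\<Sum>j<m. ?x $$ (i, j) * ?V' $$ (j, k)) = (\<Sum>p<m. (\<Sum>j<m. ?x $$ (i, j) * ?V $$ (j, p)) * (a p / d p))"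
    proof -
      have "(\<Sum>j<m. ?x $$ (i, j) * ?V' $$ (j, k)) = (\<Sum>j<m. ?x $$ (i, j) * (\<Sum>p<m. ?V $$ (j, p) * (a p / d p)))"
        using V' k by (intro sum.cong) (auto simp: d_def simp del: param_eigmat.simps)
      also have "\<dots> = (\<Sum>p<m. (\<Sum>j<m. ?x $$ (i, j) * ?V $$ (j, p)) * (a p / d p))"
        unfolding sum_distrib_left sum_distrib_right by (subst sum.swap) (simp add: mult.assoc)
      finally show ?thesis .
    qed
    have last: "?V' $$ (m, k) = 1" using k by simp
    show "(\<Sum>j<Suc m. ?x $$ (i, j) * ?V' $$ (j, k)) = \<nu> (Suc k) (Suc m) * ?V' $$ (i, k)"
    proof (cases "i = m")
      case True
      have "(\<Sum>j<m. ?x $$ (m, j) * ?V $$ (j, p)) = s m p" if "p < m" for p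
      proof -
        have "(\<Sum>j<m. ?x $$ (m, j) * ?V $$ (j, p)) = (\<Sum>j<m. (\<Sum>l<m. s m l * matinv ?V $$ (l, j)) * ?V $$ (j, p))"
          using m by (intro sum.cong) (auto simp: x param_entry_def)
        then show ?thesis using matinv_apply(3)[OF param_eigmat_carrier IH(1) that] by simp
      qed
      then have "(\<Sum>j<m. ?x $$ (i, j) * ?V' $$ (j, k)) = (\<Sum>p<m. s m p * (a p / d p))"
        unfolding swap using True by simp
      \<comment> \<open>Here the nonzero \<open>s m p\<close> cancels against the denominator in
        \<open>a p\<close>, and what remains is the Cauchy system.\<close>
      also have "\<dots> = (\<Sum>p<m. cauchy_sol \<nu> m p / d p)"
        using s m by (intro sum.cong) (auto simp: a_def)
      finally have "(\<Sum>j<Suc m. ?x $$ (i, j) * ?V' $$ (j, k)) = (\<Sum>p<m. cauchy_sol \<nu> m p / d p) + cauchy_sol \<nu> m m"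
        using True last m by (simp add: x param_entry_def del: param_eigmat.simps)
      also have "\<dots> = \<nu> (Suc k) (Suc m)" unfolding d_def by (rule cauchy_sol[OF \<nu> m k])
      finally show ?thesis using True last by simp
    next
      case False
      then have im: "i < m" using i by simp
      have "(\<Sum>j<m. ?x $$ (i, j) * ?V' $$ (j, k)) = (\<Sum>p<m. \<nu> (Suc p) m * ?V $$ (i, p) * (a p / d p))"
        unfolding swap using IH(2) im by (simp add: eigvec_def)
      moreover have "?x $$ (i, m) = (\<Sum>p<m. ?V $$ (i, p) * a p)"
        using im m by (simp add: x param_entry_def a_def)
      ultimately have "(\<Sum>j<Suc m. ?x $$ (i, j) * ?V' $$ (j, k)) =
          (\<Sum>p<m. \<nu> (Suc p) m * ?V $$ (i, p) * (a p / d p) + ?V $$ (i, p) * a p)"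
        using last by (simp add: sum.distrib del: param_eigmat.simps)
      also have "\<dots> = (\<Sum>p<m. \<nu> (Suc k) (Suc m) * (?V $$ (i, p) * (a p / d p)))"
      proof (rule sum.cong)
        fix p assume p: "p \<in> {..<m}"
        have "\<nu> (Suc k) (Suc m) = d p + \<nu> (Suc p) m" by (simp add: d_def)
        then show "\<nu> (Suc p) m * ?V $$ (i, p) * (a p / d p) + ?V $$ (i, p) * a p = \<nu> (Suc k) (Suc m) * (?V $$ (i, p) * (a p / d p))"
          using d p by (simp add: field_simps)
      qed simp
      also have "\<dots> = \<nu> (Suc k) (Suc m) * ?V' $$ (i, k)"
        unfolding V'[OF im k] d_def by (simp add: sum_distrib_left)
      finally show ?thesis .
    qed
  qed
  moreover have "det ?V' \<noteq> 0"
  proof (rule eigvec_det[OF param_eigmat_carrier calculation])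
    show "\<exists>i<Suc m. ?V' $$ (i, k) \<noteq> 0" if "k < Suc m" for k
      using that by (intro exI[of _ m]) auto
    show "inj_on (\<lambda>k. \<nu> (Suc k) (Suc m)) {..<Suc m}" using e_Omega_inj[OF \<nu>, of "Suc m"] m by simp
  qed
  ultimately show ?case by blast
qed simp

lemma param_point_in: "param_point n \<nu> s \<in> M_Omega_e n"
proof (rule M_Omega_eI)
  show "fst (param_point n \<nu> s) \<in> e_Omega n" using \<nu> by (simp add: param_point_def)
  show "snd (param_point n \<nu> s) \<in> carrier_mat n n" by (simp add: param_point_def)
  fix m k assume mk: "m \<in> {1..n}" "k < m"
  then show "\<exists>v. (\<exists>i<m. v i \<noteq> 0) \<and> eigvec (snd (param_point n \<nu> s)) m (eigval (param_point n \<nu> s) m k) v"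
    using param_eigvec[of m] param_eigmat_last[of k m]
    by (intro exI[of _ "\<lambda>i. param_eigmat \<nu> s m $$ (i, k)"] conjI exI[of _ "m - 1"]) (auto simp: param_point_def)
qed

lemma sval_param_point:
  assumes m: "1 \<le> m" "m < n" "k < m"
  shows "sval m k (param_point n \<nu> s) = s m k"
proof -
  let ?V = "param_eigmat \<nu> s m" and ?z = "param_point n \<nu> s"
  have e: "eigmat ?z m $$ (i, k) = ?V $$ (i, k)" if "i < m" for i
  proof -
    obtain p where p: "m = Suc p" using m by (cases m) auto
    show ?thesis
      using eigmat_unique_Suc[OF param_point_in, of p k "\<lambda>i. ?V $$ (i, k)" i] param_eigvec[of m] param_eigmat_last[OF m(3)] m that
      by (simp add: p param_point_def del: param_eigmat.simps)
  qed
  have "sval m k ?z = (\<Sum>j<m. (\<Sum>l<m. s m l * matinv ?V $$ (l, j)) * ?V $$ (j, k))"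
    unfolding sval_def using m e by (intro sum.cong) (auto simp: param_point_def param_entry_def)
  then show ?thesis using matinv_apply(3)[OF param_eigmat_carrier _ m(3)] param_eigvec[of m] m by simp
qed

end

section \<open>Every point arises from the reconstruction\<close>

context
  fixes n :: nat and z :: gz_point and s :: "nat \<Rightarrow> nat \<Rightarrow> complex"
  assumes z: "z \<in> M_Omega_e n" and s: "\<And>m k. 1 \<le> m \<Longrightarrow> m < n \<Longrightarrow> k < m \<Longrightarrow> s m k = sval m k z"
begin

text \<open>Expanding the eigenvectors of the larger block in the eigenbasis of the smaller one
  expresses them by the coordinates of the new column. The last row of the eigenvector equation is
  then the Cauchy system for these coordinates times \<open>s m i\<close>, and its solution is
  unique.\<close>

lemma column_coefficients:
  assumes m: "1 \<le> m" "m < n"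
  shows "i < m \<Longrightarrow> (\<Sum>l<m. matinv (eigmat z m) $$ (i, l) * snd z $$ (l, m)) = cauchy_sol (fst z) m i / s m i"
    and "j < m \<Longrightarrow> k < Suc m \<Longrightarrow> eigmat z (Suc m) $$ (j, k) =
      (\<Sum>i<m. eigmat z m $$ (j, i) * (cauchy_sol (fst z) m i / s m i) / (eigval z (Suc m) k - eigval z m i))"
    and "snd z $$ (m, m) = cauchy_sol (fst z) m m"
proof -
  have m': "m \<in> {1..n}" "Suc m \<in> {1..n}" using m by auto
  let ?V = "eigmat z m" and ?x = "snd z"
  note d = eigmat_det[OF z m'(1)]
  define a where "a i = (\<Sum>l<m. matinv ?V $$ (i, l) * ?x $$ (l, m))" for i
  have V': "eigmat z (Suc m) $$ (j, k) = (\<Sum>i<m. ?V $$ (j, i) * (a i / (eigval z (Suc m) k - eigval z m i)))"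
    if j: "j < m" and k: "k < Suc m" for j k
  proof -
    define y where "y i = eigmat z (Suc m) $$ (i, k)" for i
    have y: "(\<Sum>j<m. ?x $$ (i, j) * y j) - eigval z (Suc m) k * y i = - ?x $$ (i, m)" if "i < m" for i
    proof -
      have "(\<Sum>j<Suc m. ?x $$ (i, j) * y j) = eigval z (Suc m) k * y i"
        using eigmat_eigvec[OF z m'(2) k] that by (simp add: eigvec_def y_def)
      then show ?thesis using eigmat_last[OF k, of z] by (simp add: y_def algebra_simps)
    qed
    have "(\<Sum>j<m. matinv ?V $$ (i, j) * y j) = a i / (eigval z (Suc m) k - eigval z m i)" if i: "i < m" for i
    proof -
      have "(eigval z m i - eigval z (Suc m) k) * (\<Sum>j<m. matinv ?V $$ (i, j) * y j) = (\<Sum>j<m. matinv ?V $$ (i, j) * (- ?x $$ (j, m)))"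
        by (rule eigvec_coord[OF eigmat_carrier d eigmat_eigvec[OF z m'(1)] i y])
      also have "\<dots> = - a i" by (simp add: a_def sum_negf)
      finally show ?thesis using eigval_neq[OF z m(2) i k] by (simp add: field_simps eq_neg_iff_add_eq_0)
    qed
    then show ?thesis using matinv_apply(1)[OF eigmat_carrier d j, of y] by (simp add: y_def)
  qed
  have eq: "(\<Sum>i<m. s m i * a i / (eigval z (Suc m) k - eigval z m i)) + ?x $$ (m, m) = eigval z (Suc m) k"
    if k: "k < Suc m" for k
  proof -
    have "(\<Sum>j<m. ?x $$ (m, j) * eigmat z (Suc m) $$ (j, k)) =
       (\<Sum>j<m. ?x $$ (m, j) * (\<Sum>i<m. ?V $$ (j, i) * (a i / (eigval z (Suc m) k - eigval z m i))))"
      using V' k by simp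
    also have "\<dots> = (\<Sum>i<m. (\<Sum>j<m. ?x $$ (m, j) * ?V $$ (j, i)) * (a i / (eigval z (Suc m) k - eigval z m i)))"
      unfolding sum_distrib_left sum_distrib_right by (subst sum.swap) (simp add: mult.assoc)
    also have "\<dots> = (\<Sum>i<m. s m i * a i / (eigval z (Suc m) k - eigval z m i))"
      using s m by (intro sum.cong) (auto simp: sval_def)
    finally have 1: "(\<Sum>j<m. ?x $$ (m, j) * eigmat z (Suc m) $$ (j, k)) = \<dots>" .
    have "(\<Sum>j<Suc m. ?x $$ (m, j) * eigmat z (Suc m) $$ (j, k)) = eigval z (Suc m) k * eigmat z (Suc m) $$ (m, k)"
      using eigmat_eigvec[OF z m'(2) k] by (simp add: eigvec_def)
    then show ?thesis using 1 eigmat_last[OF k, of z] by simp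
  qed
  define c where "c i = (if i < m then s m i * a i else ?x $$ (m, m))" for i
  have c: "c i = cauchy_sol (fst z) m i" if "i < Suc m" for i
  proof (rule cauchy_sol_unique[OF M_Omega_eD(1)[OF z] m(2) _ that])
    fix k assume "k < Suc m"
    from eq[OF this] show "(\<Sum>i<m. c i / (eigval z (Suc m) k - eigval z m i)) + c m = eigval z (Suc m) k"
      by (simp add: c_def)
  qed
  have sa: "a i = cauchy_sol (fst z) m i / s m i" if "i < m" for i
    using c[of i] that s[OF m that] sval_nonzero[OF z m that] by (auto simp: c_def field_simps)
  then show "i < m \<Longrightarrow> (\<Sum>l<m. matinv (eigmat z m) $$ (i, l) * snd z $$ (l, m)) = cauchy_sol (fst z) m i / s m i"
    by (simp add: a_def)
  show "j < m \<Longrightarrow> k < Suc m \<Longrightarrow> eigmat z (Suc m) $$ (j, k) =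
      (\<Sum>i<m. eigmat z m $$ (j, i) * (cauchy_sol (fst z) m i / s m i) / (eigval z (Suc m) k - eigval z m i))"
    using V' sa by simp
  show "snd z $$ (m, m) = cauchy_sol (fst z) m m" using c[of m] by (simp add: c_def)
qed

lemma eigmat_eq_param: "m \<le> n \<Longrightarrow> eigmat z m = param_eigmat (fst z) s m"
proof (induction m)
  case 0
  then show ?case by (intro eq_matI) (auto simp: eigmat_def)
next
  case (Suc m)
  then have IH: "eigmat z m = param_eigmat (fst z) s m" and m: "m < n" by auto
  show ?case
  proof (rule eq_matI)
    fix j k assume jk: "j < dim_row (param_eigmat (fst z) s (Suc m))" "k < dim_col (param_eigmat (fst z) s (Suc m))"
    then have jk: "j < Suc m" "k < Suc m" by auto
    show "eigmat z (Suc m) $$ (j, k) = param_eigmat (fst z) s (Suc m) $$ (j, k)"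
    proof (cases "j = m")
      case True
      then show ?thesis using jk by (simp add: eigmat_last)
    next
      case False
      then have "j < m" using jk by simp
      then show ?thesis using column_coefficients(2)[of m j k] IH m jk by simp
    qed
  qed (auto simp: eigmat_def)
qed

lemma entry_eq_param:
  assumes ij: "i < n" "j < n"
  shows "snd z $$ (i, j) = param_entry (fst z) s i j"
proof (cases i j rule: linorder_cases)
  case equal
  show ?thesis
  proof (cases "i = 0")
    case False
    then show ?thesis using equal column_coefficients(3)[of i] ij by (simp add: param_entry_def)
  next
    case True
    \<comment> \<open>\<open>column_coefficients\<close> starts at \<open>m = 1\<close>; for the
      single entry of the first block the Cauchy system has an empty sum.\<close>
    have n: "0 < n" using ij by simp
    have "snd z $$ (0, 0) = cauchy_sol (fst z) 0 0"
    proof (rule cauchy_sol_unique[OF M_Omega_eD(1)[OF z] n, where c = "\<lambda>_. snd z $$ (0, 0)"])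
      fix k assume "k < Suc 0"
      then show "(\<Sum>i<0. snd z $$ (0, 0) / (eigval z (Suc 0) k - eigval z 0 i)) + snd z $$ (0, 0) = eigval z (Suc 0) k"
        using eigmat_eigvec[OF z, of 1 0] eigmat_last[of 0 0 z] n by (simp add: eigvec_def)
    qed simp
    then show ?thesis using True equal by (simp add: param_entry_def)
  qed
next
  case greater
  then have "1 \<le> i" by simp
  have "snd z $$ (i, j) = (\<Sum>l<i. sval i l z * matinv (eigmat z i) $$ (l, j))"
    using row_of_sval[OF z \<open>1 \<le> i\<close> ij(1) greater] .
  also have "\<dots> = (\<Sum>l<i. s i l * matinv (param_eigmat (fst z) s i) $$ (l, j))"
    using s[OF \<open>1 \<le> i\<close> ij(1)] eigmat_eq_param[of i] ij by simp
  finally show ?thesis using greater by (simp add: param_entry_def)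
next
  case less
  then have j1: "1 \<le> j" by simp
  then have j': "j \<in> {1..n}" using ij by simp
  have "snd z $$ (i, j) = (\<Sum>l<j. eigmat z j $$ (i, l) * (\<Sum>p<j. matinv (eigmat z j) $$ (l, p) * snd z $$ (p, j)))"
    using matinv_apply(1)[OF eigmat_carrier eigmat_det[OF z j'] less, of "\<lambda>p. snd z $$ (p, j)"] by simp
  also have "\<dots> = (\<Sum>l<j. param_eigmat (fst z) s j $$ (i, l) * (cauchy_sol (fst z) j l / s j l))"
    using column_coefficients(1)[OF j1 ij(2)] eigmat_eq_param[of j] ij by simp
  finally show ?thesis using less by (simp add: param_entry_def)
qed

end

text \<open>With a fixed value outside the range, points with equal \<open>sval\<close> have equal
  functions here, so the reconstruction formulas give equal matrices by mere substitution.\<close>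

definition sval_ext :: "nat \<Rightarrow> gz_point \<Rightarrow> nat \<Rightarrow> nat \<Rightarrow> complex" where
  "sval_ext n z m k = (if 1 \<le> m \<and> m < n \<and> k < m then sval m k z else 1)"

lemma sval_ext_eq: "1 \<le> m \<Longrightarrow> m < n \<Longrightarrow> k < m \<Longrightarrow> sval_ext n z m k = sval m k z"
  by (simp add: sval_ext_def)

theorem point_determined:
  assumes z: "z \<in> M_Omega_e n" and w: "w \<in> M_Omega_e n" and "fst z = fst w"
    and "\<And>m k. 1 \<le> m \<Longrightarrow> m < n \<Longrightarrow> k < m \<Longrightarrow> sval m k z = sval m k w"
  shows "z = w"
proof -
  have e: "sval_ext n z = sval_ext n w" using assms(4) by (intro ext) (auto simp: sval_ext_def)
  have "snd z $$ (i, j) = snd w $$ (i, j)" if "i < n" "j < n" for i j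
    using entry_eq_param[OF z sval_ext_eq that] entry_eq_param[OF w sval_ext_eq that] assms(3) e
    by simp
  then have "snd z = snd w" using M_Omega_eD(2)[OF z] M_Omega_eD(2)[OF w] by (intro eq_matI) auto
  then show ?thesis using assms(3) by (simp add: prod_eq_iff)
qed

section \<open>Rationality of the reconstruction\<close>

definition param_coordinates :: "nat \<Rightarrow> (gz_point \<Rightarrow> complex) set" where
  "param_coordinates n = {(\<lambda>z. fst z k m) | k m. 1 \<le> k \<and> k \<le> m \<and> m \<le> n} \<union>
     {sval m k | m k. 1 \<le> m \<and> m < n \<and> k < m}"

abbreviation "param_closure n \<equiv> rat_closure n (param_coordinates n)"

lemma param_coordinates_closure:
  "1 \<le> k \<Longrightarrow> k \<le> m \<Longrightarrow> m \<le> n \<Longrightarrow> (\<lambda>z. fst z k m) \<in> param_closure n"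
  "1 \<le> m \<Longrightarrow> m < n \<Longrightarrow> k < m \<Longrightarrow> sval m k \<in> param_closure n"
  by (rule rat_closure.base, force simp: param_coordinates_def)+

lemma eigval_param_closure:
  "k < m \<Longrightarrow> m \<le> n \<Longrightarrow> (\<lambda>z. eigval z m k) \<in> param_closure n"
  by (rule param_coordinates_closure) auto

lemma cauchy_sol_closure:
  assumes "m < n" "i < Suc m"
  shows "(\<lambda>z. cauchy_sol (fst z) m i) \<in> param_closure n"
proof -
  have "(\<lambda>z. matinv (cauchy_mat (fst z) m) $$ (i, k)) \<in> param_closure n" if "k < Suc m" for k
  proof (rule rat_closure_matinv[OF cauchy_mat_carrier _ _ assms(2) that])
    show "det (cauchy_mat (fst z) m) \<noteq> 0" if "z \<in> M_Omega_e n" for z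
      by (rule cauchy_mat_det[OF M_Omega_eD(1)[OF that] assms(1)])
    show "(\<lambda>z. cauchy_mat (fst z) m $$ (p, q)) \<in> param_closure n" if "p < Suc m" "q < Suc m" for p q
    proof (cases "q < m")
      case True
      have "(\<lambda>z. inverse (eigval z (Suc m) p - eigval z m q)) \<in> param_closure n"
        using assms that True eigval_neq[OF _ assms(1) True that(1), THEN not_sym]
        by (intro rat_closure.inverse rat_closure_diff eigval_param_closure) auto
      then show ?thesis using that True by (simp add: cauchy_mat_def)
    next
      case False
      then show ?thesis using that by (simp add: cauchy_mat_def rat_closure.const)
    qed
  qed
  then show ?thesis unfolding cauchy_sol_def using assms
    by (intro rat_closure_sum rat_closure.mult eigval_param_closure) auto
qed

lemma sval_ext_closure:
  assumes "m < n" "k < m"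
  shows "(\<lambda>z. sval_ext n z m k) \<in> param_closure n" "\<forall>z \<in> M_Omega_e n. sval_ext n z m k \<noteq> 0"
proof -
  have "1 \<le> m" using assms by simp
  moreover have "(\<lambda>z. sval_ext n z m k) = sval m k" using assms by (auto simp: sval_ext_def)
  ultimately show "(\<lambda>z. sval_ext n z m k) \<in> param_closure n" "\<forall>z \<in> M_Omega_e n. sval_ext n z m k \<noteq> 0"
    using assms param_coordinates_closure(2)[of m n k] sval_nonzero[of _ n m k] by (auto simp: sval_ext_def)
qed

lemma column_ratio_closure:
  assumes "m < n" "i < m"
  shows "(\<lambda>z. cauchy_sol (fst z) m i / sval_ext n z m i) \<in> param_closure n"
  using assms by (intro rat_closure_divide cauchy_sol_closure sval_ext_closure) auto

lemma param_eigmat_closure: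
  assumes "m \<le> n" "j < m" "k < m"
  shows "(\<lambda>z. param_eigmat (fst z) (sval_ext n z) m $$ (j, k)) \<in> param_closure n"
  using assms
proof (induction m arbitrary: j k)
  case (Suc m)
  show ?case
  proof (cases "j = m")
    case True
    then show ?thesis using Suc.prems by (simp add: rat_closure.const)
  next
    case False
    have "(\<lambda>z. \<Sum>i<m. param_eigmat (fst z) (sval_ext n z) m $$ (j, i) * (cauchy_sol (fst z) m i / sval_ext n z m i) /
        (eigval z (Suc m) k - eigval z m i)) \<in> param_closure n"
    proof (rule rat_closure_sum)
      fix i assume i: "i \<in> {..<m}"
      then show "(\<lambda>z. param_eigmat (fst z) (sval_ext n z) m $$ (j, i) * (cauchy_sol (fst z) m i / sval_ext n z m i) /
        (eigval z (Suc m) k - eigval z m i)) \<in> param_closure n"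
        using Suc.prems False eigval_neq[of _ n m i k, THEN not_sym]
        by (intro rat_closure_divide[where f = "\<lambda>z. param_eigmat (fst z) (sval_ext n z) m $$ (j, i) * (cauchy_sol (fst z) m i / sval_ext n z m i)"]
            rat_closure.mult Suc.IH column_ratio_closure rat_closure_diff eigval_param_closure) auto
    qed simp
    then show ?thesis using False Suc.prems by simp
  qed
qed simp

lemma entry_param_closure:
  assumes ij: "i < n" "j < n"
  shows "(\<lambda>z. snd z $$ (i, j)) \<in> param_closure n"
proof -
  have det: "det (param_eigmat (fst z) (sval_ext n z) m) \<noteq> 0" if "z \<in> M_Omega_e n" "1 \<le> m" "m \<le> n" for z m
    using eigmat_eq_param[OF that(1), of "sval_ext n z" m] eigmat_det[OF that(1), of m] that
    by (simp add: sval_ext_def)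
  have "(\<lambda>z. param_entry (fst z) (sval_ext n z) i j) \<in> param_closure n"
  proof (cases i j rule: linorder_cases)
    case equal
    then show ?thesis using ij by (simp add: param_entry_def cauchy_sol_closure)
  next
    case greater
    have "(\<lambda>z. \<Sum>k<i. sval_ext n z i k * matinv (param_eigmat (fst z) (sval_ext n z) i) $$ (k, j)) \<in> param_closure n"
    proof (intro rat_closure_sum rat_closure.mult)
      fix k assume k: "k \<in> {..<i}"
      show "(\<lambda>z. sval_ext n z i k) \<in> param_closure n"
        using k ij by (intro sval_ext_closure) auto
      show "(\<lambda>z. matinv (param_eigmat (fst z) (sval_ext n z) i) $$ (k, j)) \<in> param_closure n"
        by (rule rat_closure_matinv[OF param_eigmat_carrier param_eigmat_closure det]) (use k ij greater in auto)
    qed simp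
    then show ?thesis using greater by (simp add: param_entry_def)
  next
    case less
    have "(\<lambda>z. \<Sum>k<j. param_eigmat (fst z) (sval_ext n z) j $$ (i, k) * (cauchy_sol (fst z) j k / sval_ext n z j k)) \<in> param_closure n"
      using less ij by (intro rat_closure_sum rat_closure.mult param_eigmat_closure column_ratio_closure) auto
    then show ?thesis using less by (simp add: param_entry_def)
  qed
  then show ?thesis
    by (rule rat_closure.cong) (intro ballI entry_eq_param[OF _ sval_ext_eq ij])
qed

text \<open>Matrix entries are pole-free rational expressions in the eigenvalues and
  \<open>sval\<close>. With \<open>sval_closure\<close>, which covers the opposite direction, the
  two families of coordinates become interchangeable.\<close>

theorem closure_param:
  assumes "f \<in> coord_closure n"
  shows "f \<in> param_closure n"
  using assms
proof (induction rule: rat_closure.induct)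
  case (base f)
  then show ?case
    by (auto simp: gz_coordinates_def intro: param_coordinates_closure entry_param_closure)
qed (auto intro: rat_closure.const rat_closure.add rat_closure.mult rat_closure.inverse rat_closure.cong)

section \<open>Flows and the torus action\<close>

text \<open>\<open>gz_level\<close> and \<open>gz_position\<close> recover \<open>m\<close> and
  \<open>k\<close> from the index \<open>d(m-1) + k\<close>. Positions count from 1 but
  \<open>eigval\<close> and \<open>sval\<close> from 0, whence the recurring
  \<open>gz_position i - 1\<close>.\<close>

definition gz_level :: "nat \<Rightarrow> nat" where
  "gz_level i = (LEAST m. i \<le> gz_d m)"

definition gz_position :: "nat \<Rightarrow> nat" where
  "gz_position i = i - gz_d (gz_level i - 1)"

lemma gz_d_0 [simp]: "gz_d 0 = 0"
  by (simp add: gz_d_def)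

lemma gz_d_Suc: "gz_d (Suc m) = gz_d m + Suc m"
proof -
  have "Suc m * (Suc m + 1) = m * (m + 1) + 2 * Suc m" by simp
  then show ?thesis unfolding gz_d_def by presburger
qed

lemma gz_d_mono: "m \<le> l \<Longrightarrow> gz_d m \<le> gz_d l"
  by (rule lift_Suc_mono_le[of gz_d]) (auto simp: gz_d_Suc)

lemma gz_d_ge: "i \<le> gz_d i"
  by (induction i) (auto simp: gz_d_Suc)

lemma gz_level_position:
  assumes "1 \<le> i"
  shows "1 \<le> gz_level i" "1 \<le> gz_position i" "gz_position i \<le> gz_level i"
    "i = gz_d (gz_level i - 1) + gz_position i"
proof -
  have le: "i \<le> gz_d (gz_level i)" unfolding gz_level_def by (rule LeastI[of "\<lambda>m. i \<le> gz_d m", OF gz_d_ge])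
  show l: "1 \<le> gz_level i"
    using le assms by (cases "gz_level i") auto
  have "\<not> i \<le> gz_d (gz_level i - 1)"
    unfolding gz_level_def by (rule not_less_Least) (use l in \<open>auto simp: gz_level_def\<close>)
  moreover have "gz_d (gz_level i) = gz_d (gz_level i - 1) + gz_level i"
    using gz_d_Suc[of "gz_level i - 1"] l by simp
  ultimately show "1 \<le> gz_position i" "gz_position i \<le> gz_level i" "i = gz_d (gz_level i - 1) + gz_position i"
    using le by (auto simp: gz_position_def)
qed

lemma gz_level_unique:
  assumes "1 \<le> k" "k \<le> m"
  shows "gz_level (gz_d (m - 1) + k) = m" "gz_position (gz_d (m - 1) + k) = k"
proof -
  have m: "gz_d m = gz_d (m - 1) + m" using gz_d_Suc[of "m - 1"] assms by simp
  show l: "gz_level (gz_d (m - 1) + k) = m"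
    unfolding gz_level_def
  proof (rule Least_equality)
    show "gz_d (m - 1) + k \<le> gz_d m" using m assms by simp
    fix y assume y: "gz_d (m - 1) + k \<le> gz_d y"
    show "m \<le> y"
    proof (rule ccontr)
      assume "\<not> m \<le> y"
      then have "gz_d y \<le> gz_d (m - 1)" by (intro gz_d_mono) auto
      then show False using y assms by simp
    qed
  qed
  show "gz_position (gz_d (m - 1) + k) = k" unfolding gz_position_def l by simp
qed

lemma gz_level_le: "1 \<le> i \<Longrightarrow> i \<le> gz_d N \<longleftrightarrow> gz_level i \<le> N"
proof
  assume "i \<le> gz_d N"
  then show "gz_level i \<le> N" unfolding gz_level_def by (rule Least_le)
next
  assume "gz_level i \<le> N"
  then have "gz_d (gz_level i) \<le> gz_d N" by (rule gz_d_mono)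
  moreover have "i \<le> gz_d (gz_level i)" unfolding gz_level_def by (rule LeastI[of "\<lambda>m. i \<le> gz_d m", OF gz_d_ge])
  ultimately show "i \<le> gz_d N" by simp
qed

lemma gz_index_eq:
  assumes "1 \<le> i" "1 \<le> j" "gz_level i = gz_level j" "gz_position i = gz_position j"
  shows "i = j"
  using gz_level_position(4)[OF assms(1)] gz_level_position(4)[OF assms(2)] assms(3,4) by simp

lemma gz_r_eq:
  assumes "1 \<le> i"
  shows "gz_r i z = fst z (gz_position i) (gz_level i)"
  unfolding gz_r_def
proof (rule the_equality)
  show "\<exists>m k. 1 \<le> k \<and> k \<le> m \<and> i = gz_d (m - 1) + k \<and> fst z (gz_position i) (gz_level i) = fst z k m"
    using gz_level_position[OF assms] by blast
  show "c = fst z (gz_position i) (gz_level i)"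
    if "\<exists>m k. 1 \<le> k \<and> k \<le> m \<and> i = gz_d (m - 1) + k \<and> c = fst z k m" for c
    using that gz_level_unique by auto
qed

lemma gz_r_eigval:
  assumes "1 \<le> i"
  shows "gz_r i = (\<lambda>z. eigval z (gz_level i) (gz_position i - 1))"
  using gz_level_position(2)[OF assms] by (intro ext) (simp add: gz_r_eq[OF assms])

lemma gz_index_range:
  assumes "i \<in> {1..gz_d (n - 1)}"
  shows "1 \<le> i" "1 \<le> gz_level i" "gz_level i < n" "gz_position i - 1 < gz_level i" "gz_level i \<in> {1..n}"
proof -
  show i: "1 \<le> i" using assms by simp
  show l: "1 \<le> gz_level i" by (rule gz_level_position(1)[OF i])
  have "gz_level i \<le> n - 1" using gz_level_le[OF i, of "n - 1"] assms by simp
  then show "gz_level i < n" using l by linarith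
  then show "gz_level i \<in> {1..n}" using l by simp
  show "gz_position i - 1 < gz_level i" using gz_level_position(2,3)[OF i] by linarith
qed

lemma gz_index_exists:
  assumes "1 \<le> m" "m < n" "k < m"
  shows "\<exists>i \<in> {1..gz_d (n - 1)}. gz_level i = m \<and> gz_position i - 1 = k"
proof (intro bexI conjI)
  show "gz_level (gz_d (m - 1) + Suc k) = m" "gz_position (gz_d (m - 1) + Suc k) - 1 = k"
    using gz_level_unique[of "Suc k" m] assms by auto
  then show "gz_d (m - 1) + Suc k \<in> {1..gz_d (n - 1)}"
    using gz_level_le[of "gz_d (m - 1) + Suc k" "n - 1"] assms by auto
qed

definition sval_index :: "nat \<Rightarrow> gz_point \<Rightarrow> complex" where
  "sval_index i = sval (gz_level i) (gz_position i - 1)"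

text \<open>Existence and equality of derivatives propagate together from the coordinates to all
  rational expressions, without any Jacobian. The common point of the two curves is what makes the
  product and inverse rules give equal values.\<close>

lemma closure_same_derivative:
  assumes f: "f \<in> param_closure n"
    and \<gamma>: "\<forall>\<^sub>F t in nhds q. \<gamma> t \<in> M_Omega_e n" and \<delta>: "\<forall>\<^sub>F t in nhds p. \<delta> t \<in> M_Omega_e n" and eq: "\<gamma> q = \<delta> p"
    and base: "\<And>b. b \<in> param_coordinates n \<Longrightarrow>
      \<exists>D. ((\<lambda>t. b (\<gamma> t)) has_field_derivative D) (at q) \<and> ((\<lambda>t. b (\<delta> t)) has_field_derivative D) (at p)"
  shows "\<exists>D. ((\<lambda>t. f (\<gamma> t)) has_field_derivative D) (at q) \<and> ((\<lambda>t. f (\<delta> t)) has_field_derivative D) (at p)"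
  using f
proof (induction rule: rat_closure.induct)
  case (const c)
  then show ?case by (intro exI[of _ 0]) auto
next
  case (base f)
  then show ?case using assms(5) by blast
next
  case (add f g)
  then obtain D E where "((\<lambda>t. f (\<gamma> t)) has_field_derivative D) (at q)" "((\<lambda>t. f (\<delta> t)) has_field_derivative D) (at p)"
    "((\<lambda>t. g (\<gamma> t)) has_field_derivative E) (at q)" "((\<lambda>t. g (\<delta> t)) has_field_derivative E) (at p)" by blast
  then show ?case by (intro exI[of _ "D + E"] conjI DERIV_add)
next
  case (mult f g)
  then obtain D E where "((\<lambda>t. f (\<gamma> t)) has_field_derivative D) (at q)" "((\<lambda>t. f (\<delta> t)) has_field_derivative D) (at p)"
    "((\<lambda>t. g (\<gamma> t)) has_field_derivative E) (at q)" "((\<lambda>t. g (\<delta> t)) has_field_derivative E) (at p)" by blast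
  from DERIV_mult[OF this(1,3)] DERIV_mult[OF this(2,4)] show ?case unfolding eq by blast
next
  case (inverse f)
  then obtain D where D: "((\<lambda>t. f (\<gamma> t)) has_field_derivative D) (at q)" "((\<lambda>t. f (\<delta> t)) has_field_derivative D) (at p)" by blast
  have "f (\<gamma> q) \<noteq> 0" "f (\<delta> p) \<noteq> 0"
    using inverse(2) eventually_nhds_x_imp_x[OF \<gamma>] eventually_nhds_x_imp_x[OF \<delta>] by auto
  from DERIV_inverse'[OF D(1) this(1)] DERIV_inverse'[OF D(2) this(2)] show ?case unfolding eq by blast
next
  case (cong f g)
  then obtain D where D: "((\<lambda>t. f (\<gamma> t)) has_field_derivative D) (at q)" "((\<lambda>t. f (\<delta> t)) has_field_derivative D) (at p)" by blast
  have "\<forall>\<^sub>F t in nhds q. g (\<gamma> t) = f (\<gamma> t)" "\<forall>\<^sub>F t in nhds p. g (\<delta> t) = f (\<delta> t)"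
    using eventually_mono[OF \<gamma>, of "\<lambda>t. g (\<gamma> t) = f (\<gamma> t)"] eventually_mono[OF \<delta>, of "\<lambda>t. g (\<delta> t) = f (\<delta> t)"] cong(2) by auto
  from DERIV_cong_ev[OF refl this(1) refl, THEN iffD2, OF D(1)] DERIV_cong_ev[OF refl this(2) refl, THEN iffD2, OF D(2)]
  show ?case by blast
qed

text \<open>The candidate for the flow line is written down by reconstruction, so that it stays in
  the variety for all complex times.\<close>

definition scaled_point :: "nat \<Rightarrow> nat \<Rightarrow> nat \<Rightarrow> gz_point \<Rightarrow> complex \<Rightarrow> gz_point" where
  "scaled_point n m k z t = param_point n (fst z) (\<lambda>l j. sval l j z * (if l = m \<and> j = k then exp t else 1))"

lemma scaled_point:
  assumes z: "z \<in> M_Omega_e n"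
  shows "scaled_point n m k z t \<in> M_Omega_e n" "fst (scaled_point n m k z t) = fst z"
    "1 \<le> l \<Longrightarrow> l < n \<Longrightarrow> j < l \<Longrightarrow> sval l j (scaled_point n m k z t) = sval l j z * (if l = m \<and> j = k then exp t else 1)"
proof -
  note ne = sval_nonzero[OF z]
  show "scaled_point n m k z t \<in> M_Omega_e n"
    unfolding scaled_point_def by (rule param_point_in[OF M_Omega_eD(1)[OF z]]) (use ne in auto)
  show "fst (scaled_point n m k z t) = fst z" by (simp add: scaled_point_def param_point_def)
  show "sval l j (scaled_point n m k z t) = sval l j z * (if l = m \<and> j = k then exp t else 1)" if "1 \<le> l" "l < n" "j < l"
    unfolding scaled_point_def by (rule sval_param_point[OF M_Omega_eD(1)[OF z] _ that]) (use ne in auto)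
qed

text \<open>The curve below and any curve with velocity \<open>[x, P]\<close> have the same derivatives of
  eigenvalues and of \<open>sval\<close>, and these determine the velocity.\<close>

lemma scaled_point_curve:
  assumes z: "z \<in> M_Omega_e n" and m: "1 \<le> m" "m < n" "k < m"
  defines "\<gamma> \<equiv> scaled_point n m k z"
  shows "good_curve n \<gamma> t (snd (\<gamma> t) * eigproj n m k (\<gamma> t) - eigproj n m k (\<gamma> t) * snd (\<gamma> t))" (is "good_curve n \<gamma> t ?Y")
proof -
  have m': "m \<in> {1..n}" using m by simp
  note \<gamma> = scaled_point[OF z, where m = m and k = k, folded \<gamma>_def]
  have Y: "?Y \<in> carrier_mat n n" using M_Omega_eD(2)[OF \<gamma>(1)[of t]] eigproj_carrier[of n m k "\<gamma> t"] by auto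
  obtain \<delta> where \<delta>: "good_curve n \<delta> 0 ?Y" "\<delta> 0 = \<gamma> t" using good_curve_exists[OF \<gamma>(1) Y] by blast
  have \<delta>': "((\<lambda>q. f (\<delta> q)) has_field_derivative gz_bracket n (\<lambda>z. eigval z m k) f (\<gamma> t)) (at 0)"
    if "has_gradient n f (\<gamma> t) G" for f G
    using has_gradientD(2)[OF that \<delta>] unfolding bracket_eq[OF \<gamma>(1) has_gradient_eigval[OF m' m(3)] that] .
  have base: "\<exists>D. ((\<lambda>t. b (\<gamma> t)) has_field_derivative D) (at t) \<and> ((\<lambda>t. b (\<delta> t)) has_field_derivative D) (at 0)"
    if b: "b \<in> param_coordinates n" for b
  proof -
    consider p l where "p < l" "l \<in> {1..n}" "b = (\<lambda>z. eigval z l p)" | l j where "1 \<le> l" "l < n" "j < l" "b = sval l j"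
    proof (cases "b \<in> {sval m k | m k. 1 \<le> m \<and> m < n \<and> k < m}")
      case True then show thesis using that(2) by blast
    next
      case False
      then obtain p l where pl: "1 \<le> p" "p \<le> l" "l \<le> n" "b = (\<lambda>z. fst z p l)"
        using b by (auto simp: param_coordinates_def)
      then show thesis using that(1)[of "p - 1" l] by (cases p) auto
    qed
    then show ?thesis
    proof cases
      case 1
      have "((\<lambda>t. b (\<gamma> t)) has_field_derivative 0) (at t)" using \<gamma>(2) 1 by simp
      moreover have "((\<lambda>t. b (\<delta> t)) has_field_derivative 0) (at 0)"
        using \<delta>'[OF has_gradient_eigval[OF 1(2,1)]] bracket_eigval_eigval[OF \<gamma>(1) m' m(3) 1(2,1)] 1(3) by simp
      ultimately show ?thesis by blast
    next
      case 2
      obtain G where G: "has_gradient n (sval l j) (\<gamma> t) G" using sval_has_gradient[OF \<gamma>(1) 2(1-3)] by blast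
      have "((\<lambda>t. sval l j z * (if l = m \<and> j = k then exp t else 1)) has_field_derivative
          (if m = l \<and> k = j then sval l j (\<gamma> t) else 0)) (at t)"
        using \<gamma>(3)[OF 2(1-3)] by (auto intro!: derivative_eq_intros)
      then have "((\<lambda>t. b (\<gamma> t)) has_field_derivative (if m = l \<and> k = j then sval l j (\<gamma> t) else 0)) (at t)"
        using \<gamma>(3)[OF 2(1-3)] 2(4) by simp
      moreover have "((\<lambda>t. b (\<delta> t)) has_field_derivative (if m = l \<and> k = j then sval l j (\<gamma> t) else 0)) (at 0)"
        using \<delta>'[OF G] bracket_eigval_sval[OF \<gamma>(1) m' m(3) 2(1-3)] 2(4) by simp
      ultimately show ?thesis by blast
    qed
  qed
  have "((\<lambda>t. snd (\<gamma> t) $$ (i, j)) has_field_derivative ?Y $$ (i, j)) (at t)" if ij: "i < n" "j < n" for i j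
  proof -
    obtain D where "((\<lambda>t. snd (\<gamma> t) $$ (i, j)) has_field_derivative D) (at t)"
      "((\<lambda>t. snd (\<delta> t) $$ (i, j)) has_field_derivative D) (at 0)"
      using closure_same_derivative[OF entry_param_closure[OF ij] _ good_curveD(1)[OF \<delta>(1)] \<delta>(2)[symmetric] base] \<gamma>(1)
      by auto
    then show ?thesis using good_curveD(5)[OF \<delta>(1) ij] DERIV_unique by blast
  qed
  then show ?thesis using Y \<gamma>(1,2) by (simp add: good_curve_def del: index_minus_mat)
qed

lemma exp_ode:
  fixes f :: "complex \<Rightarrow> complex"
  assumes "\<And>t. (f has_field_derivative c * f t) (at t)"
  shows "f t = f 0 * exp (c * t)"
proof -
  have "((\<lambda>t. f t * exp (- c * t)) has_field_derivative 0) (at t within UNIV)" for t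
    by (auto intro!: derivative_eq_intros assms simp: algebra_simps)
  then obtain a where a: "\<And>t. f t * exp (- c * t) = a"
    using has_field_derivative_zero_constant[of UNIV "\<lambda>t. f t * exp (- c * t)"] by auto
  have "f t = f t * exp (- c * t) * exp (c * t)" by (simp add: exp_minus field_simps)
  also have "f t * exp (- c * t) = f 0" using a[of t] a[of 0] by simp
  finally show ?thesis .
qed

lemma scaled_point_integral_curve:
  assumes z: "z \<in> M_Omega_e n" and m: "1 \<le> m" "m < n" "k < m"
  shows "gz_integral_curve n (\<lambda>z. eigval z m k) z (scaled_point n m k z)"
  unfolding gz_integral_curve_def
proof (intro conjI ballI allI)
  have m': "m \<in> {1..n}" using m by simp
  note \<gamma> = scaled_point[OF z, where m = m and k = k]
  show "scaled_point n m k z 0 = z"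
    by (rule point_determined[OF \<gamma>(1) z \<gamma>(2)]) (simp add: \<gamma>(3))
  show "range (scaled_point n m k z) \<subseteq> M_Omega_e n" using \<gamma>(1) by auto
  fix \<psi> t assume "\<psi> \<in> gz_O n"
  then have "gz_regular_on n (M_Omega_e n) \<psi>" by (simp add: gz_O_def)
  then obtain G where G: "has_gradient n \<psi> (scaled_point n m k z t) G"
    using regular_has_gradient[OF _ \<gamma>(1) subset_refl] by blast
  show "((\<lambda>q. \<psi> (scaled_point n m k z q)) has_field_derivative
      gz_bracket n (\<lambda>z. eigval z m k) \<psi> (scaled_point n m k z t)) (at t)"
    unfolding bracket_eq[OF \<gamma>(1) has_gradient_eigval[OF m' m(3)] G]
    by (rule has_gradientD(2)[OF G scaled_point_curve[OF z m] refl])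
qed

text \<open>Eigenvalues and \<open>sval\<close> are regular, so an integral curve may be tested on
  them; the known brackets make each of them solve \<open>f' = c f\<close> with \<open>c\<close>
  equal to 0 or 1. Their values determine the point.\<close>

lemma integral_curve_unique:
  assumes z: "z \<in> M_Omega_e n" and m: "1 \<le> m" "m < n" "k < m"
    and c: "gz_integral_curve n (\<lambda>z. eigval z m k) z \<gamma>"
  shows "\<gamma> t = scaled_point n m k z t"
proof -
  have m': "m \<in> {1..n}" using m by simp
  have \<gamma>0: "\<gamma> 0 = z" and M: "\<And>t. \<gamma> t \<in> M_Omega_e n"
    and D: "\<And>\<psi> t. \<psi> \<in> gz_O n \<Longrightarrow> ((\<lambda>q. \<psi> (\<gamma> q)) has_field_derivative gz_bracket n (\<lambda>z. eigval z m k) \<psi> (\<gamma> t)) (at t)"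
    using c by (auto simp: gz_integral_curve_def)
  note S = scaled_point[OF z, where m = m and k = k]
  show ?thesis
  proof (rule point_determined[OF M S(1)])
    have "fst (\<gamma> t) p l = fst z p l" for p l
    proof (cases "1 \<le> p \<and> p \<le> l \<and> l \<le> n")
      case True
      then obtain q where q: "p = Suc q" by (cases p) auto
      have l: "l \<in> {1..n}" "q < l" using True q by auto
      have "((\<lambda>t. eigval (\<gamma> t) l q) has_field_derivative 0 * eigval (\<gamma> t) l q) (at t)" for t
        using D[OF closure_regular[OF coordinates_closure(1)], of p l t] True bracket_eigval_eigval[OF M m' m(3) l]
        by (simp add: q)
      from exp_ode[OF this] show ?thesis using \<gamma>0 q by simp
    next
      case False
      then have "fst (\<gamma> t) p l = 0" "fst z p l = 0"
        using M_Omega_eD(1)[OF M, of t] M_Omega_eD(1)[OF z] unfolding e_Omega_def by blast+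
      then show ?thesis by simp
    qed
    then show "fst (\<gamma> t) = fst (scaled_point n m k z t)" unfolding S(2) by blast
    fix l j assume l: "1 \<le> l" "l < n" "j < l"
    define e :: complex where "e = (if m = l \<and> k = j then 1 else 0)"
    have "((\<lambda>t. sval l j (\<gamma> t)) has_field_derivative e * sval l j (\<gamma> t)) (at t)" for t
      using D[OF closure_regular[OF sval_closure[OF l]], of t] bracket_eigval_sval[OF M m' m(3) l]
      by (auto simp: e_def split: if_splits)
    from exp_ode[OF this] have "sval l j (\<gamma> t) = sval l j z * exp (e * t)" using \<gamma>0 by simp
    then show "sval l j (\<gamma> t) = sval l j (scaled_point n m k z t)"
      unfolding S(3)[OF l] by (auto simp: e_def)
  qed
qed

lemma gz_flow_eq:
  assumes z: "z \<in> M_Omega_e n" and m: "1 \<le> m" "m < n" "k < m"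
  shows "gz_flow n (\<lambda>z. eigval z m k) t z = scaled_point n m k z t"
  unfolding gz_flow_def
proof (rule the_equality)
  show "\<exists>\<gamma>. gz_integral_curve n (\<lambda>z. eigval z m k) z \<gamma> \<and> scaled_point n m k z t = \<gamma> t"
    using scaled_point_integral_curve[OF z m] by blast
  show "w = scaled_point n m k z t"
    if "\<exists>\<gamma>. gz_integral_curve n (\<lambda>z. eigval z m k) z \<gamma> \<and> w = \<gamma> t" for w
    using that integral_curve_unique[OF z m] by auto
qed

section \<open>The torus action and identification of the functions \<open>s\<close>\<close>

lemma flow_sval_index:
  assumes z: "z \<in> M_Omega_e n" and j: "j \<in> {1..gz_d (n - 1)}"
  shows "gz_flow n (gz_r j) t z \<in> M_Omega_e n" "fst (gz_flow n (gz_r j) t z) = fst z"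
    "i \<in> {1..gz_d (n - 1)} \<Longrightarrow> sval_index i (gz_flow n (gz_r j) t z) = sval_index i z * (if i = j then exp t else 1)"
proof -
  note J = gz_index_range[OF j]
  have e: "gz_flow n (gz_r j) t z = scaled_point n (gz_level j) (gz_position j - 1) z t"
    unfolding gz_r_eigval[OF J(1)] by (rule gz_flow_eq[OF z J(2-4)])
  note S = scaled_point[OF z, where m = "gz_level j" and k = "gz_position j - 1"]
  show "gz_flow n (gz_r j) t z \<in> M_Omega_e n" "fst (gz_flow n (gz_r j) t z) = fst z"
    unfolding e using S by auto
  assume i: "i \<in> {1..gz_d (n - 1)}"
  note I = gz_index_range[OF i]
  have "gz_level i = gz_level j \<and> gz_position i - 1 = gz_position j - 1 \<longleftrightarrow> i = j"
    using gz_index_eq[OF I(1) J(1)] gz_level_position(2)[OF I(1)] gz_level_position(2)[OF J(1)] by auto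
  then show "sval_index i (gz_flow n (gz_r j) t z) = sval_index i z * (if i = j then exp t else 1)"
    unfolding e sval_index_def S(3)[OF I(2-4)] by simp
qed

lemma fold_flow:
  assumes "z \<in> M_Omega_e n" "distinct js" "set js \<subseteq> {1..gz_d (n - 1)}" "\<And>j. j \<in> set js \<Longrightarrow> b j \<noteq> 0"
  defines "w \<equiv> fold (\<lambda>j. gz_flow n (gz_r j) (- Ln (b j))) js z"
  shows "w \<in> M_Omega_e n \<and> fst w = fst z \<and>
    (\<forall>i \<in> {1..gz_d (n - 1)}. sval_index i w = sval_index i z * (if i \<in> set js then inverse (b i) else 1))"
  using assms(1-4) unfolding w_def
proof (induction js arbitrary: z)
  case (Cons j js)
  have j: "j \<in> {1..gz_d (n - 1)}" "b j \<noteq> 0" using Cons.prems by auto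
  let ?z = "gz_flow n (gz_r j) (- Ln (b j)) z"
  note F = flow_sval_index[OF Cons.prems(1) j(1), where t = "- Ln (b j)"]
  \<comment> \<open>Time \<open>- Ln (b j)\<close> thus multiplies the matching
    \<open>sval_index\<close> by \<open>inverse (b j)\<close>, whatever the branch of the
    logarithm.\<close>
  have e: "exp (- Ln (b j)) = inverse (b j)" using j(2) by (simp add: exp_minus)
  have "fold (\<lambda>j. gz_flow n (gz_r j) (- Ln (b j))) js ?z \<in> M_Omega_e n \<and>
      fst (fold (\<lambda>j. gz_flow n (gz_r j) (- Ln (b j))) js ?z) = fst ?z \<and>
      (\<forall>i \<in> {1..gz_d (n - 1)}. sval_index i (fold (\<lambda>j. gz_flow n (gz_r j) (- Ln (b j))) js ?z) =
         sval_index i ?z * (if i \<in> set js then inverse (b i) else 1))"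
    by (rule Cons.IH[OF F(1)]) (use Cons.prems in auto)
  then show ?case using F(2,3) e Cons.prems(2) by auto
qed auto

lemma torus_act:
  assumes z: "z \<in> M_Omega_e n" and b: "b \<in> gz_torus n"
  shows "gz_torus_act n b z \<in> M_Omega_e n" "fst (gz_torus_act n b z) = fst z"
    "i \<in> {1..gz_d (n - 1)} \<Longrightarrow> sval_index i (gz_torus_act n b z) = sval_index i z * inverse (b i)"
proof -
  have s: "set [1..<Suc (gz_d (n - 1))] = {1..gz_d (n - 1)}" by auto
  have b0: "b j \<noteq> 0" if "j \<in> set [1..<Suc (gz_d (n - 1))]" for j
    using b that unfolding gz_torus_def s by (auto simp: PiE_def Pi_def)
  have F: "gz_torus_act n b z \<in> M_Omega_e n \<and> fst (gz_torus_act n b z) = fst z \<and>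
      (\<forall>i \<in> {1..gz_d (n - 1)}. sval_index i (gz_torus_act n b z) =
         sval_index i z * (if i \<in> set [1..<Suc (gz_d (n - 1))] then inverse (b i) else 1))"
    unfolding gz_torus_act_def by (rule fold_flow[OF z distinct_upt _ b0]) (simp_all only: s subset_refl)
  show "gz_torus_act n b z \<in> M_Omega_e n" "fst (gz_torus_act n b z) = fst z" using F by auto
  show "i \<in> {1..gz_d (n - 1)} \<Longrightarrow> sval_index i (gz_torus_act n b z) = sval_index i z * inverse (b i)"
    using F unfolding s by simp
qed

lemma point_determined_index:
  assumes z: "z \<in> M_Omega_e n" and w: "w \<in> M_Omega_e n" and "fst z = fst w"
    and s: "\<And>i. i \<in> {1..gz_d (n - 1)} \<Longrightarrow> sval_index i z = sval_index i w"
  shows "z = w"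
proof (rule point_determined[OF z w assms(3)])
  fix m k assume "1 \<le> m" "m < n" "k < m"
  then obtain i where "i \<in> {1..gz_d (n - 1)}" "gz_level i = m" "gz_position i - 1 = k"
    using gz_index_exists by blast
  then show "sval m k z = sval m k w" using s[of i] by (simp add: sval_index_def)
qed

lemma M_Omega_e_b_iff:
  "z \<in> M_Omega_e_b n \<longleftrightarrow> z \<in> M_Omega_e n \<and> (\<forall>i \<in> {1..gz_d (n - 1)}. sval_index i z = 1)"
proof -
  have "(\<forall>m k. 1 \<le> m \<and> m < n \<and> k < m \<longrightarrow> sval m k z = 1) \<longleftrightarrow> (\<forall>i \<in> {1..gz_d (n - 1)}. sval_index i z = 1)"
    using gz_index_exists gz_index_range unfolding sval_index_def by metis
  then show ?thesis
    using hessenberg_iff_sval[of z n] M_Omega_eD(3)[of z n] unfolding M_Omega_e_b_def by blast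
qed

lemma sval_index_nonzero:
  "z \<in> M_Omega_e n \<Longrightarrow> i \<in> {1..gz_d (n - 1)} \<Longrightarrow> sval_index i z \<noteq> 0"
  unfolding sval_index_def using sval_nonzero gz_index_range by blast

text \<open>Since \<open>b\<close> divides each \<open>sval_index\<close> by its coordinate and
  Hessenberg points have all of them equal to 1, a decomposition of \<open>z\<close> forces the
  coordinates of the torus part to be the inverses of \<open>sval_index\<close>. The inverse taken
  in the definition of \<open>s\<close> undoes this.\<close>

theorem gz_s_eq:
  assumes z: "z \<in> M_Omega_e n" and i: "i \<in> {1..gz_d (n - 1)}"
  shows "gz_s n i z = sval_index i z"
proof -
  define b where "b = (\<lambda>i \<in> {1..gz_d (n - 1)}. inverse (sval_index i z))"
  have b: "b \<in> gz_torus n" using sval_index_nonzero[OF z] by (auto simp: b_def gz_torus_def)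
  have "gz_torus_part n z = b"
    unfolding gz_torus_part_def
  proof (rule the_equality, intro conjI b)
    \<comment> \<open>The Hessenberg point with the same eigenvalues as \<open>z\<close>.\<close>
    define y where "y = param_point n (fst z) (\<lambda>_ _. 1)"
    have y: "y \<in> M_Omega_e n" unfolding y_def by (rule param_point_in[OF M_Omega_eD(1)[OF z]]) simp
    have sy: "sval_index p y = 1" if "p \<in> {1..gz_d (n - 1)}" for p
      unfolding y_def sval_index_def using sval_param_point[OF M_Omega_eD(1)[OF z] _ gz_index_range(2-4)[OF that], of "\<lambda>_ _. 1"] by simp
    have "z = gz_torus_act n b y"
    proof (rule point_determined_index[OF z torus_act(1)[OF y b]])
      show "fst z = fst (gz_torus_act n b y)" unfolding torus_act(2)[OF y b] by (simp add: y_def param_point_def)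
      show "sval_index p z = sval_index p (gz_torus_act n b y)" if "p \<in> {1..gz_d (n - 1)}" for p
        using torus_act(3)[OF y b that] sy[OF that] that by (simp add: b_def)
    qed
    moreover have "y \<in> M_Omega_e_b n" using y sy by (simp add: M_Omega_e_b_iff)
    ultimately show "\<exists>y \<in> M_Omega_e_b n. z = gz_torus_act n b y" by blast
    fix c assume c: "c \<in> gz_torus n \<and> (\<exists>y \<in> M_Omega_e_b n. z = gz_torus_act n c y)"
    then obtain y' where y': "y' \<in> M_Omega_e_b n" "z = gz_torus_act n c y'" by blast
    show "c = b"
    proof (rule PiE_ext[of c "{1..gz_d (n - 1)}" "\<lambda>_. UNIV - {0}"])
      show "c \<in> {1..gz_d (n - 1)} \<rightarrow>\<^sub>E UNIV - {0}" "b \<in> {1..gz_d (n - 1)} \<rightarrow>\<^sub>E UNIV - {0}"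
        using c b by (simp_all add: gz_torus_def)
      show "c p = b p" if "p \<in> {1..gz_d (n - 1)}" for p
        using torus_act(3)[of y' n c p] y' c that by (auto simp: b_def M_Omega_e_b_iff)
    qed
  qed
  then show ?thesis using i by (simp add: gz_s_def b_def)
qed

section \<open>Irreducibility and the function field\<close>

text \<open>Polynomial functions on sequences, each involving finitely many entries. Closure
  properties and restriction to lines are what the geometry requires of them.\<close>

inductive_set poly_fun :: "((nat \<Rightarrow> complex) \<Rightarrow> complex) set" where
  const: "(\<lambda>_. c) \<in> poly_fun"
| var: "(\<lambda>\<tau>. \<tau> i) \<in> poly_fun"
| add: "p \<in> poly_fun \<Longrightarrow> q \<in> poly_fun \<Longrightarrow> (\<lambda>\<tau>. p \<tau> + q \<tau>) \<in> poly_fun"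
| mult: "p \<in> poly_fun \<Longrightarrow> q \<in> poly_fun \<Longrightarrow> (\<lambda>\<tau>. p \<tau> * q \<tau>) \<in> poly_fun"

lemma poly_fun_diff: "p \<in> poly_fun \<Longrightarrow> q \<in> poly_fun \<Longrightarrow> (\<lambda>\<tau>. p \<tau> - q \<tau>) \<in> poly_fun"
  using poly_fun.add[of p, OF _ poly_fun.mult[OF poly_fun.const[of "-1"]]] by fastforce

lemma poly_fun_prod:
  "finite I \<Longrightarrow> (\<And>i. i \<in> I \<Longrightarrow> f i \<in> poly_fun) \<Longrightarrow> (\<lambda>\<tau>. \<Prod>i\<in>I. f i \<tau>) \<in> poly_fun"
  by (induction I rule: finite_induct) (auto intro: poly_fun.const poly_fun.mult)

lemma poly_fun_sum:
  "finite I \<Longrightarrow> (\<And>i. i \<in> I \<Longrightarrow> f i \<in> poly_fun) \<Longrightarrow> (\<lambda>\<tau>. \<Sum>i\<in>I. f i \<tau>) \<in> poly_fun"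
  by (induction I rule: finite_induct) (auto intro: poly_fun.const poly_fun.add)

lemma poly_fun_power: "f \<in> poly_fun \<Longrightarrow> (\<lambda>\<tau>. f \<tau> ^ k) \<in> poly_fun"
  by (induction k) (auto intro: poly_fun.const poly_fun.mult)

lemma poly_fun_line:
  assumes "p \<in> poly_fun"
  shows "\<exists>P :: complex Polynomial.poly. \<forall>t. p (\<lambda>i. a i + t * (b i - a i)) = poly P t"
  using assms
proof (induction rule: poly_fun.induct)
  case (const c)
  show ?case by (intro exI[of _ "[:c:]"]) simp
next
  case (var i)
  show ?case by (intro exI[of _ "[:a i, b i - a i:]"]) simp
next
  case (add p q)
  then show ?case by (metis poly_add)
next
  case (mult p q)
  then show ?case by (metis poly_mult)
qed

text \<open>On the line through \<open>a\<close> and \<open>b\<close> both functions are nonzero polynomials in one variable.\<close>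

lemma poly_fun_nonzero:
  assumes p: "p \<in> poly_fun" "p a \<noteq> 0" and q: "q \<in> poly_fun" "q b \<noteq> 0"
  shows "\<exists>c. p c \<noteq> 0 \<and> q c \<noteq> 0"
proof -
  obtain P where P: "\<And>t. p (\<lambda>i. a i + t * (b i - a i)) = poly P t" using poly_fun_line[OF p(1)] by blast
  obtain Q where Q: "\<And>t. q (\<lambda>i. a i + t * (b i - a i)) = poly Q t" using poly_fun_line[OF q(1)] by blast
  have "P \<noteq> 0" using P[of 0] p(2) by auto
  moreover have "Q \<noteq> 0" using Q[of 1] q(2) by auto
  ultimately have "finite {t. poly (P * Q) t = 0}" by (intro poly_roots_finite) simp
  then obtain t where "poly (P * Q) t \<noteq> 0"
    using infinite_UNIV_char_0[where 'a = complex] by (metis (mono_tags, lifting) UNIV_eq_I mem_Collect_eq)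
  then show ?thesis using P[of t] Q[of t] by (intro exI[of _ "\<lambda>i. a i + t * (b i - a i)"]) auto
qed

text \<open>The entries of \<open>\<tau>\<close> are the prospective values of the generators, in the order of
  \<^const>\<open>gz_generator\<close>.\<close>

definition tau_eigval :: "nat \<Rightarrow> (nat \<Rightarrow> complex) \<Rightarrow> nat \<Rightarrow> nat \<Rightarrow> complex" where
  "tau_eigval n \<tau> k m = (if 1 \<le> k \<and> k \<le> m \<and> m \<le> n then
     (if m < n then \<tau> (gz_d (m - 1) + k) else 1) * \<tau> (gz_d (n - 1) + (gz_d (m - 1) + k)) else 0)"

definition tau_sval :: "nat \<Rightarrow> (nat \<Rightarrow> complex) \<Rightarrow> nat \<Rightarrow> nat \<Rightarrow> complex" where
  "tau_sval n \<tau> m k = \<tau> (gz_d (n - 1) + (gz_d (m - 1) + Suc k))"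

text \<open>Below level \<open>n\<close> an eigenvalue is the product of the generators
  \<open>r_(i)\<close> and \<open>s_i\<close>; at level \<open>n\<close> it is a generator itself.
  The index \<open>d(n-1) + i\<close> fits both cases: it addresses \<open>s_i\<close> for
  \<open>i \<le> d(n-1)\<close> and \<open>r_i\<close> beyond.\<close>

definition tau_point :: "nat \<Rightarrow> (nat \<Rightarrow> complex) \<Rightarrow> gz_point" where
  "tau_point n \<tau> = param_point n (tau_eigval n \<tau>) (tau_sval n \<tau>)"

definition good_tau :: "nat \<Rightarrow> (nat \<Rightarrow> complex) \<Rightarrow> bool" where
  "good_tau n \<tau> \<longleftrightarrow> tau_eigval n \<tau> \<in> e_Omega n \<and> (\<forall>i \<in> {1..gz_d (n - 1)}. \<tau> (gz_d (n - 1) + i) \<noteq> 0)"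

definition gz_gen :: "nat \<Rightarrow> nat \<Rightarrow> gz_point \<Rightarrow> complex" where
  "gz_gen n l = (let d = gz_d (n - 1) in
      if l \<le> d then gz_r_over_s n l
      else if l \<le> 2 * d then gz_s n (l - d)
      else gz_r (d + (l - 2 * d)))"

lemma gz_generator_eq: "gz_generator n l = gz_rat n (gz_gen n l)"
  by (simp add: gz_generator_def gz_gen_def Let_def)

lemma tau_eigval_poly: "(\<lambda>\<tau>. tau_eigval n \<tau> k m) \<in> poly_fun"
proof (cases "1 \<le> k \<and> k \<le> m \<and> m \<le> n")
  case True
  have "(\<lambda>\<tau>. (if m < n then \<tau> (gz_d (m - 1) + k) else 1) * \<tau> (gz_d (n - 1) + (gz_d (m - 1) + k))) \<in> poly_fun"
    by (cases "m < n") (auto intro!: poly_fun.mult poly_fun.var poly_fun.const)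
  then show ?thesis using True unfolding tau_eigval_def by simp
next
  case False
  show ?thesis unfolding tau_eigval_def if_not_P[OF False] by (rule poly_fun.const)
qed

text \<open>Finitely many polynomial inequalities amount to one: their product does not
  vanish.\<close>

lemma good_tau_poly: "\<exists>\<Delta> \<in> poly_fun. \<forall>\<tau>. good_tau n \<tau> \<longleftrightarrow> \<Delta> \<tau> \<noteq> 0"
proof -
  define d where "d = gz_d (n - 1)"
  define A where "A \<tau> = (\<Prod>i\<in>{1..d}. \<tau> (d + i))" for \<tau> :: "nat \<Rightarrow> complex"
  define B where "B \<tau> = (\<Prod>m\<in>{1..n}. \<Prod>k\<in>{1..m}. \<Prod>j\<in>{1..m} - {k}. tau_eigval n \<tau> k m - tau_eigval n \<tau> j m)" for \<tau>
  define C where "C \<tau> = (\<Prod>m\<in>{1..n - 1}. \<Prod>i\<in>{1..m}. \<Prod>j\<in>{1..m + 1}. tau_eigval n \<tau> i m - tau_eigval n \<tau> j (m + 1))" for \<tau>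
  have 1: "(\<lambda>\<tau>. A \<tau> * (B \<tau> * C \<tau>)) \<in> poly_fun"
    unfolding A_def B_def C_def
    by (intro poly_fun.mult poly_fun_prod poly_fun_diff tau_eigval_poly poly_fun.var) auto
  have 2: "good_tau n \<tau> \<longleftrightarrow> A \<tau> * (B \<tau> * C \<tau>) \<noteq> 0" for \<tau>
  proof -
    have "A \<tau> \<noteq> 0 \<longleftrightarrow> (\<forall>i \<in> {1..gz_d (n - 1)}. \<tau> (gz_d (n - 1) + i) \<noteq> 0)"
      by (simp add: A_def d_def)
    moreover have "B \<tau> \<noteq> 0 \<longleftrightarrow> (\<forall>m \<in> {1..n}. inj_on (\<lambda>k. tau_eigval n \<tau> k m) {1..m})"
      unfolding B_def inj_on_def by (simp add: Ball_def) blast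
    moreover have "C \<tau> \<noteq> 0 \<longleftrightarrow> (\<forall>m \<in> {1..n - 1}. \<forall>i \<in> {1..m}. \<forall>j \<in> {1..m + 1}. tau_eigval n \<tau> i m \<noteq> tau_eigval n \<tau> j (m + 1))"
      unfolding C_def by (auto simp only: prod_zero_iff finite_atLeastAtMost right_minus_eq)
    moreover have "\<forall>k m. \<not> (1 \<le> k \<and> k \<le> m \<and> m \<le> n) \<longrightarrow> tau_eigval n \<tau> k m = 0"
      unfolding tau_eigval_def by simp
    ultimately show ?thesis unfolding good_tau_def e_Omega_def by auto
  qed
  show ?thesis by (intro bexI[OF _ 1] allI 2)
qed

lemma good_tau_exists: "\<exists>\<tau>. good_tau n \<tau>"
proof -
  define d where "d = gz_d (n - 1)"
  \<comment> \<open>All \<open>s_i\<close> are set to 1 and every eigenvalue to its own index, so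
    that the eigenvalues are pairwise different.\<close>
  define \<tau> :: "nat \<Rightarrow> complex" where "\<tau> l = (if l \<le> d then of_nat l else if l \<le> 2 * d then 1 else of_nat (l - d))" for l
  have idx: "gz_d (m - 1) + k \<le> d" if "k \<le> m" "m < n" "1 \<le> m" for m k
  proof -
    have "m \<le> n - 1" using that by linarith
    then show ?thesis using gz_d_Suc[of "m - 1"] gz_d_mono[of m "n - 1"] that by (simp add: d_def)
  qed
  have e: "tau_eigval n \<tau> k m = of_nat (gz_d (m - 1) + k)" if "1 \<le> k" "k \<le> m" "m \<le> n" for k m
  proof -
    define i where "i = gz_d (m - 1) + k"
    have i: "1 \<le> i" "m < n \<Longrightarrow> i \<le> d" "\<not> m < n \<Longrightarrow> d < i"
      using idx[of k m] that by (auto simp: i_def d_def)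
    show ?thesis
      using i that unfolding tau_eigval_def i_def[symmetric] d_def[symmetric]
      by (cases "m < n") (auto simp: \<tau>_def)
  qed
  have "tau_eigval n \<tau> \<in> e_Omega n"
    unfolding e_Omega_def mem_Collect_eq
  proof (intro conjI ballI allI impI)
    show "tau_eigval n \<tau> k m = 0" if "\<not> (1 \<le> k \<and> k \<le> m \<and> m \<le> n)" for k m
      using that unfolding tau_eigval_def by (rule if_not_P)
    show "inj_on (\<lambda>k. tau_eigval n \<tau> k m) {1..m}" if "m \<in> {1..n}" for m
      using that by (intro inj_onI) (simp add: e del: of_nat_add)
    show "tau_eigval n \<tau> i m \<noteq> tau_eigval n \<tau> j (m + 1)" if "m \<in> {1..n - 1}" "i \<in> {1..m}" "j \<in> {1..m + 1}" for m i j
    proof -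
      have "m + 1 \<le> n" using that by auto
      moreover have "gz_d (m - 1) + i \<noteq> gz_d m + j" using gz_d_Suc[of "m - 1"] that by simp
      then have "(of_nat (gz_d (m - 1) + i) :: complex) \<noteq> of_nat (gz_d m + j)" by (simp only: of_nat_eq_iff not_False_eq_True)
      ultimately show ?thesis using that e[of i m] e[of j "m + 1"] by simp
    qed
  qed
  moreover have "\<tau> (d + i) \<noteq> 0" if "i \<in> {1..d}" for i using that by (simp add: \<tau>_def)
  ultimately show ?thesis unfolding good_tau_def d_def[symmetric] by blast
qed

lemma tau_sval_nonzero:
  assumes "good_tau n \<tau>" "1 \<le> m" "m < n" "k < m"
  shows "tau_sval n \<tau> m k \<noteq> 0"
proof -
  have "m \<le> n - 1" using assms by linarith
  then have "gz_d (m - 1) + Suc k \<in> {1..gz_d (n - 1)}"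
    using gz_d_Suc[of "m - 1"] gz_d_mono[of m "n - 1"] assms by auto
  then show ?thesis using assms(1) unfolding good_tau_def tau_sval_def by blast
qed

lemma tau_point:
  assumes "good_tau n \<tau>"
  shows "tau_point n \<tau> \<in> M_Omega_e n" "fst (tau_point n \<tau>) = tau_eigval n \<tau>"
    "1 \<le> m \<Longrightarrow> m < n \<Longrightarrow> k < m \<Longrightarrow> sval m k (tau_point n \<tau>) = tau_sval n \<tau> m k"
proof -
  have \<nu>: "tau_eigval n \<tau> \<in> e_Omega n" using assms by (simp add: good_tau_def)
  show "tau_point n \<tau> \<in> M_Omega_e n"
    unfolding tau_point_def by (rule param_point_in[OF \<nu> tau_sval_nonzero[OF assms]])
  show "fst (tau_point n \<tau>) = tau_eigval n \<tau>" by (simp add: tau_point_def param_point_def)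
  show "1 \<le> m \<Longrightarrow> m < n \<Longrightarrow> k < m \<Longrightarrow> sval m k (tau_point n \<tau>) = tau_sval n \<tau> m k"
    unfolding tau_point_def by (rule sval_param_point[OF \<nu> tau_sval_nonzero[OF assms]])
qed

lemma sval_index_tau_point:
  assumes "good_tau n \<tau>" "i \<in> {1..gz_d (n - 1)}"
  shows "sval_index i (tau_point n \<tau>) = \<tau> (gz_d (n - 1) + i)"
  using tau_point(3)[OF assms(1) gz_index_range(2-4)[OF assms(2)]] gz_level_position(2,4)[of i] assms(2)
  by (simp add: sval_index_def tau_sval_def)

lemma gz_r_tau_point:
  assumes "good_tau n \<tau>" "1 \<le> i" "i \<le> gz_d n"
  shows "gz_r i (tau_point n \<tau>) = (if i \<le> gz_d (n - 1) then \<tau> i else 1) * \<tau> (gz_d (n - 1) + i)"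
proof -
  have l: "gz_level i \<le> n" using gz_level_le[OF assms(2)] assms(3) by simp
  have "gz_level i < n \<longleftrightarrow> i \<le> gz_d (n - 1)"
    using gz_level_le[OF assms(2), of "n - 1"] gz_level_position(1)[OF assms(2)] by linarith
  then show ?thesis
    using l gz_level_position[OF assms(2)]
    by (simp add: gz_r_eq[OF assms(2)] tau_point(2)[OF assms(1)] tau_eigval_def)
qed

lemma gz_gen_tau_point:
  assumes \<tau>: "good_tau n \<tau>" and n: "1 \<le> n" and l: "l \<in> {1..n ^ 2}"
  shows "gz_gen n l (tau_point n \<tau>) = \<tau> l"
proof -
  define d where "d = gz_d (n - 1)"
  have dn: "gz_d n = d + n" using gz_d_Suc[of "n - 1"] n by (simp add: d_def)
  have n2: "n ^ 2 = 2 * d + n"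
  proof -
    have "2 * gz_d n = n * (n + 1)" by (simp add: gz_d_def)
    then show ?thesis using dn by (simp add: power2_eq_square algebra_simps)
  qed
  note s = gz_s_eq[OF tau_point(1)[OF \<tau>]] and si = sval_index_tau_point[OF \<tau>]
  consider "l \<in> {1..d}" | "d < l" "l \<le> 2 * d" | "2 * d < l" "l \<le> 2 * d + n"
    using l n2 by fastforce
  then show ?thesis
  proof cases
    case 1
    have "\<tau> (d + l) \<noteq> 0" using \<tau> 1 by (simp add: good_tau_def d_def)
    then show ?thesis
      using 1 s[of l] si[of l] gz_r_tau_point[OF \<tau>, of l] dn by (simp add: gz_gen_def gz_r_over_s_def d_def)
  next
    case 2
    then have "l - d \<in> {1..d}" by auto
    with 2 show ?thesis using s[of "l - d"] si[of "l - d"] by (simp add: gz_gen_def d_def)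
  next
    case 3
    then show ?thesis using gz_r_tau_point[OF \<tau>, of "d + (l - 2 * d)"] dn by (simp add: gz_gen_def d_def)
  qed
qed

text \<open>With \<open>gz_gen_tau_point\<close> this identifies the variety with the open set
  \<open>good_tau\<close>, apart from the entries of \<open>\<tau>\<close> with indices outside
  \<open>1..n^2\<close>.\<close>

lemma tau_of_point:
  assumes z: "z \<in> M_Omega_e n" and n: "1 \<le> n"
  defines "\<tau> \<equiv> \<lambda>l. gz_gen n l z"
  shows "good_tau n \<tau>" "tau_point n \<tau> = z"
proof -
  define d where "d = gz_d (n - 1)"
  have s: "\<tau> (d + i) = sval_index i z" if "i \<in> {1..d}" for i
    using that gz_s_eq[OF z, of i] by (simp add: \<tau>_def gz_gen_def d_def)
  have e: "tau_eigval n \<tau> k m = fst z k m" for k m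
  proof (cases "1 \<le> k \<and> k \<le> m \<and> m \<le> n")
    case False
    then have "fst z k m = 0" using M_Omega_eD(1)[OF z] unfolding e_Omega_def by blast
    then show ?thesis using False by (auto simp: tau_eigval_def)
  next
    case True
    define i where "i = gz_d (m - 1) + k"
    have i: "1 \<le> i" "gz_level i = m" "gz_position i = k" using True gz_level_unique[of k m] by (auto simp: i_def)
    have r: "gz_r i z = fst z k m" using gz_r_eq[OF i(1)] i by simp
    show ?thesis
    proof (cases "m < n")
      case t: True
      have id: "i \<in> {1..d}" using gz_level_le[OF i(1), of "n - 1"] i t by (simp add: d_def)
      have "\<tau> i = gz_r i z / sval_index i z"
        using id gz_s_eq[OF z, of i] by (simp add: \<tau>_def gz_gen_def gz_r_over_s_def d_def)
      then show ?thesis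
        using True t s[OF id] sval_index_nonzero[OF z, of i] id r
        unfolding tau_eigval_def i_def[symmetric] d_def[symmetric] by simp
    next
      case False
      then have mn: "m = n" using True by simp
      then have "\<tau> (d + i) = gz_r i z" using True by (simp add: \<tau>_def gz_gen_def d_def i_def)
      then show ?thesis using True mn r by (simp add: tau_eigval_def i_def d_def)
    qed
  qed
  then have e: "tau_eigval n \<tau> = fst z" by blast
  show g: "good_tau n \<tau>"
    unfolding good_tau_def e d_def[symmetric] using M_Omega_eD(1)[OF z] s sval_index_nonzero[OF z] by (simp add: d_def)
  show "tau_point n \<tau> = z"
    by (rule point_determined_index[OF tau_point(1)[OF g] z])
      (use tau_point(2)[OF g] e sval_index_tau_point[OF g] s in \<open>auto simp: d_def\<close>)
qed

lemma closure_tau_fraction: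
  assumes "f \<in> param_closure n"
  shows "\<exists>A \<in> poly_fun. \<exists>B \<in> poly_fun. \<forall>\<tau>. good_tau n \<tau> \<longrightarrow> B \<tau> \<noteq> 0 \<and> f (tau_point n \<tau>) = A \<tau> / B \<tau>"
  using assms
proof (induction rule: rat_closure.induct)
  case (const c)
  show ?case by (intro bexI[of _ "\<lambda>_. c"] bexI[of _ "\<lambda>_. 1"]) (auto intro: poly_fun.const)
next
  case (base f)
  then consider k m where "f = (\<lambda>z. fst z k m)" | m k where "1 \<le> m" "m < n" "k < m" "f = sval m k"
    by (auto simp: param_coordinates_def)
  then show ?case
  proof cases
    case 1
    then show ?thesis
      by (intro bexI[of _ "\<lambda>\<tau>. tau_eigval n \<tau> k m"] bexI[of _ "\<lambda>_. 1"])
        (auto simp: tau_point(2) intro: tau_eigval_poly poly_fun.const)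
  next
    case 2
    then show ?thesis
      by (intro bexI[of _ "\<lambda>\<tau>. tau_sval n \<tau> m k"] bexI[of _ "\<lambda>_. 1"])
        (auto simp: tau_point(3) tau_sval_def intro: poly_fun.var poly_fun.const)
  qed
next
  case (add f g)
  then obtain A B C D where "A \<in> poly_fun" "B \<in> poly_fun" "C \<in> poly_fun" "D \<in> poly_fun"
    "\<forall>\<tau>. good_tau n \<tau> \<longrightarrow> B \<tau> \<noteq> 0 \<and> f (tau_point n \<tau>) = A \<tau> / B \<tau>"
    "\<forall>\<tau>. good_tau n \<tau> \<longrightarrow> D \<tau> \<noteq> 0 \<and> g (tau_point n \<tau>) = C \<tau> / D \<tau>" by blast
  then show ?case
    by (intro bexI[of _ "\<lambda>\<tau>. A \<tau> * D \<tau> + C \<tau> * B \<tau>"] bexI[of _ "\<lambda>\<tau>. B \<tau> * D \<tau>"])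
      (auto intro!: poly_fun.add poly_fun.mult simp: add_frac_eq)
next
  case (mult f g)
  then obtain A B C D where "A \<in> poly_fun" "B \<in> poly_fun" "C \<in> poly_fun" "D \<in> poly_fun"
    "\<forall>\<tau>. good_tau n \<tau> \<longrightarrow> B \<tau> \<noteq> 0 \<and> f (tau_point n \<tau>) = A \<tau> / B \<tau>"
    "\<forall>\<tau>. good_tau n \<tau> \<longrightarrow> D \<tau> \<noteq> 0 \<and> g (tau_point n \<tau>) = C \<tau> / D \<tau>" by blast
  then show ?case
    by (intro bexI[of _ "\<lambda>\<tau>. A \<tau> * C \<tau>"] bexI[of _ "\<lambda>\<tau>. B \<tau> * D \<tau>"]) (auto intro!: poly_fun.mult)
next
  case (inverse f)
  then obtain A B where AB: "A \<in> poly_fun" "B \<in> poly_fun"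
    "\<forall>\<tau>. good_tau n \<tau> \<longrightarrow> B \<tau> \<noteq> 0 \<and> f (tau_point n \<tau>) = A \<tau> / B \<tau>" by blast
  moreover have "A \<tau> \<noteq> 0" if "good_tau n \<tau>" for \<tau>
    using inverse(2) tau_point(1)[OF that] AB(3) that by auto
  ultimately show ?case by (intro bexI[of _ B] bexI[of _ A]) auto
next
  case (cong f g)
  then show ?case using tau_point(1) by metis
qed

section \<open>Zariski open sets and irreducibility\<close>

lemma zariski_open_Int:
  assumes "gz_zariski_open n U" "gz_zariski_open n V"
  shows "gz_zariski_open n (U \<inter> V)"
proof -
  obtain S T where S: "S \<subseteq> gz_polynomial n" "U = {z \<in> M_Omega_e n. \<exists>p \<in> S. p z \<noteq> 0}"
    and T: "T \<subseteq> gz_polynomial n" "V = {z \<in> M_Omega_e n. \<exists>p \<in> T. p z \<noteq> 0}"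
    using assms by (auto simp: gz_zariski_open_def)
  show ?thesis
    unfolding gz_zariski_open_def
  proof (intro exI[of _ "{(\<lambda>z. p z * q z) | p q. p \<in> S \<and> q \<in> T}"] conjI)
    show "{(\<lambda>z. p z * q z) | p q. p \<in> S \<and> q \<in> T} \<subseteq> gz_polynomial n"
      using S(1) T(1) by (auto intro!: gz_polynomial.mult)
    show "U \<inter> V = {z \<in> M_Omega_e n. \<exists>p \<in> {(\<lambda>z. p z * q z) | p q. p \<in> S \<and> q \<in> T}. p z \<noteq> 0}"
      unfolding S(2) T(2) by fastforce
  qed
qed

lemma zariski_open_subset: "gz_zariski_open n U \<Longrightarrow> U \<subseteq> M_Omega_e n"
  by (auto simp: gz_zariski_open_def)

lemma zariski_open_basic: "p \<in> gz_polynomial n \<Longrightarrow> gz_zariski_open n {z \<in> M_Omega_e n. p z \<noteq> 0}"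
  unfolding gz_zariski_open_def by (intro exI[of _ "{p}"]) auto

text \<open>Pulled back along \<open>tau_point\<close>, a polynomial that is nonzero somewhere on
  the variety becomes a fraction; its numerator times the polynomial defining
  \<open>good_tau\<close> is a nonzero polynomial function whose nonvanishing locus maps into the
  open set. Two such loci meet.\<close>

theorem M_Omega_e_irreducible:
  assumes n: "1 \<le> n" and U: "gz_zariski_open n U" "U \<noteq> {}" and V: "gz_zariski_open n V" "V \<noteq> {}"
  shows "U \<inter> V \<noteq> {}"
proof -
  have *: "\<exists>A \<in> poly_fun. (\<exists>\<tau>. A \<tau> \<noteq> 0) \<and> (\<forall>\<tau>. A \<tau> \<noteq> 0 \<longrightarrow> tau_point n \<tau> \<in> U)"
    if U: "gz_zariski_open n U" "U \<noteq> {}" for U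
  proof -
    obtain S z where S: "S \<subseteq> gz_polynomial n" "U = {z \<in> M_Omega_e n. \<exists>p \<in> S. p z \<noteq> 0}" and z: "z \<in> U"
      using U unfolding gz_zariski_open_def by blast
    then obtain p where p: "p \<in> S" "p z \<noteq> 0" "z \<in> M_Omega_e n" by auto
    obtain A B where AB: "A \<in> poly_fun" "B \<in> poly_fun"
        "\<And>\<tau>. good_tau n \<tau> \<Longrightarrow> B \<tau> \<noteq> 0 \<and> p (tau_point n \<tau>) = A \<tau> / B \<tau>"
      using closure_tau_fraction[OF closure_param[OF polynomial_closure]] S(1) p(1) by blast
    obtain \<Delta> where \<Delta>: "\<Delta> \<in> poly_fun" "\<And>\<tau>. good_tau n \<tau> \<longleftrightarrow> \<Delta> \<tau> \<noteq> 0" using good_tau_poly by blast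
    show ?thesis
    proof (intro bexI[of _ "\<lambda>\<tau>. A \<tau> * \<Delta> \<tau>"] conjI exI[of _ "\<lambda>l. gz_gen n l z"] allI impI)
      note t = tau_of_point[OF p(3) n]
      show "A (\<lambda>l. gz_gen n l z) * \<Delta> (\<lambda>l. gz_gen n l z) \<noteq> 0"
        using AB(3)[OF t(1)] t(2) p(2) \<Delta>(2) t(1) by auto
      fix \<tau> assume "A \<tau> * \<Delta> \<tau> \<noteq> 0"
      then have g: "good_tau n \<tau>" "A \<tau> \<noteq> 0" using \<Delta>(2) by auto
      then have "p (tau_point n \<tau>) \<noteq> 0" using AB(3)[OF g(1)] by simp
      then show "tau_point n \<tau> \<in> U" using tau_point(1)[OF g(1)] p(1) unfolding S(2) by blast
    qed (intro poly_fun.mult AB \<Delta>)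
  qed
  obtain A a where A: "A \<in> poly_fun" "A a \<noteq> 0" "\<And>\<tau>. A \<tau> \<noteq> 0 \<Longrightarrow> tau_point n \<tau> \<in> U" using *[OF U] by blast
  obtain B b where B: "B \<in> poly_fun" "B b \<noteq> 0" "\<And>\<tau>. B \<tau> \<noteq> 0 \<Longrightarrow> tau_point n \<tau> \<in> V" using *[OF V] by blast
  from poly_fun_nonzero[OF A(1,2) B(1,2)] show ?thesis using A(3) B(3) by blast
qed

lemma M_Omega_e_nonempty: "M_Omega_e n \<noteq> {}"
  using good_tau_exists tau_point(1) by blast

section \<open>The field of rational functions\<close>

lemma regular_subset:
  assumes f: "gz_regular_on n U f" and V: "gz_zariski_open n V" "V \<subseteq> U"
  shows "gz_regular_on n V f"
  unfolding gz_regular_on_def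
proof
  fix z assume z: "z \<in> V"
  then obtain W g h where W: "gz_zariski_open n W" "z \<in> W" "g \<in> gz_polynomial n" "h \<in> gz_polynomial n"
    "\<forall>w \<in> W. h w \<noteq> 0 \<and> f w = g w / h w"
    using f V(2) unfolding gz_regular_on_def by blast
  show "\<exists>W g h. gz_zariski_open n W \<and> z \<in> W \<and> W \<subseteq> V \<and> g \<in> gz_polynomial n \<and> h \<in> gz_polynomial n \<and>
      (\<forall>w \<in> W. h w \<noteq> 0 \<and> f w = g w / h w)"
    by (intro exI[of _ "W \<inter> V"] exI[of _ g] exI[of _ h]) (use W z V zariski_open_Int in auto)
qed

lemma regular_op:
  assumes U: "gz_zariski_open n U" "gz_regular_on n U f" and V: "gz_zariski_open n V" "gz_regular_on n V g"
    and op: "\<And>a b c d. a \<in> gz_polynomial n \<Longrightarrow> b \<in> gz_polynomial n \<Longrightarrow> c \<in> gz_polynomial n \<Longrightarrow> d \<in> gz_polynomial n \<Longrightarrow>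
      \<exists>e \<in> gz_polynomial n. \<exists>h \<in> gz_polynomial n. \<forall>w. b w \<noteq> 0 \<longrightarrow> d w \<noteq> 0 \<longrightarrow> h w \<noteq> 0 \<and> F (a w / b w) (c w / d w) = e w / h w"
  shows "gz_regular_on n (U \<inter> V) (\<lambda>z. F (f z) (g z))"
  unfolding gz_regular_on_def
proof
  fix z assume z: "z \<in> U \<inter> V"
  obtain A a b where A: "gz_zariski_open n A" "z \<in> A" "A \<subseteq> U" "a \<in> gz_polynomial n" "b \<in> gz_polynomial n"
    "\<forall>w \<in> A. b w \<noteq> 0 \<and> f w = a w / b w"
    using U(2) z unfolding gz_regular_on_def by blast
  obtain C c d where C: "gz_zariski_open n C" "z \<in> C" "C \<subseteq> V" "c \<in> gz_polynomial n" "d \<in> gz_polynomial n"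
    "\<forall>w \<in> C. d w \<noteq> 0 \<and> g w = c w / d w"
    using V(2) z unfolding gz_regular_on_def by blast
  obtain e h where eh: "e \<in> gz_polynomial n" "h \<in> gz_polynomial n"
    "\<forall>w. b w \<noteq> 0 \<longrightarrow> d w \<noteq> 0 \<longrightarrow> h w \<noteq> 0 \<and> F (a w / b w) (c w / d w) = e w / h w"
    using op[OF A(4,5) C(4,5)] by blast
  have "\<forall>w \<in> A \<inter> C. h w \<noteq> 0 \<and> F (f w) (g w) = e w / h w"
  proof
    fix w assume "w \<in> A \<inter> C"
    then have "b w \<noteq> 0" "f w = a w / b w" "d w \<noteq> 0" "g w = c w / d w" using A(6) C(6) by blast+
    moreover from this have "h w \<noteq> 0 \<and> F (a w / b w) (c w / d w) = e w / h w" using eh(3) by blast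
    ultimately show "h w \<noteq> 0 \<and> F (f w) (g w) = e w / h w" by (simp only: simp_thms)
  qed
  moreover have "z \<in> A \<inter> C" "A \<inter> C \<subseteq> U \<inter> V" using A(2,3) C(2,3) by blast+
  ultimately show "\<exists>W g' h. gz_zariski_open n W \<and> z \<in> W \<and> W \<subseteq> U \<inter> V \<and> g' \<in> gz_polynomial n \<and> h \<in> gz_polynomial n \<and>
      (\<forall>w \<in> W. h w \<noteq> 0 \<and> F (f w) (g w) = g' w / h w)"
    by (intro exI[of _ "A \<inter> C"] exI[of _ e] exI[of _ h] conjI zariski_open_Int[OF A(1) C(1)] eh(1,2))
qed

lemma regular_add:
  assumes "gz_zariski_open n U" "gz_regular_on n U f" "gz_zariski_open n V" "gz_regular_on n V g"
  shows "gz_regular_on n (U \<inter> V) (\<lambda>z. f z + g z)"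
proof (rule regular_op[OF assms, where F = "(+)"])
  fix a b c d :: "gz_point \<Rightarrow> complex"
  assume "a \<in> gz_polynomial n" "b \<in> gz_polynomial n" "c \<in> gz_polynomial n" "d \<in> gz_polynomial n"
  then show "\<exists>e \<in> gz_polynomial n. \<exists>h \<in> gz_polynomial n. \<forall>w. b w \<noteq> 0 \<longrightarrow> d w \<noteq> 0 \<longrightarrow> h w \<noteq> 0 \<and> a w / b w + c w / d w = e w / h w"
    by (intro bexI[of _ "\<lambda>w. a w * d w + c w * b w"] bexI[of _ "\<lambda>w. b w * d w"] gz_polynomial.add gz_polynomial.mult)
      (auto simp: add_frac_eq)
qed

lemma regular_mult:
  assumes "gz_zariski_open n U" "gz_regular_on n U f" "gz_zariski_open n V" "gz_regular_on n V g"
  shows "gz_regular_on n (U \<inter> V) (\<lambda>z. f z * g z)"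
proof (rule regular_op[OF assms, where F = "(*)"])
  fix a b c d :: "gz_point \<Rightarrow> complex"
  assume "a \<in> gz_polynomial n" "b \<in> gz_polynomial n" "c \<in> gz_polynomial n" "d \<in> gz_polynomial n"
  then show "\<exists>e \<in> gz_polynomial n. \<exists>h \<in> gz_polynomial n. \<forall>w. b w \<noteq> 0 \<longrightarrow> d w \<noteq> 0 \<longrightarrow> h w \<noteq> 0 \<and> a w / b w * (c w / d w) = e w / h w"
    by (intro bexI[of _ "\<lambda>w. a w * c w"] bexI[of _ "\<lambda>w. b w * d w"] gz_polynomial.mult) auto
qed

lemma regular_const: "U \<subseteq> M_Omega_e n \<Longrightarrow> gz_zariski_open n U \<Longrightarrow> gz_regular_on n U (\<lambda>_. c)"
  unfolding gz_regular_on_def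
  by (intro ballI exI[of _ U] exI[of _ "\<lambda>_. c"] exI[of _ "\<lambda>_. 1"]) (auto intro: gz_polynomial.const)

text \<open>\<open>gz_rat_lift2\<close> takes a union over all representatives; well-definedness
  means that all sets in the union are the same class.\<close>

lemma UN_UN_const:
  assumes "\<And>U f V g. (U, f) \<in> A \<Longrightarrow> (V, g) \<in> B \<Longrightarrow> F U f V g = K" "A \<noteq> {}" "B \<noteq> {}"
  shows "(\<Union>(U, f)\<in>A. \<Union>(V, g)\<in>B. F U f V g) = K"
proof -
  have "(\<Union>y\<in>B. case y of (V, g) \<Rightarrow> F U f V g) = K" if "(U, f) \<in> A" for U f
  proof -
    have "(case y of (V, g) \<Rightarrow> F U f V g) = K" if "y \<in> B" for y
      using assms(1)[OF \<open>(U, f) \<in> A\<close>] that by (cases y) auto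
    then show ?thesis using assms(3) by auto
  qed
  then have "(case x of (U, f) \<Rightarrow> \<Union>y\<in>B. case y of (V, g) \<Rightarrow> F U f V g) = K" if "x \<in> A" for x
    using that by (cases x) auto
  then show ?thesis using assms(2) by auto
qed

context
  fixes n :: nat
  assumes n: "1 \<le> n"
begin

text \<open>Near a point where \<open>f\<close> and \<open>g\<close> differ, the cross-multiplied
  difference \<open>p\<close> of local fractions cuts out a nonempty open set on which they differ
  everywhere. By irreducibility it would meet \<open>W\<close>.\<close>

lemma identity_principle:
  assumes U: "gz_zariski_open n U" "gz_regular_on n U f" and V: "gz_zariski_open n V" "gz_regular_on n V g"
    and W: "gz_zariski_open n W" "W \<noteq> {}" "\<forall>w \<in> W. f w = g w" and z: "z \<in> U \<inter> V"
  shows "f z = g z"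
proof (rule ccontr)
  assume ne: "f z \<noteq> g z"
  obtain A a b where A: "gz_zariski_open n A" "z \<in> A" "a \<in> gz_polynomial n" "b \<in> gz_polynomial n"
    "\<forall>w \<in> A. b w \<noteq> 0 \<and> f w = a w / b w"
    using U(2) z unfolding gz_regular_on_def by blast
  obtain C c d where C: "gz_zariski_open n C" "z \<in> C" "c \<in> gz_polynomial n" "d \<in> gz_polynomial n"
    "\<forall>w \<in> C. d w \<noteq> 0 \<and> g w = c w / d w"
    using V(2) z unfolding gz_regular_on_def by blast
  define p where "p w = a w * d w + (- 1) * (c w * b w)" for w
  have p: "p \<in> gz_polynomial n" unfolding p_def by (intro gz_polynomial.intros A C)
  have fg: "f w = g w \<longleftrightarrow> p w = 0" if "w \<in> A \<inter> C" for w
    using that A(5) C(5) by (auto simp: p_def frac_eq_eq)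
  have "gz_zariski_open n (A \<inter> C \<inter> {z \<in> M_Omega_e n. p z \<noteq> 0})"
    by (intro zariski_open_Int A C zariski_open_basic p)
  moreover have "z \<in> A \<inter> C \<inter> {z \<in> M_Omega_e n. p z \<noteq> 0}"
    using A(2) C(2) fg[of z] ne zariski_open_subset[OF A(1)] by auto
  ultimately obtain w where "w \<in> A \<inter> C \<inter> {z \<in> M_Omega_e n. p z \<noteq> 0} \<inter> W"
    using M_Omega_e_irreducible[OF n _ _ W(1,2)] by blast
  then have "w \<in> A \<inter> C" "p w \<noteq> 0" "f w = g w" using W(3) by blast+
  then show False using fg[of w] by blast
qed

lemma rat_repsD:
  assumes "(U, f) \<in> gz_rat_reps n"
  shows "gz_zariski_open n U" "U \<noteq> {}" "gz_regular_on n U f"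
  using assms by (auto simp: gz_rat_reps_def)

text \<open>Only transitivity has content: agreement on the triple intersection, nonempty by
  irreducibility, has to be spread to \<open>U \<inter> W\<close> by the identity principle.\<close>

lemma rat_rel_equiv: "equiv (gz_rat_reps n) (gz_rat_rel n)"
proof (rule equivI)
  show "gz_rat_rel n \<subseteq> gz_rat_reps n \<times> gz_rat_reps n" by (auto simp: gz_rat_rel_def)
  show "refl_on (gz_rat_reps n) (gz_rat_rel n)" by (auto simp: refl_on_def gz_rat_rel_def)
  show "sym (gz_rat_rel n)" by (auto simp: sym_def gz_rat_rel_def)
  show "trans (gz_rat_rel n)"
  proof (rule transI)
    fix x y z assume "(x, y) \<in> gz_rat_rel n" "(y, z) \<in> gz_rat_rel n"
    then obtain U f V g W h where e: "x = (U, f)" "y = (V, g)" "z = (W, h)"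
      and r: "(U, f) \<in> gz_rat_reps n" "(V, g) \<in> gz_rat_reps n" "(W, h) \<in> gz_rat_reps n"
      and a: "\<forall>z \<in> U \<inter> V. f z = g z" "\<forall>z \<in> V \<inter> W. g z = h z"
      by (auto simp: gz_rat_rel_def)
    note U = rat_repsD[OF r(1)] and V = rat_repsD[OF r(2)] and W = rat_repsD[OF r(3)]
    have o: "gz_zariski_open n (U \<inter> V \<inter> W)" by (intro zariski_open_Int U V W)
    have ne: "U \<inter> V \<inter> W \<noteq> {}"
      using M_Omega_e_irreducible[OF n zariski_open_Int[OF U(1) V(1)] M_Omega_e_irreducible[OF n U(1,2) V(1,2)] W(1,2)] .
    have "\<forall>z \<in> U \<inter> W. f z = h z"
      using identity_principle[OF U(1,3) W(1,3) o ne] a by auto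
    then show "(x, z) \<in> gz_rat_rel n" using r e by (auto simp: gz_rat_rel_def)
  qed
qed

lemma rat_class_eq_iff:
  assumes "(U, f) \<in> gz_rat_reps n" "(V, g) \<in> gz_rat_reps n"
  shows "gz_rat_class n U f = gz_rat_class n V g \<longleftrightarrow> (\<forall>z \<in> U \<inter> V. f z = g z)"
  unfolding gz_rat_class_def eq_equiv_class_iff[OF rat_rel_equiv assms]
  using assms by (auto simp: gz_rat_rel_def)

lemma mem_rat_class:
  "(V, g) \<in> gz_rat_class n U f \<longleftrightarrow> (U, f) \<in> gz_rat_reps n \<and> (V, g) \<in> gz_rat_reps n \<and> (\<forall>z \<in> U \<inter> V. f z = g z)"
  by (auto simp: gz_rat_class_def gz_rat_rel_def)

lemma carrier_gz_F: "carrier (gz_F n) = {gz_rat_class n U f | U f. (U, f) \<in> gz_rat_reps n}"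
  by (auto simp: gz_F_def quotient_def gz_rat_class_def)

lemma rat_lift2_class:
  assumes f: "(U, f) \<in> gz_rat_reps n" and g: "(V, g) \<in> gz_rat_reps n"
    and op: "\<And>U f V g. (U, f) \<in> gz_rat_reps n \<Longrightarrow> (V, g) \<in> gz_rat_reps n \<Longrightarrow> (U \<inter> V, op f g) \<in> gz_rat_reps n"
    and cong: "\<And>f g f' g' z. f z = f' z \<Longrightarrow> g z = g' z \<Longrightarrow> op f g z = op f' g' z"
  shows "gz_rat_lift2 n op (gz_rat_class n U f) (gz_rat_class n V g) = gz_rat_class n (U \<inter> V) (op f g)"
proof -
  have "gz_rat_class n (U' \<inter> V') (op f' g') = gz_rat_class n (U \<inter> V) (op f g)"
    if "(U', f') \<in> gz_rat_class n U f" "(V', g') \<in> gz_rat_class n V g" for U' f' V' g'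
  proof -
    have r: "(U', f') \<in> gz_rat_reps n" "(V', g') \<in> gz_rat_reps n"
      and e: "\<forall>z \<in> U \<inter> U'. f z = f' z" "\<forall>z \<in> V \<inter> V'. g z = g' z" using that unfolding mem_rat_class by auto
    show ?thesis
      unfolding rat_class_eq_iff[OF op[OF r] op[OF f g]]
    proof
      fix z assume "z \<in> U' \<inter> V' \<inter> (U \<inter> V)"
      then show "op f' g' z = op f g z" using e by (intro cong) auto
    qed
  qed
  moreover have "(U, f) \<in> gz_rat_class n U f" "(V, g) \<in> gz_rat_class n V g"
    unfolding mem_rat_class using f g by blast+
  ultimately show ?thesis unfolding gz_rat_lift2_def by (intro UN_UN_const) blast+
qed

text \<open>An operation with constant value on the overlap of any two representatives is
  automatically regular there. The constant brackets descend to the function field by this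
  argument.\<close>

lemma rat_lift2_const:
  assumes A: "A \<in> carrier (gz_F n)" and B: "B \<in> carrier (gz_F n)"
    and c: "\<And>U f V g z. (U, f) \<in> A \<Longrightarrow> (V, g) \<in> B \<Longrightarrow> (U, f) \<in> gz_rat_reps n \<Longrightarrow> (V, g) \<in> gz_rat_reps n \<Longrightarrow>
      z \<in> U \<inter> V \<Longrightarrow> op f g z = c"
  shows "gz_rat_lift2 n op A B = gz_rat n (\<lambda>_. c)"
proof -
  have M: "(M_Omega_e n, \<lambda>_. c) \<in> gz_rat_reps n"
    using M_Omega_e_nonempty zariski_open_UNIV regular_const by (auto simp: gz_rat_reps_def)
  have "gz_rat_class n (U \<inter> V) (op f g) = gz_rat n (\<lambda>_. c)" if UV: "(U, f) \<in> A" "(V, g) \<in> B" for U f V g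
  proof -
    have r: "(U, f) \<in> gz_rat_reps n" "(V, g) \<in> gz_rat_reps n"
      using A B UV by (auto simp: carrier_gz_F mem_rat_class)
    note U = rat_repsD[OF r(1)] and V = rat_repsD[OF r(2)]
    have o: "gz_zariski_open n (U \<inter> V)" by (intro zariski_open_Int U V)
    have "gz_regular_on n (U \<inter> V) (op f g)"
      unfolding gz_regular_on_def
    proof
      fix z assume "z \<in> U \<inter> V"
      then show "\<exists>W g' h. gz_zariski_open n W \<and> z \<in> W \<and> W \<subseteq> U \<inter> V \<and> g' \<in> gz_polynomial n \<and> h \<in> gz_polynomial n \<and>
        (\<forall>w \<in> W. h w \<noteq> 0 \<and> op f g w = g' w / h w)"
        by (intro exI[of _ "U \<inter> V"] exI[of _ "\<lambda>_. c"] exI[of _ "\<lambda>_. 1"])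
          (use o c[OF UV r] in \<open>auto intro: gz_polynomial.const\<close>)
    qed
    then have "(U \<inter> V, op f g) \<in> gz_rat_reps n"
      using o M_Omega_e_irreducible[OF n U(1,2) V(1,2)] by (simp add: gz_rat_reps_def)
    then show ?thesis unfolding gz_rat_def using rat_class_eq_iff[OF _ M] c[OF UV r] by blast
  qed
  moreover obtain U f V g where "(U, f) \<in> A" "(V, g) \<in> B"
  proof -
    obtain U f V g where "A = gz_rat_class n U f" "(U, f) \<in> gz_rat_reps n" "B = gz_rat_class n V g" "(V, g) \<in> gz_rat_reps n"
      using A B unfolding carrier_gz_F by blast
    then have "(U, f) \<in> A" "(V, g) \<in> B" by (simp_all only: mem_rat_class) blast+
    then show thesis by (rule that)
  qed
  ultimately show ?thesis unfolding gz_rat_lift2_def by (intro UN_UN_const) blast+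
qed

lemma reps_add: "(U, f) \<in> gz_rat_reps n \<Longrightarrow> (V, g) \<in> gz_rat_reps n \<Longrightarrow> (U \<inter> V, \<lambda>z. f z + g z) \<in> gz_rat_reps n"
  and reps_mult: "(U, f) \<in> gz_rat_reps n \<Longrightarrow> (V, g) \<in> gz_rat_reps n \<Longrightarrow> (U \<inter> V, \<lambda>z. f z * g z) \<in> gz_rat_reps n"
  using M_Omega_e_irreducible[OF n] by (auto simp: gz_rat_reps_def intro!: regular_add regular_mult zariski_open_Int)

lemma gz_F_ops:
  "a \<oplus>\<^bsub>gz_F n\<^esub> b = gz_rat_lift2 n (\<lambda>f g z. f z + g z) a b"
  "a \<otimes>\<^bsub>gz_F n\<^esub> b = gz_rat_lift2 n (\<lambda>f g z. f z * g z) a b"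
  by (simp_all add: gz_F_def)

lemma class_add:
  assumes "(U, f) \<in> gz_rat_reps n" "(V, g) \<in> gz_rat_reps n"
  shows "gz_rat_class n U f \<oplus>\<^bsub>gz_F n\<^esub> gz_rat_class n V g = gz_rat_class n (U \<inter> V) (\<lambda>z. f z + g z)"
  unfolding gz_F_ops by (rule rat_lift2_class[OF assms reps_add]) auto

lemma class_mult:
  assumes "(U, f) \<in> gz_rat_reps n" "(V, g) \<in> gz_rat_reps n"
  shows "gz_rat_class n U f \<otimes>\<^bsub>gz_F n\<^esub> gz_rat_class n V g = gz_rat_class n (U \<inter> V) (\<lambda>z. f z * g z)"
  unfolding gz_F_ops by (rule rat_lift2_class[OF assms reps_mult]) auto

lemma reps_O: "f \<in> gz_O n \<Longrightarrow> (M_Omega_e n, f) \<in> gz_rat_reps n"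
  using M_Omega_e_nonempty zariski_open_UNIV by (auto simp: gz_rat_reps_def gz_O_def)

lemma O_const: "(\<lambda>_. c) \<in> gz_O n"
  using regular_const zariski_open_UNIV by (auto simp: gz_O_def)

lemma gz_F_zero: "\<zero>\<^bsub>gz_F n\<^esub> = gz_rat_class n (M_Omega_e n) (\<lambda>_. 0)"
  and gz_F_one: "\<one>\<^bsub>gz_F n\<^esub> = gz_rat_class n (M_Omega_e n) (\<lambda>_. 1)"
  by (simp_all add: gz_F_def gz_rat_def)

lemma class_carrier: "(U, f) \<in> gz_rat_reps n \<Longrightarrow> gz_rat_class n U f \<in> carrier (gz_F n)"
  by (auto simp: carrier_gz_F)

lemma carrier_class:
  assumes "a \<in> carrier (gz_F n)"
  obtains U f where "(U, f) \<in> gz_rat_reps n" "a = gz_rat_class n U f"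
  using assms by (auto simp: carrier_gz_F)

lemma reps_minus: "(U, f) \<in> gz_rat_reps n \<Longrightarrow> (U, \<lambda>z. - f z) \<in> gz_rat_reps n"
  using reps_mult[OF _ reps_O[OF O_const[of "-1"]], of U f] zariski_open_subset rat_repsD(1)
  by (simp add: Int_absorb2)

text \<open>The domain is shrunk to where a local numerator is nonzero.\<close>

lemma reps_inverse:
  assumes f: "(U, f) \<in> gz_rat_reps n" and w: "w \<in> U" "f w \<noteq> 0"
  shows "\<exists>V. (V, \<lambda>z. inverse (f z)) \<in> gz_rat_reps n \<and> V \<subseteq> U \<and> (\<forall>z \<in> V. f z \<noteq> 0)"
proof -
  obtain A a b where A: "gz_zariski_open n A" "w \<in> A" "A \<subseteq> U" "a \<in> gz_polynomial n" "b \<in> gz_polynomial n"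
    "\<forall>w \<in> A. b w \<noteq> 0 \<and> f w = a w / b w"
    using rat_repsD(3)[OF f] w unfolding gz_regular_on_def by blast
  define V where "V = A \<inter> {z \<in> M_Omega_e n. a z \<noteq> 0}"
  have V: "gz_zariski_open n V" unfolding V_def by (intro zariski_open_Int A zariski_open_basic)
  have "w \<in> V" using A w(2) zariski_open_subset[OF A(1)] by (auto simp: V_def)
  moreover have "gz_regular_on n V (\<lambda>z. inverse (f z))"
    unfolding gz_regular_on_def
    by (intro ballI exI[of _ V] exI[of _ b] exI[of _ a]) (use V A in \<open>auto simp: V_def\<close>)
  ultimately show ?thesis using V A by (intro exI[of _ V]) (auto simp: gz_rat_reps_def V_def)
qed

theorem field_gz_F: "field (gz_F n)"
proof (rule cring.cring_fieldI2)
  note zero = reps_O[OF O_const[of 0]] and one = reps_O[OF O_const[of 1]]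
  have domain: "M_Omega_e n \<inter> U = U" if "(U, f) \<in> gz_rat_reps n" for U f
    using zariski_open_subset[OF rat_repsD(1)[OF that]] by blast
  show "cring (gz_F n)"
  proof (rule cringI)
    show "abelian_group (gz_F n)"
    proof (rule abelian_groupI)
      fix x y assume "x \<in> carrier (gz_F n)" "y \<in> carrier (gz_F n)"
      then show "x \<oplus>\<^bsub>gz_F n\<^esub> y \<in> carrier (gz_F n)"
        by (elim carrier_class) (simp add: class_add class_carrier reps_add)
    next
      show "\<zero>\<^bsub>gz_F n\<^esub> \<in> carrier (gz_F n)" unfolding gz_F_zero by (rule class_carrier[OF zero])
    next
      fix x y z assume "x \<in> carrier (gz_F n)" "y \<in> carrier (gz_F n)" "z \<in> carrier (gz_F n)"
      then show "x \<oplus>\<^bsub>gz_F n\<^esub> y \<oplus>\<^bsub>gz_F n\<^esub> z = x \<oplus>\<^bsub>gz_F n\<^esub> (y \<oplus>\<^bsub>gz_F n\<^esub> z)"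
        by (elim carrier_class) (simp add: class_add reps_add Int_ac add_ac)
    next
      fix x y assume "x \<in> carrier (gz_F n)" "y \<in> carrier (gz_F n)"
      then show "x \<oplus>\<^bsub>gz_F n\<^esub> y = y \<oplus>\<^bsub>gz_F n\<^esub> x"
        by (elim carrier_class) (simp add: class_add reps_add Int_ac add_ac)
    next
      fix x assume "x \<in> carrier (gz_F n)"
      then show "\<zero>\<^bsub>gz_F n\<^esub> \<oplus>\<^bsub>gz_F n\<^esub> x = x"
        by (elim carrier_class) (simp add: gz_F_zero class_add[OF zero] domain)
    next
      fix x assume "x \<in> carrier (gz_F n)"
      then obtain U f where f: "(U, f) \<in> gz_rat_reps n" "x = gz_rat_class n U f" by (rule carrier_class)
      show "\<exists>y \<in> carrier (gz_F n). y \<oplus>\<^bsub>gz_F n\<^esub> x = \<zero>\<^bsub>gz_F n\<^esub>"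
      proof (rule bexI[OF _ class_carrier[OF reps_minus[OF f(1)]]])
        show "gz_rat_class n U (\<lambda>z. - f z) \<oplus>\<^bsub>gz_F n\<^esub> x = \<zero>\<^bsub>gz_F n\<^esub>"
          unfolding gz_F_zero f(2) class_add[OF reps_minus[OF f(1)] f(1)]
          by (subst rat_class_eq_iff[OF reps_add[OF reps_minus[OF f(1)] f(1)] zero]) simp
      qed
    qed
    show "comm_monoid (gz_F n)"
    proof (rule comm_monoidI)
      fix x y assume "x \<in> carrier (gz_F n)" "y \<in> carrier (gz_F n)"
      then show "x \<otimes>\<^bsub>gz_F n\<^esub> y \<in> carrier (gz_F n)"
        by (elim carrier_class) (simp add: class_mult class_carrier reps_mult)
    next
      show "\<one>\<^bsub>gz_F n\<^esub> \<in> carrier (gz_F n)" unfolding gz_F_one by (rule class_carrier[OF one])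
    next
      fix x y z assume "x \<in> carrier (gz_F n)" "y \<in> carrier (gz_F n)" "z \<in> carrier (gz_F n)"
      then show "x \<otimes>\<^bsub>gz_F n\<^esub> y \<otimes>\<^bsub>gz_F n\<^esub> z = x \<otimes>\<^bsub>gz_F n\<^esub> (y \<otimes>\<^bsub>gz_F n\<^esub> z)"
        by (elim carrier_class) (simp add: class_mult reps_mult Int_ac mult_ac)
    next
      fix x assume "x \<in> carrier (gz_F n)"
      then show "\<one>\<^bsub>gz_F n\<^esub> \<otimes>\<^bsub>gz_F n\<^esub> x = x"
        by (elim carrier_class) (simp add: gz_F_one class_mult[OF one] domain)
    next
      fix x y assume "x \<in> carrier (gz_F n)" "y \<in> carrier (gz_F n)"
      then show "x \<otimes>\<^bsub>gz_F n\<^esub> y = y \<otimes>\<^bsub>gz_F n\<^esub> x"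
        by (elim carrier_class) (simp add: class_mult reps_mult Int_ac mult_ac)
    qed
    fix x y z assume "x \<in> carrier (gz_F n)" "y \<in> carrier (gz_F n)" "z \<in> carrier (gz_F n)"
    then show "(x \<oplus>\<^bsub>gz_F n\<^esub> y) \<otimes>\<^bsub>gz_F n\<^esub> z = x \<otimes>\<^bsub>gz_F n\<^esub> z \<oplus>\<^bsub>gz_F n\<^esub> y \<otimes>\<^bsub>gz_F n\<^esub> z"
      by (elim carrier_class) (simp add: class_mult class_add reps_add reps_mult distrib_right Int_ac)
  qed
  show "\<zero>\<^bsub>gz_F n\<^esub> \<noteq> \<one>\<^bsub>gz_F n\<^esub>"
  proof -
    obtain w where "w \<in> M_Omega_e n" using M_Omega_e_nonempty by blast
    then show ?thesis unfolding gz_F_zero gz_F_one rat_class_eq_iff[OF zero one] by (metis IntI zero_neq_one)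
  qed
  fix a assume a: "a \<in> carrier (gz_F n)" "a \<noteq> \<zero>\<^bsub>gz_F n\<^esub>"
  from a(1) obtain U f where f: "(U, f) \<in> gz_rat_reps n" "a = gz_rat_class n U f" by (rule carrier_class)
  from a(2) obtain w where "w \<in> U" "f w \<noteq> 0"
    unfolding gz_F_zero f(2) rat_class_eq_iff[OF f(1) zero] by auto
  from reps_inverse[OF f(1) this] obtain V where V: "(V, \<lambda>z. inverse (f z)) \<in> gz_rat_reps n" "V \<subseteq> U" "\<forall>z \<in> V. f z \<noteq> 0" by blast
  show "\<exists>b \<in> carrier (gz_F n). a \<otimes>\<^bsub>gz_F n\<^esub> b = \<one>\<^bsub>gz_F n\<^esub>"
  proof (rule bexI[OF _ class_carrier[OF V(1)]])
    show "a \<otimes>\<^bsub>gz_F n\<^esub> gz_rat_class n V (\<lambda>z. inverse (f z)) = \<one>\<^bsub>gz_F n\<^esub>"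
      unfolding gz_F_one f(2) class_mult[OF f(1) V(1)]
      by (subst rat_class_eq_iff[OF reps_mult[OF f(1) V(1)] one]) (use V(3) in auto)
  qed
qed

end

section \<open>Generators, independence and brackets\<close>

definition monomial_value :: "nat multiset \<Rightarrow> (nat \<Rightarrow> complex) \<Rightarrow> complex" where
  "monomial_value m \<tau> = (\<Prod>i\<in>set_mset m. \<tau> i ^ count m i)"

lemma monomial_value_split:
  "monomial_value m \<tau> = \<tau> x ^ count m x * monomial_value (filter_mset (\<lambda>i. i \<noteq> x) m) \<tau>"
proof -
  have "(\<Prod>i\<in>set_mset m - {x}. \<tau> i ^ count m i) = monomial_value (filter_mset (\<lambda>i. i \<noteq> x) m) \<tau>"
    unfolding monomial_value_def by (intro prod.cong) auto
  then show ?thesis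
    unfolding monomial_value_def
    by (cases "x \<in># m") (simp_all add: prod.remove[of _ x] not_in_iff)
qed

lemma filter_mset_inj:
  assumes "count m x = count m' x" "filter_mset (\<lambda>i. i \<noteq> x) m = filter_mset (\<lambda>i. i \<noteq> x) m'"
  shows "m = m'"
proof (rule multiset_eqI)
  fix i show "count m i = count m' i"
    using assms(1) arg_cong[OF assms(2), of "\<lambda>M. count M i"] by (cases "i = x") auto
qed

text \<open>Induction on the variables: sorting monomials by the exponent of \<open>x\<close> gives,
  for fixed other variables, a polynomial in one variable that vanishes identically. Each of its
  coefficients is a relation in the remaining variables.\<close>

lemma monomials_independent:
  fixes c :: "nat multiset \<Rightarrow> complex"
  assumes "finite I" "finite S" "\<And>m. m \<in> S \<Longrightarrow> set_mset m \<subseteq> I" "\<And>\<tau>. (\<Sum>m\<in>S. c m * monomial_value m \<tau>) = 0"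
  shows "\<forall>m \<in> S. c m = 0"
  using assms
proof (induction I arbitrary: S c rule: finite_induct)
  case empty
  then have "S \<subseteq> {{#}}" by auto
  then consider "S = {}" | "S = {{#}}" by blast
  then show ?case using empty(3) by cases (auto simp: monomial_value_def)
next
  case (insert x I)
  define rest where "rest m = filter_mset (\<lambda>i. i \<noteq> x) m" for m :: "nat multiset"
  have slice: "(\<Sum>m\<in>{m \<in> S. count m x = e}. c m * monomial_value (rest m) \<tau>) = 0" for e \<tau>
  proof -
    \<comment> \<open>The variable \<open>x\<close> becomes the indeterminate, while the other
      variables keep their values in \<open>\<tau>\<close>.\<close>
    define P where "P = (\<Sum>m\<in>S. Polynomial.monom (c m * monomial_value (rest m) \<tau>) (count m x))"
    have "poly P t = 0" for t
    proof -
      have r: "monomial_value (rest m) (\<tau>(x := t)) = monomial_value (rest m) \<tau>" for m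
        unfolding monomial_value_def rest_def by (intro prod.cong) auto
      have "monomial_value m (\<tau>(x := t)) = t ^ count m x * monomial_value (rest m) \<tau>" for m
        unfolding r[symmetric] using monomial_value_split[of m "\<tau>(x := t)" x] by (simp add: rest_def)
      then have "poly P t = (\<Sum>m\<in>S. c m * monomial_value m (\<tau>(x := t)))"
        by (simp add: P_def poly_sum poly_monom ac_simps)
      then show ?thesis using insert.prems(3) by simp
    qed
    then have "P = 0" using poly_all_0_iff_0 by blast
    then have "poly.coeff P e = 0" by simp
    moreover have "poly.coeff P e = (\<Sum>m\<in>S. if count m x = e then c m * monomial_value (rest m) \<tau> else 0)"
      unfolding P_def coeff_sum by (intro sum.cong) auto
    ultimately show ?thesis using insert.prems(1) by (simp add: sum.inter_filter)
  qed
  show ?case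
  proof
    fix m assume m: "m \<in> S"
    define e where "e = count m x"
    define T where "T = {m \<in> S. count m x = e}"
    have inj: "inj_on rest T" unfolding inj_on_def T_def rest_def using filter_mset_inj by fastforce
    \<comment> \<open>Within one slice the exponent of \<open>x\<close> is fixed, so deleting
      \<open>x\<close> is injective and the coefficients can be transported to the shortened
      monomials.\<close>
    have "\<forall>q \<in> rest ` T. c (the_inv_into T rest q) = 0"
    proof (rule insert.IH)
      show "finite (rest ` T)" using insert.prems(1) by (simp add: T_def)
      show "set_mset q \<subseteq> I" if q: "q \<in> rest ` T" for q
      proof -
        obtain p where p: "q = rest p" "p \<in> S" using q by (auto simp: T_def)
        show ?thesis using insert.prems(2)[OF p(2)] unfolding p(1) rest_def by auto
      qed
      show "(\<Sum>q\<in>rest ` T. c (the_inv_into T rest q) * monomial_value q \<tau>) = 0" for \<tau>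
        unfolding sum.reindex[OF inj] using slice[of \<tau> e]
        by (simp add: the_inv_into_f_f[OF inj] T_def[symmetric])
    qed
    moreover have "m \<in> T" using m by (simp add: T_def e_def)
    ultimately show "c m = 0" using the_inv_into_f_f[OF inj] by force
  qed
qed

lemma closure_param_regular:
  assumes "f \<in> param_closure n"
  shows "f \<in> gz_O n"
proof -
  have "f \<in> coord_closure n"
    using assms
  proof (induction rule: rat_closure.induct)
    case (base f)
    then show ?case by (auto simp: param_coordinates_def intro: coordinates_closure sval_closure)
  qed (auto intro: rat_closure.const rat_closure.add rat_closure.mult rat_closure.inverse rat_closure.cong)
  then show ?thesis by (rule closure_regular)
qed

lemma gz_r_closure:
  assumes "1 \<le> i" "i \<le> gz_d n"
  shows "gz_r i \<in> param_closure n"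
proof -
  have "gz_level i \<le> n" using gz_level_le[OF assms(1)] assms(2) by simp
  then have "(\<lambda>z. fst z (gz_position i) (gz_level i)) \<in> param_closure n"
    using gz_level_position[OF assms(1)] by (intro param_coordinates_closure) auto
  moreover have "gz_r i = (\<lambda>z. fst z (gz_position i) (gz_level i))"
    by (rule ext) (rule gz_r_eq[OF assms(1)])
  ultimately show ?thesis by simp
qed

lemma gz_s_closure:
  assumes "i \<in> {1..gz_d (n - 1)}"
  shows "gz_s n i \<in> param_closure n"
proof (rule rat_closure.cong)
  show "sval_index i \<in> param_closure n"
    unfolding sval_index_def by (rule param_coordinates_closure(2)[OF gz_index_range(2-4)[OF assms]])
  show "\<forall>z \<in> M_Omega_e n. gz_s n i z = sval_index i z" using gz_s_eq[OF _ assms] by blast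
qed

lemma gz_s_nonzero: "z \<in> M_Omega_e n \<Longrightarrow> i \<in> {1..gz_d (n - 1)} \<Longrightarrow> gz_s n i z \<noteq> 0"
  using gz_s_eq sval_index_nonzero by simp

lemma gz_d_pred_le: "gz_d (n - 1) \<le> gz_d n"
  by (rule gz_d_mono) simp

lemma gz_r_over_s_closure:
  assumes "i \<in> {1..gz_d (n - 1)}"
  shows "gz_r_over_s n i \<in> param_closure n"
proof -
  have "(\<lambda>z. gz_r i z / gz_s n i z) \<in> param_closure n"
    using assms gz_d_pred_le[of n] gz_s_nonzero[OF _ assms]
    by (intro rat_closure_divide gz_r_closure gz_s_closure) auto
  then show ?thesis by (simp add: gz_r_over_s_def[abs_def])
qed

lemma square_eq: "1 \<le> n \<Longrightarrow> n ^ 2 = 2 * gz_d (n - 1) + n" "1 \<le> n \<Longrightarrow> gz_d n = gz_d (n - 1) + n"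
proof -
  assume n: "1 \<le> n"
  show d: "gz_d n = gz_d (n - 1) + n" using gz_d_Suc[of "n - 1"] n by simp
  have "2 * gz_d n = n * (n + 1)" by (simp add: gz_d_def)
  then show "n ^ 2 = 2 * gz_d (n - 1) + n" using d by (simp add: power2_eq_square algebra_simps)
qed

lemma gz_gen_closure:
  assumes n: "1 \<le> n" and l: "l \<in> {1..n ^ 2}"
  shows "gz_gen n l \<in> param_closure n"
proof -
  define d where "d = gz_d (n - 1)"
  consider "l \<in> {1..d}" | "d < l" "l - d \<in> {1..d}" | "2 * d < l" "d + (l - 2 * d) \<le> gz_d n"
    using l square_eq[OF n] by (auto simp: d_def) linarith
  then show ?thesis
  proof cases
    case 1 then show ?thesis using gz_r_over_s_closure[of l n] by (simp add: gz_gen_def d_def)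
  next
    case 2
    then have "\<not> l \<le> d" "l \<le> 2 * d" by auto
    then show ?thesis using 2 gz_s_closure[of "l - d" n] by (simp add: gz_gen_def d_def)
  next
    case 3
    then have "\<not> l \<le> d" "\<not> l \<le> 2 * d" by auto
    then show ?thesis using 3 gz_r_closure[of "d + (l - 2 * d)" n] by (simp add: gz_gen_def d_def)
  qed
qed

section \<open>The generators of the function field\<close>

context
  fixes n :: nat
  assumes n: "1 \<le> n"
begin

interpretation F: field "gz_F n" by (rule field_gz_F[OF n])

lemma O_mult: "f \<in> gz_O n \<Longrightarrow> g \<in> gz_O n \<Longrightarrow> (\<lambda>z. f z * g z) \<in> gz_O n"
  and O_add: "f \<in> gz_O n \<Longrightarrow> g \<in> gz_O n \<Longrightarrow> (\<lambda>z. f z + g z) \<in> gz_O n"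
  using regular_mult[OF zariski_open_UNIV _ zariski_open_UNIV] regular_add[OF zariski_open_UNIV _ zariski_open_UNIV]
  by (auto simp: gz_O_def)

lemma rat_carrier: "f \<in> gz_O n \<Longrightarrow> gz_rat n f \<in> carrier (gz_F n)"
  unfolding gz_rat_def by (rule class_carrier[OF n reps_O[OF n]])

lemma rat_add: "f \<in> gz_O n \<Longrightarrow> g \<in> gz_O n \<Longrightarrow> gz_rat n f \<oplus>\<^bsub>gz_F n\<^esub> gz_rat n g = gz_rat n (\<lambda>z. f z + g z)"
  and rat_mult: "f \<in> gz_O n \<Longrightarrow> g \<in> gz_O n \<Longrightarrow> gz_rat n f \<otimes>\<^bsub>gz_F n\<^esub> gz_rat n g = gz_rat n (\<lambda>z. f z * g z)"
  unfolding gz_rat_def by (simp_all add: class_add[OF n reps_O[OF n] reps_O[OF n]] class_mult[OF n reps_O[OF n] reps_O[OF n]])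

lemma rat_eq_iff: "f \<in> gz_O n \<Longrightarrow> g \<in> gz_O n \<Longrightarrow> gz_rat n f = gz_rat n g \<longleftrightarrow> (\<forall>z \<in> M_Omega_e n. f z = g z)"
  unfolding gz_rat_def rat_class_eq_iff[OF n reps_O[OF n] reps_O[OF n]] by simp

lemma rat_cong: "f \<in> gz_O n \<Longrightarrow> g \<in> gz_O n \<Longrightarrow> (\<And>z. z \<in> M_Omega_e n \<Longrightarrow> f z = g z) \<Longrightarrow> gz_rat n f = gz_rat n g"
  using rat_eq_iff by blast

lemma rat_zero: "\<zero>\<^bsub>gz_F n\<^esub> = gz_rat n (\<lambda>_. 0)" and rat_one: "\<one>\<^bsub>gz_F n\<^esub> = gz_rat n (\<lambda>_. 1)"
  by (simp_all add: gz_F_def)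

lemmas O_const' = O_const[OF n]

lemma rat_inverse:
  assumes "f \<in> gz_O n" "(\<lambda>z. inverse (f z)) \<in> gz_O n" "\<forall>z \<in> M_Omega_e n. f z \<noteq> 0"
  shows "inv\<^bsub>gz_F n\<^esub> (gz_rat n f) = gz_rat n (\<lambda>z. inverse (f z))"
proof (rule F.comm_inv_char[OF rat_carrier[OF assms(1)] rat_carrier[OF assms(2)]])
  show "gz_rat n f \<otimes>\<^bsub>gz_F n\<^esub> gz_rat n (\<lambda>z. inverse (f z)) = \<one>\<^bsub>gz_F n\<^esub>"
    unfolding rat_mult[OF assms(1,2)] rat_one
    by (rule rat_cong[OF O_mult[OF assms(1,2)] O_const']) (use assms(3) in auto)
qed

lemma subfield_scalars: "subfield (gz_scalars n) (gz_F n)"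
proof (rule F.subfieldI')
  show "subring (gz_scalars n) (gz_F n)"
  proof (rule F.subringI)
    show "gz_scalars n \<subseteq> carrier (gz_F n)" by (auto simp: gz_scalars_def intro: rat_carrier O_const')
    show "\<one>\<^bsub>gz_F n\<^esub> \<in> gz_scalars n" by (auto simp: gz_scalars_def rat_one)
    show "h1 \<otimes>\<^bsub>gz_F n\<^esub> h2 \<in> gz_scalars n" "h1 \<oplus>\<^bsub>gz_F n\<^esub> h2 \<in> gz_scalars n"
      if "h1 \<in> gz_scalars n" "h2 \<in> gz_scalars n" for h1 h2
      using that by (auto simp: gz_scalars_def rat_mult rat_add O_const')
    fix h assume "h \<in> gz_scalars n"
    then obtain c where c: "h = gz_rat n (\<lambda>_. c)" by (auto simp: gz_scalars_def)
    have "gz_rat n (\<lambda>_. - c) \<oplus>\<^bsub>gz_F n\<^esub> h = \<zero>\<^bsub>gz_F n\<^esub>"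
      unfolding c rat_add[OF O_const' O_const'] rat_zero by simp
    then have "\<ominus>\<^bsub>gz_F n\<^esub> h = gz_rat n (\<lambda>_. - c)"
      using F.minus_equality[of "gz_rat n (\<lambda>_. - c)" h] rat_carrier O_const' c by auto
    then show "\<ominus>\<^bsub>gz_F n\<^esub> h \<in> gz_scalars n" by (auto simp: gz_scalars_def)
  qed
  fix k assume "k \<in> gz_scalars n - {\<zero>\<^bsub>gz_F n\<^esub>}"
  then obtain c where c: "k = gz_rat n (\<lambda>_. c)" "k \<noteq> gz_rat n (\<lambda>_. 0)" by (auto simp: gz_scalars_def rat_zero)
  then have "c \<noteq> 0" by auto
  then have "inv\<^bsub>gz_F n\<^esub> k = gz_rat n (\<lambda>_. inverse c)"
    unfolding c(1) by (intro rat_inverse O_const') auto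
  then show "inv\<^bsub>gz_F n\<^esub> k \<in> gz_scalars n" by (auto simp: gz_scalars_def)
qed

lemma gz_gen_O: "l \<in> {1..n ^ 2} \<Longrightarrow> gz_gen n l \<in> gz_O n"
  by (rule closure_param_regular[OF gz_gen_closure[OF n]])

text \<open>Each rule of \<open>rat_closure\<close> is matched by a field operation. For inverses, a
  function without zeros gives a nonzero class because the variety is nonempty.\<close>

lemma generated_closure:
  assumes "f \<in> param_closure n"
  shows "gz_rat n f \<in> generate_field (gz_F n) (gz_scalars n \<union> gz_generator n ` {1..n ^ 2})" (is "_ \<in> ?G")
  using assms
proof (induction rule: rat_closure.induct)
  case (const c)
  show ?case by (rule generate_field.incl) (auto simp: gz_scalars_def)
next
  case (base f)
  define d where "d = gz_d (n - 1)"
  have gen: "gz_rat n (gz_gen n l) \<in> ?G" if "l \<in> {1..n ^ 2}" for l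
    by (rule generate_field.incl) (use that in \<open>auto simp: gz_generator_eq[symmetric]\<close>)
  have fO: "f \<in> gz_O n" by (rule closure_param_regular[OF rat_closure.base[OF base]])
  from base consider k m where "1 \<le> k" "k \<le> m" "m \<le> n" "f = (\<lambda>z. fst z k m)" |
     m k where "1 \<le> m" "m < n" "k < m" "f = sval m k"
    by (auto simp: param_coordinates_def)
  then show ?case
  proof cases
    case 1
    define i where "i = gz_d (m - 1) + k"
    have i: "1 \<le> i" "gz_level i = m" "gz_position i = k" using 1 gz_level_unique[of k m] by (auto simp: i_def)
    have r: "gz_r i = f" using gz_r_eq[OF i(1)] i 1 by auto
    have il: "i \<le> gz_d n" using gz_level_le[OF i(1)] i(2) 1 by simp
    show ?thesis
    proof (cases "i \<le> d")
      case True
      have ix: "i \<in> {1..n ^ 2}" "d + i \<in> {1..n ^ 2}" using i(1) True square_eq[OF n] by (auto simp: d_def)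
      \<comment> \<open>Below level \<open>n\<close> the eigenvalue is recovered as
        \<open>r_(i)\<close> times \<open>s_i\<close>.\<close>
      have "gz_rat n f = gz_rat n (\<lambda>z. gz_gen n i z * gz_gen n (d + i) z)"
      proof (rule rat_cong[OF fO O_mult[OF gz_gen_O[OF ix(1)] gz_gen_O[OF ix(2)]]])
        fix z assume z: "z \<in> M_Omega_e n"
        then show "f z = gz_gen n i z * gz_gen n (d + i) z"
          using gz_s_nonzero[OF z, of i] i(1) True r by (simp add: gz_gen_def d_def gz_r_over_s_def)
      qed
      also have "\<dots> = gz_rat n (gz_gen n i) \<otimes>\<^bsub>gz_F n\<^esub> gz_rat n (gz_gen n (d + i))"
        by (rule rat_mult[OF gz_gen_O[OF ix(1)] gz_gen_O[OF ix(2)], symmetric])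
      finally show ?thesis using gen[OF ix(1)] gen[OF ix(2)] generate_field.eng_mult by metis
    next
      case False
      then have "gz_gen n (d + i) = f" using r by (simp add: gz_gen_def d_def)
      moreover have "d + i \<in> {1..n ^ 2}" using i(1) il square_eq[OF n] by (auto simp: d_def)
      ultimately show ?thesis using gen by metis
    qed
  next
    case 2
    then obtain i where i: "i \<in> {1..d}" "gz_level i = m" "gz_position i - 1 = k"
      using gz_index_exists unfolding d_def by blast
    have ix: "d + i \<in> {1..n ^ 2}" using i(1) square_eq[OF n] by (auto simp: d_def)
    have "gz_rat n f = gz_rat n (gz_gen n (d + i))"
    proof (rule rat_cong[OF fO gz_gen_O[OF ix]])
      fix z assume z: "z \<in> M_Omega_e n"
      then show "f z = gz_gen n (d + i) z"
        using gz_s_eq[OF z, of i] i 2(4) by (simp add: gz_gen_def d_def sval_index_def)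
    qed
    then show ?thesis using gen[OF ix] by simp
  qed
next
  case (add f g)
  show ?case
    unfolding rat_add[OF closure_param_regular[OF add.hyps(1)] closure_param_regular[OF add.hyps(2)], symmetric]
    by (rule generate_field.eng_add[OF add.IH])
next
  case (mult f g)
  show ?case
    unfolding rat_mult[OF closure_param_regular[OF mult.hyps(1)] closure_param_regular[OF mult.hyps(2)], symmetric]
    by (rule generate_field.eng_mult[OF mult.IH])
next
  case (inverse f)
  note fO = closure_param_regular[OF inverse.hyps(1)] closure_param_regular[OF rat_closure.inverse[OF inverse.hyps]]
  have "gz_rat n f \<noteq> \<zero>\<^bsub>gz_F n\<^esub>"
  proof
    assume "gz_rat n f = \<zero>\<^bsub>gz_F n\<^esub>"
    then have "\<forall>z \<in> M_Omega_e n. f z = 0" unfolding rat_zero rat_eq_iff[OF fO(1) O_const'] .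
    then show False using inverse.hyps(2) M_Omega_e_nonempty by blast
  qed
  then show ?case using generate_field.m_inv[OF inverse.IH] rat_inverse[OF fO inverse.hyps(2)] by simp
next
  case (cong f g)
  have "gz_rat n g = gz_rat n f"
    by (rule rat_cong[OF closure_param_regular[OF rat_closure.cong[OF cong.hyps]] closure_param_regular[OF cong.hyps(1)]])
      (use cong.hyps(2) in blast)
  then show ?case using cong.IH by simp
qed

lemma gens_carrier: "gz_generator n ` {1..n ^ 2} \<subseteq> carrier (gz_F n)"
  by (auto simp: gz_generator_eq intro!: rat_carrier gz_gen_O)

text \<open>A class is determined on any nonempty open subset of its domain, so one local fraction
  \<open>g / h\<close> represents it; \<open>g\<close> and \<open>h\<close> are polynomials in the
  coordinates and hence covered by \<open>generated_closure\<close>.\<close>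

lemma generate_field_all:
  "generate_field (gz_F n) (gz_scalars n \<union> gz_generator n ` {1..n ^ 2}) = carrier (gz_F n)" (is "?G = _")
proof
  have H: "gz_scalars n \<union> gz_generator n ` {1..n ^ 2} \<subseteq> carrier (gz_F n)"
    using gens_carrier by (auto simp: gz_scalars_def intro: rat_carrier O_const')
  then show "?G \<subseteq> carrier (gz_F n)" by (rule F.generate_field_incl)
  show "carrier (gz_F n) \<subseteq> ?G"
  proof
    fix a assume "a \<in> carrier (gz_F n)"
    then obtain U f where f: "(U, f) \<in> gz_rat_reps n" "a = gz_rat_class n U f" by (rule carrier_class[OF n])
    obtain w where w: "w \<in> U" using rat_repsD(2)[OF n f(1)] by blast
    obtain V g h where V: "gz_zariski_open n V" "w \<in> V" "V \<subseteq> U" and g: "g \<in> gz_polynomial n" and h: "h \<in> gz_polynomial n"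
      and fgh: "\<forall>w \<in> V. h w \<noteq> 0 \<and> f w = g w / h w"
      using rat_repsD(3)[OF n f(1)] w unfolding gz_regular_on_def by blast
    have fV: "(V, f) \<in> gz_rat_reps n"
      using V regular_subset[OF rat_repsD(3)[OF n f(1)] V(1,3)] by (auto simp: gz_rat_reps_def)
    have aV: "a = gz_rat_class n V f"
      unfolding f(2) rat_class_eq_iff[OF n f(1) fV] by blast
    note g' = closure_param[OF polynomial_closure[OF g]] and h' = closure_param[OF polynomial_closure[OF h]]
    note gO = closure_param_regular[OF g'] and hO = closure_param_regular[OF h']
    have prod: "a \<otimes>\<^bsub>gz_F n\<^esub> gz_rat n h = gz_rat n g"
      unfolding aV gz_rat_def class_mult[OF n fV reps_O[OF n hO]]
      by (subst rat_class_eq_iff[OF n reps_mult[OF n fV reps_O[OF n hO]] reps_O[OF n gO]]) (use fgh in auto)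
    have h0: "gz_rat n h \<noteq> \<zero>\<^bsub>gz_F n\<^esub>"
    proof
      assume "gz_rat n h = \<zero>\<^bsub>gz_F n\<^esub>"
      then have "\<forall>z \<in> M_Omega_e n. h z = 0" unfolding rat_zero rat_eq_iff[OF hO O_const'] .
      then show False using fgh V(2) zariski_open_subset[OF V(1)] by blast
    qed
    have u: "gz_rat n h \<in> Units (gz_F n)" using h0 rat_carrier[OF hO] F.field_Units by blast
    have ac: "a \<in> carrier (gz_F n)" unfolding f(2) by (rule class_carrier[OF n f(1)])
    have "a = a \<otimes>\<^bsub>gz_F n\<^esub> (gz_rat n h \<otimes>\<^bsub>gz_F n\<^esub> inv\<^bsub>gz_F n\<^esub> (gz_rat n h))"
      using F.Units_r_inv[OF u] ac by simp
    also have "\<dots> = gz_rat n g \<otimes>\<^bsub>gz_F n\<^esub> inv\<^bsub>gz_F n\<^esub> (gz_rat n h)"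
      using F.m_assoc[OF ac rat_carrier[OF hO] F.Units_inv_closed[OF u]] prod by simp
    finally have "a = gz_rat n g \<otimes>\<^bsub>gz_F n\<^esub> inv\<^bsub>gz_F n\<^esub> (gz_rat n h)" .
    then show "a \<in> ?G"
      using generate_field.eng_mult[OF generated_closure[OF g'] generate_field.m_inv[OF generated_closure[OF h'] h0]]
      by simp
  qed
qed

lemma rat_pow: "f \<in> gz_O n \<Longrightarrow> gz_rat n f [^]\<^bsub>gz_F n\<^esub> (k::nat) = gz_rat n (\<lambda>z. f z ^ k) \<and> (\<lambda>z. f z ^ k) \<in> gz_O n"
proof (induction k)
  case 0
  then show ?case using O_const' by (simp add: rat_one)
next
  case (Suc k)
  then have IH: "gz_rat n f [^]\<^bsub>gz_F n\<^esub> k = gz_rat n (\<lambda>z. f z ^ k)" "(\<lambda>z. f z ^ k) \<in> gz_O n" by auto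
  have "(\<lambda>z. f z ^ k * f z) \<in> gz_O n" by (rule O_mult[OF IH(2) Suc.prems])
  then show ?case using IH(1) rat_mult[OF IH(2) Suc.prems] by (simp add: mult.commute)
qed

lemma rat_finprod:
  assumes "finite A" "\<And>i. i \<in> A \<Longrightarrow> f i \<in> gz_O n"
  shows "(\<Otimes>\<^bsub>gz_F n\<^esub>i\<in>A. gz_rat n (f i)) = gz_rat n (\<lambda>z. \<Prod>i\<in>A. f i z) \<and> (\<lambda>z. \<Prod>i\<in>A. f i z) \<in> gz_O n"
  using assms
proof (induction A rule: finite_induct)
  case empty
  then show ?case using O_const' by (simp add: rat_one)
next
  case (insert x A)
  then have IH: "(\<Otimes>\<^bsub>gz_F n\<^esub>i\<in>A. gz_rat n (f i)) = gz_rat n (\<lambda>z. \<Prod>i\<in>A. f i z)" "(\<lambda>z. \<Prod>i\<in>A. f i z) \<in> gz_O n" by auto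
  have fx: "f x \<in> gz_O n" using insert.prems by simp
  have "(\<Otimes>\<^bsub>gz_F n\<^esub>i\<in>insert x A. gz_rat n (f i)) = gz_rat n (f x) \<otimes>\<^bsub>gz_F n\<^esub> (\<Otimes>\<^bsub>gz_F n\<^esub>i\<in>A. gz_rat n (f i))"
    using insert.prems by (intro F.finprod_insert insert.hyps) (auto intro: rat_carrier)
  also have "\<dots> = gz_rat n (\<lambda>z. f x z * (\<Prod>i\<in>A. f i z))" unfolding IH(1) by (rule rat_mult[OF fx IH(2)])
  finally show ?case using O_mult[OF fx IH(2)] insert.hyps by simp
qed

lemma rat_finsum:
  assumes "finite A" "\<And>i. i \<in> A \<Longrightarrow> f i \<in> gz_O n"
  shows "(\<Oplus>\<^bsub>gz_F n\<^esub>i\<in>A. gz_rat n (f i)) = gz_rat n (\<lambda>z. \<Sum>i\<in>A. f i z) \<and> (\<lambda>z. \<Sum>i\<in>A. f i z) \<in> gz_O n"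
  using assms
proof (induction A rule: finite_induct)
  case empty
  then show ?case using O_const' by (simp add: rat_zero)
next
  case (insert x A)
  then have IH: "(\<Oplus>\<^bsub>gz_F n\<^esub>i\<in>A. gz_rat n (f i)) = gz_rat n (\<lambda>z. \<Sum>i\<in>A. f i z)" "(\<lambda>z. \<Sum>i\<in>A. f i z) \<in> gz_O n" by auto
  have fx: "f x \<in> gz_O n" using insert.prems by simp
  have "(\<Oplus>\<^bsub>gz_F n\<^esub>i\<in>insert x A. gz_rat n (f i)) = gz_rat n (f x) \<oplus>\<^bsub>gz_F n\<^esub> (\<Oplus>\<^bsub>gz_F n\<^esub>i\<in>A. gz_rat n (f i))"
    using insert.prems by (intro F.finsum_insert insert.hyps) (auto intro: rat_carrier)
  also have "\<dots> = gz_rat n (\<lambda>z. f x z + (\<Sum>i\<in>A. f i z))" unfolding IH(1) by (rule rat_add[OF fx IH(2)])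
  finally show ?case using O_add[OF fx IH(2)] insert.hyps by simp
qed

text \<open>Finite support turns \<open>indexed_poly_value\<close> into a genuine sum: over an
  infinite index set the operator would return its default value 0.\<close>

lemma indexed_pset_finite:
  assumes "P \<in> ring.indexed_pset (gz_F n) I (gz_scalars n)"
  shows "finite {m. P m \<noteq> \<zero>\<^bsub>gz_F n\<^esub>} \<and> (\<forall>m. P m \<in> gz_scalars n) \<and> (\<forall>m. P m \<noteq> \<zero>\<^bsub>gz_F n\<^esub> \<longrightarrow> set_mset m \<subseteq> I)"
  using assms
proof (induction rule: F.indexed_pset.induct)
  note K = subringE(2,6,7)[OF subfieldE(1)[OF subfield_scalars]]
  case (indexed_const k)
  have "{m. F.indexed_const k m \<noteq> \<zero>\<^bsub>gz_F n\<^esub>} \<subseteq> {{#}}" by (auto simp: F.indexed_const_def)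
  then show ?case using indexed_const K(1) finite_subset by (auto simp: F.indexed_const_def)
next
  note K = subringE(1,2,6,7)[OF subfieldE(1)[OF subfield_scalars]]
  case (indexed_padd P Q)
  have nz: "P m \<noteq> \<zero>\<^bsub>gz_F n\<^esub> \<or> Q m \<noteq> \<zero>\<^bsub>gz_F n\<^esub>" if "F.indexed_padd P Q m \<noteq> \<zero>\<^bsub>gz_F n\<^esub>" for m
    using that F.l_zero[OF F.zero_closed] unfolding F.indexed_padd_def by metis
  then have "{m. F.indexed_padd P Q m \<noteq> \<zero>\<^bsub>gz_F n\<^esub>} \<subseteq> {m. P m \<noteq> \<zero>\<^bsub>gz_F n\<^esub>} \<union> {m. Q m \<noteq> \<zero>\<^bsub>gz_F n\<^esub>}"
    by blast
  then have "finite {m. F.indexed_padd P Q m \<noteq> \<zero>\<^bsub>gz_F n\<^esub>}" using indexed_padd finite_subset by blast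
  moreover have "F.indexed_padd P Q m \<in> gz_scalars n" for m
    using indexed_padd K(4) by (simp add: F.indexed_padd_def)
  moreover have "set_mset m \<subseteq> I" if "F.indexed_padd P Q m \<noteq> \<zero>\<^bsub>gz_F n\<^esub>" for m
    using nz[OF that] indexed_padd by blast
  ultimately show ?case by blast
next
  note K = subringE(2)[OF subfieldE(1)[OF subfield_scalars]]
  case (indexed_pmult P i)
  have sub: "{m. F.indexed_pmult P i m \<noteq> \<zero>\<^bsub>gz_F n\<^esub>} \<subseteq> (\<lambda>m. add_mset i m) ` {m. P m \<noteq> \<zero>\<^bsub>gz_F n\<^esub>}"
  proof
    fix m assume "m \<in> {m. F.indexed_pmult P i m \<noteq> \<zero>\<^bsub>gz_F n\<^esub>}"
    then have "i \<in># m" "P (m - {#i#}) \<noteq> \<zero>\<^bsub>gz_F n\<^esub>" by (auto simp: F.indexed_pmult_def split: if_splits)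
    then show "m \<in> (\<lambda>m. add_mset i m) ` {m. P m \<noteq> \<zero>\<^bsub>gz_F n\<^esub>}"
      by (intro image_eqI[of _ _ "m - {#i#}"]) auto
  qed
  then have "finite {m. F.indexed_pmult P i m \<noteq> \<zero>\<^bsub>gz_F n\<^esub>}" using indexed_pmult finite_subset by blast
  moreover have "F.indexed_pmult P i m \<in> gz_scalars n" for m
    using indexed_pmult F.zero_closed subringE(2)[OF subfieldE(1)[OF subfield_scalars]] by (simp add: F.indexed_pmult_def)
  moreover have "set_mset m \<subseteq> I" if nz: "F.indexed_pmult P i m \<noteq> \<zero>\<^bsub>gz_F n\<^esub>" for m
  proof -
    obtain m' where "m = add_mset i m'" "P m' \<noteq> \<zero>\<^bsub>gz_F n\<^esub>" using nz sub by blast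
    then show ?thesis using indexed_pmult by auto
  qed
  ultimately show ?case by blast
qed

text \<open>At \<open>tau_point n \<tau>\<close> the generators take the values
  \<open>\<tau>\<close>, so a relation between them is a polynomial function \<open>Q\<close>
  vanishing on all of \<open>good_tau\<close>. That set is the nonvanishing locus of a nonzero
  polynomial, hence \<open>Q\<close> vanishes everywhere and its coefficients are 0.\<close>

lemma generators_independent: "alg_independent_family (gz_F n) (gz_scalars n) {1..n ^ 2} (gz_generator n)"
  unfolding alg_independent_family_def
proof (intro ballI impI)
  fix P assume P: "P \<in> ring.indexed_pset (gz_F n) {1..n ^ 2} (gz_scalars n)"
    and v: "indexed_poly_value (gz_F n) (gz_generator n) P = \<zero>\<^bsub>gz_F n\<^esub>"
  define S where "S = {m. P m \<noteq> \<zero>\<^bsub>gz_F n\<^esub>}"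
  have S: "finite S" "\<And>m. m \<in> S \<Longrightarrow> set_mset m \<subseteq> {1..n ^ 2}" and K: "\<forall>m. P m \<in> gz_scalars n"
    using indexed_pset_finite[OF P] by (auto simp: S_def)
  have "\<forall>m. \<exists>c. P m = gz_rat n (\<lambda>_. c)" using K by (auto simp: gz_scalars_def)
  from choice[OF this] obtain c where c: "\<And>m. P m = gz_rat n (\<lambda>_. c m)" by blast
  define f where "f m z = c m * (\<Prod>i\<in>set_mset m. gz_gen n i z ^ count m i)" for m z
  have mterm: "P m \<otimes>\<^bsub>gz_F n\<^esub> (\<Otimes>\<^bsub>gz_F n\<^esub>i\<in>set_mset m. gz_generator n i [^]\<^bsub>gz_F n\<^esub> count m i) = gz_rat n (f m) \<and> f m \<in> gz_O n"
    if m: "m \<in> S" for m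
  proof -
    have pw: "gz_generator n i [^]\<^bsub>gz_F n\<^esub> count m i = gz_rat n (\<lambda>z. gz_gen n i z ^ count m i)"
      "(\<lambda>z. gz_gen n i z ^ count m i) \<in> gz_O n" if "i \<in> set_mset m" for i
      using rat_pow[OF gz_gen_O, of i] S(2)[OF m] that unfolding gz_generator_eq by blast+
    have "(\<Otimes>\<^bsub>gz_F n\<^esub>i\<in>set_mset m. gz_generator n i [^]\<^bsub>gz_F n\<^esub> count m i) =
        (\<Otimes>\<^bsub>gz_F n\<^esub>i\<in>set_mset m. gz_rat n (\<lambda>z. gz_gen n i z ^ count m i))"
      by (rule F.finprod_cong') (use pw rat_carrier in auto)
    also have "\<dots> = gz_rat n (\<lambda>z. \<Prod>i\<in>set_mset m. gz_gen n i z ^ count m i)"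
      using rat_finprod[of "set_mset m" "\<lambda>i z. gz_gen n i z ^ count m i"] pw(2) by simp
    finally have e: "(\<Otimes>\<^bsub>gz_F n\<^esub>i\<in>set_mset m. gz_generator n i [^]\<^bsub>gz_F n\<^esub> count m i) = \<dots>" .
    have O: "(\<lambda>z. \<Prod>i\<in>set_mset m. gz_gen n i z ^ count m i) \<in> gz_O n"
      using rat_finprod[of "set_mset m" "\<lambda>i z. gz_gen n i z ^ count m i"] pw(2) by simp
    show ?thesis
      unfolding e c rat_mult[OF O_const' O] f_def[abs_def] using O_mult[OF O_const' O] by simp
  qed
  have "indexed_poly_value (gz_F n) (gz_generator n) P = (\<Oplus>\<^bsub>gz_F n\<^esub>m\<in>S. gz_rat n (f m))"
    unfolding indexed_poly_value_def S_def[symmetric]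
    by (rule F.finsum_cong') (use mterm rat_carrier in auto)
  also have "\<dots> = gz_rat n (\<lambda>z. \<Sum>m\<in>S. f m z)" using rat_finsum[OF S(1), of f] mterm by blast
  finally have "gz_rat n (\<lambda>z. \<Sum>m\<in>S. f m z) = gz_rat n (\<lambda>_. 0)" using v rat_zero by simp
  then have f0: "\<forall>z \<in> M_Omega_e n. (\<Sum>m\<in>S. f m z) = 0"
    using rat_eq_iff[OF _ O_const'] rat_finsum[OF S(1), of f] mterm by blast
  define Q where "Q \<tau> = (\<Sum>m\<in>S. c m * monomial_value m \<tau>)" for \<tau>
  have Qp: "Q \<in> poly_fun"
    unfolding Q_def[abs_def] monomial_value_def[abs_def]
    by (intro poly_fun_sum S poly_fun.mult poly_fun.const poly_fun_prod poly_fun_power poly_fun.var) auto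
  have Qgood: "Q \<tau> = 0" if g: "good_tau n \<tau>" for \<tau>
  proof -
    have "f m (tau_point n \<tau>) = c m * monomial_value m \<tau>" if "m \<in> S" for m
      unfolding f_def monomial_value_def using S(2)[OF that] gz_gen_tau_point[OF g n] by (auto intro!: prod.cong)
    then have "Q \<tau> = (\<Sum>m\<in>S. f m (tau_point n \<tau>))" unfolding Q_def by simp
    then show ?thesis using f0 tau_point(1)[OF g] by simp
  qed
  have "Q \<tau> = 0" for \<tau>
  proof (rule ccontr)
    assume a: "Q \<tau> \<noteq> 0"
    obtain \<Delta> where \<Delta>: "\<Delta> \<in> poly_fun" "\<And>\<tau>. good_tau n \<tau> \<longleftrightarrow> \<Delta> \<tau> \<noteq> 0" using good_tau_poly by blast
    obtain b where "\<Delta> b \<noteq> 0" using good_tau_exists \<Delta>(2) by blast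
    from poly_fun_nonzero[OF Qp a \<Delta>(1) this] show False using Qgood \<Delta>(2) by blast
  qed
  then have "\<forall>m \<in> S. c m = 0"
    using monomials_independent[OF _ S, of c] unfolding Q_def by blast
  moreover have "c m \<noteq> 0" if "m \<in> S" for m using that c[of m] rat_zero by (auto simp: S_def)
  ultimately have "S = {}" by blast
  then show "P = (\<lambda>_. \<zero>\<^bsub>gz_F n\<^esub>)" by (auto simp: S_def)
qed

theorem rational_function_field:
  "is_rational_function_field (gz_F n) (gz_scalars n) {1..n ^ 2} (gz_generator n)"
  unfolding is_rational_function_field_def
  using F.field_axioms subfield_scalars gens_carrier generators_independent generate_field_all by blast

text \<open>Other representatives of the two classes agree with \<open>f\<close> and
  \<open>g\<close> on open sets, so they have the same gradients and the same bracket at each point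
  of these.\<close>

lemma F_bracket_const:
  assumes f: "f \<in> gz_O n" and g: "g \<in> gz_O n" and c: "\<And>z. z \<in> M_Omega_e n \<Longrightarrow> gz_bracket n f g z = c"
  shows "gz_F_bracket n (gz_rat n f) (gz_rat n g) = gz_rat n (\<lambda>_. c)"
  unfolding gz_F_bracket_def
proof (rule rat_lift2_const[OF n rat_carrier[OF f] rat_carrier[OF g]])
  fix U f' V g' z assume r: "(U, f') \<in> gz_rat n f" "(V, g') \<in> gz_rat n g" "(U, f') \<in> gz_rat_reps n" "(V, g') \<in> gz_rat_reps n"
    and z: "z \<in> U \<inter> V"
  note U = rat_repsD[OF n r(3)] and V = rat_repsD[OF n r(4)]
  have zM: "z \<in> M_Omega_e n" using z zariski_open_subset[OF U(1)] by blast
  have e: "\<forall>w \<in> U. f' w = f w" "\<forall>w \<in> V. g' w = g w"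
    using r(1,2) zariski_open_subset[OF U(1)] zariski_open_subset[OF V(1)]
    unfolding gz_rat_def mem_rat_class[OF n] by (metis IntI subsetD)+
  obtain F where F: "has_gradient n f z F" using regular_has_gradient[OF _ zM subset_refl, of f] f unfolding gz_O_def by blast
  obtain G where G: "has_gradient n g z G" using regular_has_gradient[OF _ zM subset_refl, of g] g unfolding gz_O_def by blast
  have "has_gradient n f' z F" "has_gradient n g' z G"
    using has_gradient_cong[OF F U(1) _ e(1)] has_gradient_cong[OF G V(1) _ e(2)] z by blast+
  then have "gz_bracket n f' g' z = gz_bracket n f g z"
    using bracket_eq[OF zM F G] bracket_eq[OF zM] by metis
  then show "gz_bracket n f' g' z = c" using c[OF zM] by simp
qed

text \<open>Here \<open>\<phi>\<close> may have poles; its representatives have gradients on their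
  own domains, and the Casimir property holds pointwise.\<close>

lemma F_bracket_top:
  assumes k: "k \<in> {1..n}" and \<phi>: "\<phi> \<in> carrier (gz_F n)"
  shows "gz_F_bracket n (gz_rat n (gz_r (gz_d (n - 1) + k))) \<phi> = \<zero>\<^bsub>gz_F n\<^esub>"
  unfolding gz_F_bracket_def rat_zero
proof (rule rat_lift2_const[OF n rat_carrier \<phi>])
  let ?i = "gz_d (n - 1) + k"
  have i: "1 \<le> ?i" "gz_level ?i = n" "gz_position ?i = k" using k gz_level_unique[of k n] by auto
  have "?i \<le> gz_d n" using k square_eq(2)[OF n] by simp
  then show O: "gz_r ?i \<in> gz_O n" by (rule closure_param_regular[OF gz_r_closure[OF i(1)]])
  fix U f V g z assume r: "(U, f) \<in> gz_rat n (gz_r ?i)" "(U, f) \<in> gz_rat_reps n" "(V, g) \<in> gz_rat_reps n"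
    and z: "z \<in> U \<inter> V"
  note U = rat_repsD[OF n r(2)] and V = rat_repsD[OF n r(3)]
  have zM: "z \<in> M_Omega_e n" using z zariski_open_subset[OF U(1)] by blast
  have e: "\<forall>w \<in> U. f w = gz_r ?i w"
    using r(1) zariski_open_subset[OF U(1)] unfolding gz_rat_def mem_rat_class[OF n] by (metis IntI subsetD)
  have ri: "gz_r ?i = (\<lambda>z. eigval z n (k - 1))" using gz_r_eigval[OF i(1)] unfolding i(2,3) .
  have nk: "n \<in> {1..n}" "k - 1 < n" using n k by auto
  obtain G where G: "has_gradient n g z G"
    using regular_has_gradient[OF V(3) _ zariski_open_subset[OF V(1)]] z by blast
  note E = has_gradient_eigval[OF nk, of z]
  have "has_gradient n f z (eigproj n n (k - 1) z)"
    using has_gradient_cong[OF E U(1)] z e unfolding ri by blast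
  then have "gz_bracket n f g z = gz_bracket n (\<lambda>z. eigval z n (k - 1)) g z"
    using bracket_eq[OF zM E G] bracket_eq[OF zM _ G] by metis
  then show "gz_bracket n f g z = 0" using bracket_eigval_top[OF zM nk(2) G] by simp
qed

end

section \<open>Canonical relations for \<open>r_(i)\<close> and \<open>s_j\<close>\<close>

lemma bracket_quotient:
  assumes z: "z \<in> M_Omega_e n" and h: "has_gradient n h z H" and f: "has_gradient n f z A" and g: "has_gradient n g z B"
    and g0: "g z \<noteq> 0"
  shows "\<exists>D. has_gradient n (\<lambda>w. f w / g w) z D"
    and "gz_bracket n h (\<lambda>w. f w / g w) z = gz_bracket n h f z / g z - f z / g z ^ 2 * gz_bracket n h g z"
    and "gz_bracket n (\<lambda>w. f w / g w) h z = gz_bracket n f h z / g z - f z / g z ^ 2 * gz_bracket n g h z"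
proof -
  note c = M_Omega_eD(2)[OF z] has_gradientD(1)[OF h] has_gradientD(1)[OF f] has_gradientD(1)[OF g]
  define D where "D = inverse (g z) \<cdot>\<^sub>m A + f z \<cdot>\<^sub>m ((- inverse (g z ^ 2)) \<cdot>\<^sub>m B)"
  have D: "has_gradient n (\<lambda>w. f w / g w) z D"
    using has_gradient_mult[OF f has_gradient_inverse[OF g g0]] by (simp add: D_def divide_inverse)
  then show "\<exists>D. has_gradient n (\<lambda>w. f w / g w) z D" by blast
  let ?Y = "snd z * H - H * snd z"
  have Y: "?Y \<in> carrier_mat n n" using c by auto
  have D': "D = inverse (g z) \<cdot>\<^sub>m A + (f z * (- inverse (g z ^ 2))) \<cdot>\<^sub>m B"
    using c by (intro eq_matI) (auto simp: D_def)
  show R: "gz_bracket n h (\<lambda>w. f w / g w) z = gz_bracket n h f z / g z - f z / g z ^ 2 * gz_bracket n h g z"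
    unfolding bracket_eq[OF z h D] bracket_eq[OF z h f] bracket_eq[OF z h g]
    unfolding D' matrix_trace_linear_left[OF c(3,4) Y] by (simp add: divide_inverse)
  show "gz_bracket n (\<lambda>w. f w / g w) h z = gz_bracket n f h z / g z - f z / g z ^ 2 * gz_bracket n g h z"
    unfolding bracket_antisym[OF z h D] bracket_antisym[OF z h f] bracket_antisym[OF z h g] R by simp
qed

lemma gz_r_s_brackets:
  assumes z: "z \<in> M_Omega_e n" and i: "i \<in> {1..gz_d (n - 1)}" and j: "j \<in> {1..gz_d (n - 1)}"
  shows "gz_bracket n (gz_r i) (gz_r j) z = 0"
    and "gz_bracket n (gz_r i) (gz_s n j) z = (if i = j then gz_s n j z else 0)"
    and "gz_bracket n (gz_s n i) (gz_s n j) z = 0"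
    and "\<exists>G. has_gradient n (gz_r i) z G" "\<exists>G. has_gradient n (gz_s n i) z G"
proof -
  note I = gz_index_range[OF i] and J = gz_index_range[OF j]
  note ri = gz_r_eigval[OF I(1)] and rj = gz_r_eigval[OF J(1)]
  have r: "has_gradient n (gz_r i) z (eigproj n (gz_level i) (gz_position i - 1) z)"
    unfolding ri by (rule has_gradient_eigval[OF I(5,4)])
  then show "\<exists>G. has_gradient n (gz_r i) z G" by blast
  obtain A B where A: "has_gradient n (sval_index i) z A" and B: "has_gradient n (sval_index j) z B"
    unfolding sval_index_def using sval_has_gradient[OF z I(2-4)] sval_has_gradient[OF z J(2-4)] by blast
  have A': "has_gradient n (gz_s n i) z A" and B': "has_gradient n (gz_s n j) z B"
    using has_gradient_cong[OF A zariski_open_UNIV z] has_gradient_cong[OF B zariski_open_UNIV z] gz_s_eq[OF _ i] gz_s_eq[OF _ j]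
    by blast+
  then show "\<exists>G. has_gradient n (gz_s n i) z G" by blast
  show "gz_bracket n (gz_r i) (gz_r j) z = 0"
    unfolding ri rj by (rule bracket_eigval_eigval[OF z I(5,4) J(5,4)])
  have "gz_bracket n (gz_r i) (gz_s n j) z = gz_bracket n (gz_r i) (sval_index j) z"
    unfolding bracket_eq[OF z r B] bracket_eq[OF z r B'] ..
  also have "\<dots> = (if gz_level i = gz_level j \<and> gz_position i - 1 = gz_position j - 1 then sval_index j z else 0)"
    unfolding ri sval_index_def by (rule bracket_eigval_sval[OF z I(5,4) J(2-4)])
  also have "\<dots> = (if i = j then gz_s n j z else 0)"
  proof -
    have "gz_level i = gz_level j \<and> gz_position i - 1 = gz_position j - 1 \<longleftrightarrow> i = j"
      using gz_index_eq[OF I(1) J(1)] gz_level_position(2)[OF I(1)] gz_level_position(2)[OF J(1)] by auto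
    then show ?thesis using gz_s_eq[OF z j] by simp
  qed
  finally show "gz_bracket n (gz_r i) (gz_s n j) z = (if i = j then gz_s n j z else 0)" .
  have "gz_bracket n (gz_s n i) (gz_s n j) z = gz_bracket n (sval_index i) (sval_index j) z"
    unfolding bracket_eq[OF z A B] bracket_eq[OF z A' B'] ..
  also have "\<dots> = 0" unfolding sval_index_def by (rule bracket_sval_sval[OF z I(2-4) J(2-4)])
  finally show "gz_bracket n (gz_s n i) (gz_s n j) z = 0" .
qed

text \<open>All of it follows by the quotient rule from \<open>[r_i, s_j] = \<delta>_ij s_j\<close>
  and the vanishing of the other brackets. Division by \<open>s_i\<close> turns the right side into
  \<open>\<delta>_ij\<close>; in the bracket of two quotients the only possible contributions occur
  for \<open>i = j\<close>, and they cancel.\<close>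

lemma canonical_brackets:
  assumes z: "z \<in> M_Omega_e n" and i: "i \<in> {1..gz_d (n - 1)}" and j: "j \<in> {1..gz_d (n - 1)}"
  shows "gz_bracket n (gz_r_over_s n i) (gz_s n j) z = (if i = j then 1 else 0)"
    and "gz_bracket n (gz_r_over_s n i) (gz_r_over_s n j) z = 0"
proof -
  obtain A B C D where ri: "has_gradient n (gz_r i) z A" and si: "has_gradient n (gz_s n i) z B"
    and rj: "has_gradient n (gz_r j) z C" and sj: "has_gradient n (gz_s n j) z D"
    using gz_r_s_brackets(4,5)[OF z i i] gz_r_s_brackets(4,5)[OF z j j] by blast
  note nz = gz_s_nonzero[OF z i] gz_s_nonzero[OF z j]
  have rs: "gz_r_over_s n l = (\<lambda>w. gz_r l w / gz_s n l w)" for l by (simp add: gz_r_over_s_def[abs_def])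
  show 1: "gz_bracket n (gz_r_over_s n i) (gz_s n j) z = (if i = j then 1 else 0)"
    unfolding rs bracket_quotient(3)[OF z sj ri si nz(1)] gz_r_s_brackets(2,3)[OF z i j] using nz by simp
  obtain E where E: "has_gradient n (gz_r_over_s n i) z E"
    unfolding rs using bracket_quotient(1)[OF z ri ri si nz(1)] by blast
  have "gz_bracket n (gz_s n i) (gz_r j) z = - (if j = i then gz_s n i z else 0)"
    unfolding bracket_antisym[OF z rj si] gz_r_s_brackets(2)[OF z j i] ..
  then have 2: "gz_bracket n (gz_r_over_s n i) (gz_r j) z = (if i = j then gz_r i z / gz_s n i z else 0)"
    unfolding rs bracket_quotient(3)[OF z rj ri si nz(1)] gz_r_s_brackets(1)[OF z i j]
    using nz by (auto simp: power2_eq_square)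
  show "gz_bracket n (gz_r_over_s n i) (gz_r_over_s n j) z = 0"
    unfolding rs[of j] bracket_quotient(2)[OF z E rj sj nz(2)] 1 2 by (simp add: power2_eq_square)
qed

theorem theorem5p24:
  fixes n :: nat
  assumes "n \<ge> 1"
  shows
    "(\<forall>i \<in> {1..gz_d (n - 1)}.
        (\<forall>z \<in> M_Omega_e n. gz_s n i z \<noteq> 0) \<and>
        (\<lambda>z. inverse (gz_s n i z)) \<in> gz_O n \<and>
        gz_r_over_s n i \<in> gz_O n) \<and>
     is_rational_function_field (gz_F n) (gz_scalars n) {1..n ^ 2} (gz_generator n) \<and>
     (\<forall>k \<in> {1..n}. \<forall>\<phi> \<in> carrier (gz_F n).
        gz_F_bracket n (gz_rat n (gz_r (gz_d (n - 1) + k))) \<phi> = \<zero>\<^bsub>gz_F n\<^esub>) \<and>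
     (\<forall>i \<in> {1..gz_d (n - 1)}. \<forall>j \<in> {1..gz_d (n - 1)}.
        gz_F_bracket n (gz_rat n (gz_r_over_s n i)) (gz_rat n (gz_r_over_s n j)) = \<zero>\<^bsub>gz_F n\<^esub> \<and>
        gz_F_bracket n (gz_rat n (gz_r_over_s n i)) (gz_rat n (gz_s n j)) =
          (if i = j then \<one>\<^bsub>gz_F n\<^esub> else \<zero>\<^bsub>gz_F n\<^esub>) \<and>
        gz_F_bracket n (gz_rat n (gz_s n i)) (gz_rat n (gz_s n j)) = \<zero>\<^bsub>gz_F n\<^esub>)"
proof (intro conjI ballI)
  note s = closure_param_regular[OF gz_s_closure] and q = closure_param_regular[OF gz_r_over_s_closure]
  show "gz_s n i z \<noteq> 0" if "i \<in> {1..gz_d (n - 1)}" "z \<in> M_Omega_e n" for i z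
    by (rule gz_s_nonzero[OF that(2,1)])
  show "(\<lambda>z. inverse (gz_s n i z)) \<in> gz_O n" if "i \<in> {1..gz_d (n - 1)}" for i
    by (rule closure_param_regular[OF rat_closure.inverse[OF gz_s_closure[OF that]]])
      (use gz_s_nonzero[OF _ that] in blast)
  show "gz_r_over_s n i \<in> gz_O n" if "i \<in> {1..gz_d (n - 1)}" for i by (rule q[OF that])
  show "is_rational_function_field (gz_F n) (gz_scalars n) {1..n ^ 2} (gz_generator n)"
    by (rule rational_function_field[OF assms])
  show "gz_F_bracket n (gz_rat n (gz_r (gz_d (n - 1) + k))) \<phi> = \<zero>\<^bsub>gz_F n\<^esub>"
    if "k \<in> {1..n}" "\<phi> \<in> carrier (gz_F n)" for k \<phi>
    by (rule F_bracket_top[OF assms that])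
  fix i j assume i: "i \<in> {1..gz_d (n - 1)}" and j: "j \<in> {1..gz_d (n - 1)}"
  show "gz_F_bracket n (gz_rat n (gz_r_over_s n i)) (gz_rat n (gz_r_over_s n j)) = \<zero>\<^bsub>gz_F n\<^esub>"
    unfolding rat_zero[OF assms] by (rule F_bracket_const[OF assms q[OF i] q[OF j] canonical_brackets(2)[OF _ i j]])
  \<comment> \<open>For fixed \<open>i\<close> and \<open>j\<close> the Kronecker delta is a
    constant, so both cases are treated at once.\<close>
  have "gz_F_bracket n (gz_rat n (gz_r_over_s n i)) (gz_rat n (gz_s n j)) = gz_rat n (\<lambda>_. if i = j then 1 else 0)"
    by (rule F_bracket_const[OF assms q[OF i] s[OF j] canonical_brackets(1)[OF _ i j]])
  then show "gz_F_bracket n (gz_rat n (gz_r_over_s n i)) (gz_rat n (gz_s n j)) =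
      (if i = j then \<one>\<^bsub>gz_F n\<^esub> else \<zero>\<^bsub>gz_F n\<^esub>)"
    by (simp add: rat_zero[OF assms] rat_one[OF assms])
  show "gz_F_bracket n (gz_rat n (gz_s n i)) (gz_rat n (gz_s n j)) = \<zero>\<^bsub>gz_F n\<^esub>"
    unfolding rat_zero[OF assms] by (rule F_bracket_const[OF assms s[OF i] s[OF j] gz_r_s_brackets(3)[OF _ i j]])
qed

end
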